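(* Assume that $\Lambda\subset\mathbb{D}$ is a sequence satisfying the Blaschke condition $\sum_{\lambda\in\Lambda}(1-|\lambda|)<\infty$ and that $\Lambda$ lies in a finite union of Stolz angles. (a) $\Lambda\in\mathrm{Int}\,N^+$ if and only if $\displaystyle\lim_{|\lambda|\to1,\ \lambda\in\Lambda}(1-|\lambda|)\log|B_\lambda(\lambda)|^{-1}=0$. (b) $\Lambda\in\mathrm{Int}\,N$ if and only if $\displaystyle\sup_{\lambda\in\Lambda}(1-|\lambda|)\log|B_\lambda(\lambda)|^{-1}<\infty$.
   Context: $\mathbb{D}$ is the open unit disc. A sequence $\Lambda\subset\mathbb{D}$ means a discrete sequence of (distinct) points. The Stolz angle with vertex $\zeta\in\partial\mathbb{D}$ and aperture $\alpha>0$ is $\Gamma_\alpha(\zeta)=\{z\in\mathbb{D}:|z-\zeta|\le\alpha(1-|z|^2)\}$. For $\lambda\in\mathbb{D}$, $b_\lambda(z)=\frac{|\lambda|}{\lambda}\frac{\lambda-z}{1-\overline{\lambda}z}$ ($b_0(z)=z$); for $\lambda\in\Lambda$, $B_\lambda=\prod_{\lambda'\in\Lambda\setminus\{\lambda\}}b_{\lambda'}$. The Nevanlinna class is $N=\{f\in\mathrm{Hol}(\mathbb{D}):\lim_{r\to1}\frac1{2\pi}\int_0^{2\pi}\log^+|f(re^{i\theta})|\,d\theta<\infty\}$, and the Smirnov class $N^+$ is the set of $f\in N$ with $\lim_{r\to1}\frac1{2\pi}\int_0^{2\pi}\log^+|f(re^{i\theta})|\,d\theta=\frac1{2\pi}\int_0^{2\pi}\log^+|f(e^{i\theta})|\,d\theta$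 (non-tangential boundary values). For a space $X$ of holomorphic functions on $\mathbb{D}$, $X|\Lambda=\{(f(\lambda))_{\lambda\in\Lambda}:f\in X\}$, and $\Lambda\in\mathrm{Int}\,X$ ($\Lambda$ is free interpolating for $X$) means that $X|\Lambda$ is ideal: $(a_\lambda)\in X|\Lambda$ and $(\omega_\lambda)\in\ell^\infty$ imply $(\omega_\lambda a_\lambda)\in X|\Lambda$. *)

theory Defs
  imports "HOL-Analysis.Analysis"
begin

abbreviation unit_disc :: "complex set" where
  "unit_disc \<equiv> ball 0 1"

definition stolz_angle :: "real \<Rightarrow> complex \<Rightarrow> complex set" where
  "stolz_angle \<alpha> \<zeta> = {z \<in> unit_disc. cmod (z - \<zeta>) \<le> \<alpha> * (1 - (cmod z)\<^sup>2)}"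

definition in_finite_union_stolz_angles :: "complex set \<Rightarrow> bool" where
  "in_finite_union_stolz_angles \<Lambda> \<longleftrightarrow>
     (\<exists>V :: (real \<times> complex) set.
        finite V \<and> (\<forall>(\<alpha>, \<zeta>) \<in> V. 0 < \<alpha> \<and> cmod \<zeta> = 1) \<and>
        \<Lambda> \<subseteq> (\<Union>(\<alpha>, \<zeta>) \<in> V. stolz_angle \<alpha> \<zeta>))"

definition blaschke_factor :: "complex \<Rightarrow> complex \<Rightarrow> complex" where
  "blaschke_factor \<mu> z =
     (if \<mu> = 0 then z else of_real (cmod \<mu>) / \<mu> * ((\<mu> - z) / (1 - cnj \<mu> * z)))"

text \<open>
  The Blaschke product over the points of \<open>\<Lambda>\<close> other than \<open>\<mu>\<close>.  There is no enumeration of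
  \<open>\<Lambda>\<close>: the infinite product is the limit of the finite partial products along the directed
  family of finite subsets (unconditional convergence, as for \<^const>\<open>infsum\<close>).  The limit
  exists whenever \<open>\<Lambda>\<close> satisfies the Blaschke condition.
\<close>
definition blaschke_product_omit :: "complex set \<Rightarrow> complex \<Rightarrow> complex \<Rightarrow> complex" where
  "blaschke_product_omit \<Lambda> \<mu> z =
     Lim (finite_subsets_at_top (\<Lambda> - {\<mu>})) (\<lambda>F. \<Prod>\<nu>\<in>F. blaschke_factor \<nu> z)"

definition log_plus :: "real \<Rightarrow> real" where
  "log_plus x = ln (max 1 x)"

definition circle_log_mean :: "(complex \<Rightarrow> complex) \<Rightarrow> real \<Rightarrow> real" where
  "circle_log_mean f r =
     1 / (2 * pi) * (LINT \<theta>:{0..2 * pi}|lebesgue. log_plus (cmod (f (of_real r * cis \<theta>))))"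

definition nevanlinna_class :: "(complex \<Rightarrow> complex) set" where
  "nevanlinna_class =
     {f. f holomorphic_on unit_disc \<and> (\<exists>L::real. (circle_log_mean f \<longlongrightarrow> L) (at_left 1))}"

text \<open>
  Apertures \<open>\<alpha> \<le> 1/2\<close> give empty Stolz angles and hence impose no condition; all larger
  apertures do accumulate at the vertex, so the limit is unique.
\<close>
definition has_nontangential_limit :: "(complex \<Rightarrow> complex) \<Rightarrow> complex \<Rightarrow> complex \<Rightarrow> bool" where
  "has_nontangential_limit f \<zeta> l \<longleftrightarrow> (\<forall>\<alpha>>0. (f \<longlongrightarrow> l) (at \<zeta> within stolz_angle \<alpha> \<zeta>))"

text \<open>
  Unspecified where no non-tangential limit exists; for functions of the Nevanlinna class this
  concerns only a null set of the circle, which the Lebesgue integral below ignores.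
\<close>
definition boundary_value :: "(complex \<Rightarrow> complex) \<Rightarrow> complex \<Rightarrow> complex" where
  "boundary_value f \<zeta> = (THE l. has_nontangential_limit f \<zeta> l)"

definition smirnov_class :: "(complex \<Rightarrow> complex) set" where
  "smirnov_class =
     {f \<in> nevanlinna_class.
        (circle_log_mean f \<longlongrightarrow>
           1 / (2 * pi) *
             (LINT \<theta>:{0..2 * pi}|lebesgue. log_plus (cmod (boundary_value f (cis \<theta>)))))
          (at_left 1)}"

definition trace_space :: "(complex \<Rightarrow> complex) set \<Rightarrow> complex set \<Rightarrow> (complex \<Rightarrow> complex) set" where
  "trace_space X \<Lambda> = (\<lambda>f. restrict f \<Lambda>) ` X"

definition free_interpolating :: "complex set \<Rightarrow> (complex \<Rightarrow> complex) set \<Rightarrow> bool" where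
  "free_interpolating \<Lambda> X \<longleftrightarrow>
     (\<forall>a \<in> trace_space X \<Lambda>. \<forall>\<omega> :: complex \<Rightarrow> complex.
        bounded (\<omega> ` \<Lambda>) \<longrightarrow> (\<lambda>\<mu>\<in>\<Lambda>. \<omega> \<mu> * a \<mu>) \<in> trace_space X \<Lambda>)"

end

(*
  For points in finitely many Stolz angles a Nevanlinna function satisfies log+|f| <= C/(1-|z|),
  and a Smirnov function even (1-|z|) log+|f(z)| -> 0.  Conversely, sums of Herglotz kernels with
  poles at the vertices (or slightly outside the disc, which makes them quasi-bounded) are positive
  harmonic functions Re H of the size c/(1-|z|) at the points of Lambda.  If Re H dominates
  log+|a| + log(1/|B|) + log(1/(1-|.|)) on Lambda, then g = e^H G with the absolutely convergent
  series G = sum of c_l B_l, |c_l| <= const (1-|l|), interpolates any bounded multiple of a.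
  For necessity, interpolate 1 on a very sparse subset and 0 elsewhere, and divide out finitely
  many zeros.

  Subharmonicity of log+|f| is replaced by majorants |f| <= exp(Re p), where Re p is a trigonometric
  polynomial approximating log+|f| on a circle.  That the boundary values in the definition of the
  Smirnov class exist almost everywhere is Fatou's theorem: bounded functions have nontangential
  limits by a maximal inequality, and a normal families limit of the functions exp(-p) writes a
  Nevanlinna function as a quotient of bounded ones.
*)

theory Submission
  imports Defs "HOL-Complex_Analysis.Complex_Analysis"
begin

section \<open>Circle means and the Poisson formula\<close>

text \<open>A positive harmonic function grows at most like a constant over 1 - |z|, and a Poisson
  kernel attains this rate in the Stolz angles at its pole. On Lambda upper bound and construction
  therefore match up to constants, which is why the existence of a harmonic majorant reduces to a
  size condition. The angles help once more: Lambda accumulates only at the finitely many vertices,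
  so Blaschke products and interpolating series are continuous on the closed disc without the
  vertices, and their boundary values are plain values. Free interpolation yields a function for
  each datum but no bound on it. Necessity therefore tests a whole bad sequence with one datum, so
  that a single function, with its single growth constant, meets all the bad points; sparseness
  keeps the other points of the sequence from masking the zeros. A pole moved off the circle serves
  only points of Lambda at least as far from the circle as the pole, so the masses must shrink along
  with the shifts; the little-o in (a) is exactly what permits this.\<close>

abbreviation circ :: "real measure" where
  "circ \<equiv> lebesgue_on {0..2 * pi}"

definition cmean :: "(real \<Rightarrow> real) \<Rightarrow> real" where
  "cmean u = (\<integral>\<theta>. u \<theta> \<partial>circ) / (2 * pi)"

lemma circle_log_mean_eq_cmean:
  "circle_log_mean f r = cmean (\<lambda>\<theta>. log_plus (cmod (f (of_real r * cis \<theta>))))"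
  unfolding circle_log_mean_def cmean_def set_lebesgue_integral_def
  by (simp add: integral_restrict_space)

lemma integrable_circ:
  fixes u :: "real \<Rightarrow> 'b::euclidean_space"
  shows "continuous_on {0..2*pi} u \<Longrightarrow> integrable circ u"
  by (rule continuous_imp_integrable_real)

lemma integrable_circ_cis:
  fixes u :: "complex \<Rightarrow> 'b::euclidean_space"
  assumes "continuous_on (sphere 0 1) u"
  shows "integrable circ (\<lambda>\<theta>. u (cis \<theta>))"
proof (rule integrable_circ)
  show "continuous_on {0..2*pi} (\<lambda>\<theta>. u (cis \<theta>))"
    by (rule continuous_on_compose2[OF assms]) (auto intro!: continuous_intros)
qed

lemma cmean_mono:
  assumes "integrable circ u" "integrable circ v" "\<And>\<theta>. u \<theta> \<le> v \<theta>"
  shows "cmean u \<le> cmean v"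
  unfolding cmean_def using assms by (intro divide_right_mono integral_mono) auto

lemma finite_measure_circ: "finite_measure circ"
  by (rule finite_measureI) (simp add: emeasure_restrict_space)

lemma cmean_const [simp]: "cmean (\<lambda>_. c) = c"
  unfolding cmean_def by (simp add: measure_restrict_space)

lemma cmean_add:
  "integrable circ u \<Longrightarrow> integrable circ v \<Longrightarrow> cmean (\<lambda>\<theta>. u \<theta> + v \<theta>) = cmean u + cmean v"
  unfolding cmean_def by (simp add: add_divide_distrib)

lemma cmean_diff:
  "integrable circ u \<Longrightarrow> integrable circ v \<Longrightarrow> cmean (\<lambda>\<theta>. u \<theta> - v \<theta>) = cmean u - cmean v"
  unfolding cmean_def by (simp add: diff_divide_distrib)

lemma cmean_nonneg: "(\<And>\<theta>. 0 \<le> u \<theta>) \<Longrightarrow> 0 \<le> cmean u"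
  unfolding cmean_def by simp

definition poisson_kernel :: "complex \<Rightarrow> real \<Rightarrow> real" where
  "poisson_kernel z t = (1 - (cmod z)\<^sup>2) / (cmod (cis t - z))\<^sup>2"

lemma poisson_kernel_nonneg: "cmod z \<le> 1 \<Longrightarrow> 0 \<le> poisson_kernel z t"
  unfolding poisson_kernel_def by (simp add: abs_square_le_1)

lemma poisson_kernel_le:
  assumes "cmod z < 1"
  shows "poisson_kernel z t \<le> 2 / (1 - cmod z)"
proof -
  have "1 - cmod z \<le> cmod (cis t - z)"
    using norm_triangle_ineq2[of "cis t" z] by simp
  then have "(1 - cmod z)\<^sup>2 \<le> (cmod (cis t - z))\<^sup>2"
    using assms by (intro power_mono) auto
  then have "poisson_kernel z t \<le> (1 - (cmod z)\<^sup>2) / (1 - cmod z)\<^sup>2"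
    unfolding poisson_kernel_def using assms
    by (intro divide_left_mono mult_pos_pos) (auto simp: abs_square_le_1)
  also have "\<dots> = (1 + cmod z) / (1 - cmod z)"
  proof -
    have "1 - (cmod z)\<^sup>2 = (1 + cmod z) * (1 - cmod z)" by (simp add: power2_eq_square algebra_simps)
    then show ?thesis using assms by (simp add: power2_eq_square)
  qed
  also have "\<dots> \<le> 2 / (1 - cmod z)"
    using assms by (intro divide_right_mono) auto
  finally show ?thesis .
qed

lemma continuous_on_poisson_kernel:
  assumes "cmod z < 1"
  shows "continuous_on A (poisson_kernel z)"
proof -
  have "cis t \<noteq> z" for t using assms by (metis norm_cis less_irrefl)
  then show ?thesis unfolding poisson_kernel_def by (auto intro!: continuous_intros)
qed

text \<open>Apply Cauchy's formula to \<open>w \<mapsto> f w (1 - \<bar>z\<bar>\<^sup>2) / (1 - cnj z w)\<close>.\<close>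
lemma Poisson_formula:
  fixes f :: "complex \<Rightarrow> complex"
  assumes f: "continuous_on (cball 0 1) f" "f holomorphic_on ball 0 1" and z: "cmod z < 1"
  shows "(\<integral>t. complex_of_real (poisson_kernel z t) * f (cis t) \<partial>circ) = 2 * pi * f z"
proof -
  define k where "k w = f w * of_real (1 - (cmod z)\<^sup>2) / (1 - cnj z * w)" for w
  have nz: "1 - cnj z * w \<noteq> 0" if "cmod w \<le> 1" for w
  proof
    assume "1 - cnj z * w = 0"
    then have "cmod (cnj z * w) = 1" by (metis eq_iff_diff_eq_0 norm_one)
    moreover have "cmod (cnj z * w) \<le> cmod z * 1" 
      unfolding norm_mult by (intro mult_mono) (use that in auto)
    ultimately show False using z by simp
  qed
  have "continuous_on (cball 0 1) k"
    unfolding k_def using nz by (intro continuous_intros f) auto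
  moreover have "k holomorphic_on ball 0 1"
    unfolding k_def using nz by (intro holomorphic_intros f) auto
  ultimately have "((\<lambda>u. k u / (u - z)) has_contour_integral (2 * of_real pi * \<i> * k z)) (circlepath 0 1)"
    using z by (intro Cauchy_integral_circlepath) auto
  then have "((\<lambda>t. k (cis t) / (cis t - z) * \<i> * cis t) has_integral (2 * of_real pi * \<i> * k z)) {0..2*pi}"
    unfolding circlepath_def by (subst (asm) has_contour_integral_part_circlepath_iff) auto
  moreover have "k (cis t) / (cis t - z) * \<i> * cis t = \<i> * (complex_of_real (poisson_kernel z t) * f (cis t))" for t
  proof -
    have 1: "cis t - z \<noteq> 0" using z by (metis eq_iff_diff_eq_0 norm_cis less_irrefl)
    \<comment> \<open>On the circle \<open>cis t\<close> is inverse to its conjugate. The factor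
      \<open>cis t\<close> produced here cancels the one from the derivative of the path, and the
      remaining two factors form the squared modulus in the Poisson kernel.\<close>
    have "1 - cnj z * cis t = cis t * cnj (cis t - z)"
      by (simp add: algebra_simps cis_cnj cis_mult)
    then have "k (cis t) / (cis t - z) * \<i> * cis t
      = f (cis t) * of_real (1 - (cmod z)\<^sup>2) / (cis t * cnj (cis t - z)) / (cis t - z) * \<i> * cis t"
      unfolding k_def by simp
    also have "\<dots> = \<i> * (of_real (1 - (cmod z)\<^sup>2) / ((cis t - z) * cnj (cis t - z)) * f (cis t))"
      by (simp add: divide_simps)
    also have "\<dots> = \<i> * (complex_of_real (poisson_kernel z t) * f (cis t))"
      unfolding poisson_kernel_def of_real_divide by (simp only: complex_norm_square)
    finally show ?thesis .
  qed
  moreover have "k z = f z"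
  proof -
    have "1 - cnj z * z = 1 - (cmod z)\<^sup>2" using complex_norm_square[of z] by (simp add: mult.commute)
    then show ?thesis using nz[of z] z unfolding k_def by simp
  qed
  ultimately have "((\<lambda>t. \<i> * (complex_of_real (poisson_kernel z t) * f (cis t))) has_integral (\<i> * (2 * of_real pi * f z))) {0..2*pi}"
    by (simp add: mult_ac)
  then have I: "((\<lambda>t. complex_of_real (poisson_kernel z t) * f (cis t)) has_integral (2 * of_real pi * f z)) {0..2*pi}"
    by (drule_tac has_integral_mult_right[where c = "-\<i>"]) simp
  have "continuous_on {0..2*pi} (\<lambda>t. f (cis t))"
    by (rule continuous_on_compose2[OF f(1)]) (auto intro!: continuous_intros)
  then have "integrable circ (\<lambda>t. complex_of_real (poisson_kernel z t) * f (cis t))"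
    by (intro integrable_circ continuous_intros continuous_on_poisson_kernel z)
  then show ?thesis using I by (simp add: lebesgue_integral_eq_integral integral_unique)
qed

lemma Poisson_formula_Re:
  fixes f :: "complex \<Rightarrow> complex"
  assumes f: "continuous_on (cball 0 1) f" "f holomorphic_on ball 0 1" and z: "cmod z < 1"
  shows "cmean (\<lambda>t. poisson_kernel z t * Re (f (cis t))) = Re (f z)"
proof -
  have "continuous_on {0..2*pi} (\<lambda>t. f (cis t))"
    by (rule continuous_on_compose2[OF f(1)]) (auto intro!: continuous_intros)
  then have "integrable circ (\<lambda>t. complex_of_real (poisson_kernel z t) * f (cis t))"
    by (intro integrable_circ continuous_intros continuous_on_poisson_kernel z)
  then have "(\<integral>t. Re (complex_of_real (poisson_kernel z t) * f (cis t)) \<partial>circ) = Re (2 * pi * f z)"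
    using Poisson_formula[OF assms] by (simp only: integral_Re)
  then show ?thesis unfolding cmean_def by simp
qed

lemma mean_value_Re:
  fixes f :: "complex \<Rightarrow> complex"
  assumes f: "continuous_on (cball 0 1) f" "f holomorphic_on ball 0 1"
  shows "cmean (\<lambda>t. Re (f (cis t))) = Re (f 0)"
  using Poisson_formula_Re[OF f, of 0] by (simp add: poisson_kernel_def)

lemma Re_nonneg_on_ball:
  fixes f :: "complex \<Rightarrow> complex"
  assumes f: "continuous_on (cball 0 1) f" "f holomorphic_on ball 0 1"
    and "\<And>w. cmod w = 1 \<Longrightarrow> 0 \<le> Re (f w)" and z: "cmod z \<le> 1"
  shows "0 \<le> Re (f z)"
proof (cases "cmod z = 1")
  case False
  then have "Re (f z) = cmean (\<lambda>t. poisson_kernel z t * Re (f (cis t)))"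
    using Poisson_formula_Re[OF f] z by simp
  also have "\<dots> \<ge> 0" using assms by (intro cmean_nonneg mult_nonneg_nonneg poisson_kernel_nonneg) auto
  finally show ?thesis .
qed (use assms in auto)

text \<open>Nonnegative boundary values may be integrated against an upper bound of the Poisson
  kernel instead of the kernel itself. This is the source of the factor
  \<open>2 / (1 - cmod z)\<close> in all growth estimates below.\<close>

lemma Harnack_upper:
  fixes f :: "complex \<Rightarrow> complex"
  assumes f: "continuous_on (cball 0 1) f" "f holomorphic_on ball 0 1"
    and pos: "\<And>w. cmod w = 1 \<Longrightarrow> 0 \<le> Re (f w)" and z: "cmod z < 1"
  shows "Re (f z) \<le> 2 / (1 - cmod z) * Re (f 0)"
proof -
  have c: "continuous_on {0..2*pi} (\<lambda>t. f (cis t))"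
    by (rule continuous_on_compose2[OF f(1)]) (auto intro!: continuous_intros)
  have "Re (f z) = cmean (\<lambda>t. poisson_kernel z t * Re (f (cis t)))"
    using Poisson_formula_Re[OF f z] by simp
  also have "\<dots> \<le> cmean (\<lambda>t. 2 / (1 - cmod z) * Re (f (cis t)))"
    using pos z c
    by (intro cmean_mono mult_right_mono poisson_kernel_le integrable_circ)
       (auto intro!: continuous_intros continuous_on_poisson_kernel)
  also have "\<dots> = 2 / (1 - cmod z) * cmean (\<lambda>t. Re (f (cis t)))"
    unfolding cmean_def by simp
  also have "\<dots> = 2 / (1 - cmod z) * Re (f 0)"
    using mean_value_Re[OF f] by simp
  finally show ?thesis .
qed

section \<open>Trigonometric polynomials and harmonic majorants of continuous functions\<close>

lemma real_part_monomial_product: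
  fixes z a b :: complex
  assumes "cmod z = 1" "n \<le> m"
  shows "Re (a * z ^ m) * Re (b * z ^ n) = Re (a * b / 2 * z ^ (m + n) + a * cnj b / 2 * z ^ (m - n))"
proof -
  have "z ^ (m - n) = z ^ m * cnj (z ^ n)"
  proof -
    have "z ^ n * cnj (z ^ n) = 1"
      using assms complex_norm_square[of "z ^ n"] by (simp add: norm_power)
    moreover have "z ^ m = z ^ (m - n) * z ^ n" using assms by (simp flip: power_add)
    ultimately show ?thesis by (simp add: mult.assoc)
  qed
  then have eq: "a * b / 2 * z ^ (m + n) + a * cnj b / 2 * z ^ (m - n) =
      (a * z ^ m) * (b * z ^ n) / 2 + (a * z ^ m) * cnj (b * z ^ n) / 2"
    by (simp add: power_add mult_ac)
  have "Re x * Re y = Re (x * y / 2 + x * cnj y / 2)" for x y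
    by (simp add: field_simps)
  then show ?thesis unfolding eq .
qed

text \<open>Only values on the circle are prescribed. There conjugation inverts \<open>z\<close>, so
  products of real parts of polynomials are again of this kind, and the set is a function ring in
  the sense of Stone-Weierstrass.\<close>

definition trig_polys :: "(complex \<Rightarrow> real) set" where
  "trig_polys = {f. \<exists>p::complex poly. \<forall>z\<in>sphere 0 1. f z = Re (poly p z)}"

lemma trig_polys_add: "f \<in> trig_polys \<Longrightarrow> g \<in> trig_polys \<Longrightarrow> (\<lambda>z. f z + g z) \<in> trig_polys"
  unfolding trig_polys_def by clarsimp (metis poly_add plus_complex.sel(1))

lemma trig_polys_sum:
  "finite I \<Longrightarrow> (\<And>i. i \<in> I \<Longrightarrow> f i \<in> trig_polys) \<Longrightarrow> (\<lambda>z. \<Sum>i\<in>I. f i z) \<in> trig_polys"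
proof (induction I rule: finite_induct)
  case empty
  show ?case unfolding trig_polys_def by (auto intro!: exI[of _ 0])
qed (auto intro: trig_polys_add)

lemma trig_polys_monom_mult:
  "(\<lambda>z. Re (a * z ^ m) * Re (b * z ^ n)) \<in> trig_polys"
proof (induction m n arbitrary: a b rule: linorder_wlog)
  case (le n m)
  show ?case unfolding trig_polys_def mem_Collect_eq
  proof (intro exI ballI)
    fix z :: complex assume "z \<in> sphere 0 1"
    then have "Re (b * z ^ m) * Re (a * z ^ n) = Re (poly (monom (b * a / 2) (m + n) + monom (b * cnj a / 2) (m - n)) z)"
      using real_part_monomial_product[of z n m b a] le by (simp only: poly_add poly_monom) (simp add: mult.commute)
    then show "Re (a * z ^ n) * Re (b * z ^ m) = Re (poly (monom (b * a / 2) (m + n) + monom (b * cnj a / 2) (m - n)) z)"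
      by (simp only: mult.commute)
  qed
next
  case (sym n m)
  show ?case using sym[of b a] by (simp add: mult.commute)
qed

lemma trig_polys_mult:
  assumes "f \<in> trig_polys" "g \<in> trig_polys" shows "(\<lambda>z. f z * g z) \<in> trig_polys"
proof -
  obtain p q where p: "\<And>z. z \<in> sphere 0 1 \<Longrightarrow> f z = Re (poly p z)" and q: "\<And>z. z \<in> sphere 0 1 \<Longrightarrow> g z = Re (poly q z)"
    using assms unfolding trig_polys_def by auto
  have "(\<lambda>z. \<Sum>i\<le>degree p. \<Sum>j\<le>degree q. Re (coeff p i * z ^ i) * Re (coeff q j * z ^ j)) \<in> trig_polys"
    by (intro trig_polys_sum trig_polys_monom_mult) auto
  moreover have "(\<Sum>i\<le>degree p. \<Sum>j\<le>degree q. Re (coeff p i * z ^ i) * Re (coeff q j * z ^ j)) = Re (poly p z) * Re (poly q z)" for z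
    unfolding poly_altdef Re_sum by (simp add: sum_product)
  ultimately show ?thesis unfolding trig_polys_def using p q by simp
qed

text \<open>Approximating \<open>v + e/2\<close> to within \<open>e/2\<close> yields a trigonometric
  polynomial that lies above \<open>v\<close>. It is the real part of an entire function on the
  circle, so its harmonic extension comes for free and its value at 0 is its mean; no Dirichlet
  problem has to be solved for \<open>v\<close>.\<close>

lemma trig_poly_majorant:
  fixes v :: "complex \<Rightarrow> real"
  assumes v: "continuous_on (sphere 0 1) v" and e: "e > 0"
  obtains h where "h holomorphic_on UNIV"
    "\<And>z. cmod z = 1 \<Longrightarrow> v z \<le> Re (h z)" "\<And>z. cmod z = 1 \<Longrightarrow> Re (h z) \<le> v z + e"
    "Re (h 0) \<le> cmean (\<lambda>t. v (cis t)) + e"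
proof -
  interpret function_ring_on trig_polys "sphere (0::complex) 1"
  proof
    show "continuous_on (sphere 0 1) f" if f: "f \<in> trig_polys" for f
    proof -
      obtain p where "\<And>z. z \<in> sphere 0 1 \<Longrightarrow> f z = Re (poly p z)" using f unfolding trig_polys_def by auto
      moreover have "continuous_on (sphere 0 1) (\<lambda>z. Re (poly p z))" by (intro continuous_intros)
      ultimately show ?thesis by (metis (no_types, lifting) continuous_on_cong)
    qed
    show "(\<lambda>_. c) \<in> trig_polys" for c
      unfolding trig_polys_def by (auto intro!: exI[of _ "[:of_real c:]"])
    fix x y :: complex assume "x \<noteq> y"
    then consider "Re x \<noteq> Re y" | "Im x \<noteq> Im y" using complex_eqI by blast
    then show "\<exists>f\<in>trig_polys. f x \<noteq> f y"
    proof cases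
      case 1 then show ?thesis by (intro bexI[of _ Re]) (auto simp: trig_polys_def intro!: exI[of _ "[:0, 1:]"])
    next
      case 2 then show ?thesis by (intro bexI[of _ Im]) (auto simp: trig_polys_def intro!: exI[of _ "[:0, -\<i>:]"])
    qed
  qed (auto intro: trig_polys_add trig_polys_mult)
  obtain g where g: "g \<in> trig_polys" "\<And>z. z \<in> sphere 0 1 \<Longrightarrow> \<bar>(v z + e/2) - g z\<bar> < e / 2"
    using Stone_Weierstrass_basic[of "\<lambda>z. v z + e/2" "e/2"] v e continuous_on_add[OF v continuous_on_const[of _ "e/2"]]
    by (metis half_gt_zero)
  obtain p where p: "\<And>z. z \<in> sphere 0 1 \<Longrightarrow> g z = Re (poly p z)" using g unfolding trig_polys_def by auto
  have h: "poly p holomorphic_on UNIV" by (intro holomorphic_intros)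
  have le: "v z \<le> Re (poly p z)" "Re (poly p z) \<le> v z + e" if "cmod z = 1" for z
    using g(2)[of z] p[of z] that by (auto simp: abs_if split: if_splits)
  have "Re (poly p 0) = cmean (\<lambda>t. Re (poly p (cis t)))"
    by (rule mean_value_Re[symmetric]) (auto intro!: continuous_intros holomorphic_intros)
  also have "\<dots> \<le> cmean (\<lambda>t. v (cis t) + e)"
    using le v by (intro cmean_mono integrable_circ_cis) (auto intro!: continuous_intros integrable_circ_cis)
  also have "\<dots> = cmean (\<lambda>t. v (cis t)) + e"
    using v by (subst cmean_add) (auto intro!: integrable_circ_cis)
  finally show ?thesis using that[OF h le] by blast
qed

section \<open>Growth and circle means of holomorphic functions\<close>

lemma log_plus_nonneg [simp]: "0 \<le> log_plus x"
  unfolding log_plus_def by simp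

lemma le_exp_log_plus: "x \<le> exp (log_plus x)"
  unfolding log_plus_def by simp

lemma log_plus_le_iff:
  assumes "0 \<le> c" shows "log_plus x \<le> c \<longleftrightarrow> x \<le> exp c"
proof -
  have "log_plus x \<le> c \<longleftrightarrow> max 1 x \<le> exp c"
    unfolding log_plus_def by (metis exp_le_cancel_iff exp_ln less_max_iff_disj zero_less_one)
  then show ?thesis using assms by simp
qed

lemma continuous_on_log_plus [continuous_intros]:
  "continuous_on A f \<Longrightarrow> continuous_on A (\<lambda>x. log_plus (f x))"
  unfolding log_plus_def by (intro continuous_intros) (auto simp: max_def)

lemma tendsto_log_plus [tendsto_intros]:
  assumes "(f \<longlongrightarrow> l) F" shows "((\<lambda>x. log_plus (f x)) \<longlongrightarrow> log_plus l) F"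
proof -
  have "continuous_on UNIV log_plus" using continuous_on_log_plus[OF continuous_on_id] .
  then show ?thesis using assms by (metis UNIV_I continuous_on_eq_continuous_at isCont_tendsto_compose open_UNIV)
qed

text \<open>The product of \<open>g\<close> with \<open>exp (- h)\<close> is at most
  \<open>exp M\<close> on the circle, and the maximum modulus principle carries this inside. No
  logarithm of \<open>g\<close> is taken, so its zeros do no harm.\<close>

lemma boundary_majorant:
  assumes g: "continuous_on (cball 0 1) g" "g holomorphic_on ball 0 1"
    and v: "continuous_on (sphere 0 1) v" "\<And>w. cmod w = 1 \<Longrightarrow> 0 \<le> v w"
    and bnd: "\<And>w. cmod w = 1 \<Longrightarrow> cmod (g w) \<le> exp (M + v w)" and e: "e > 0"
  obtains h where "h holomorphic_on UNIV" "\<And>z. cmod z \<le> 1 \<Longrightarrow> 0 \<le> Re (h z)"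
    "\<And>z. cmod z \<le> 1 \<Longrightarrow> cmod (g z) \<le> exp (M + Re (h z))"
    "Re (h 0) \<le> cmean (\<lambda>t. v (cis t)) + e"
proof -
  obtain h where h: "h holomorphic_on UNIV" "\<And>z. cmod z = 1 \<Longrightarrow> v z \<le> Re (h z)"
    "Re (h 0) \<le> cmean (\<lambda>t. v (cis t)) + e"
    using trig_poly_majorant[OF v(1) e] by metis
  have hc: "continuous_on A h" for A using h(1) holomorphic_on_imp_continuous_on holomorphic_on_subset by blast
  have hh: "h holomorphic_on A" for A using h(1) holomorphic_on_subset by blast
  have pos: "0 \<le> Re (h z)" if "cmod z \<le> 1" for z
    by (rule Re_nonneg_on_ball[OF hc hh _ that]) (use v(2) h(2) order_trans in blast)
  have "cmod (g z * exp (- h z)) \<le> exp M" if z: "cmod z \<le> 1" for z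
  proof (rule maximum_modulus_frontier[where S = "cball 0 1" and f = "\<lambda>z. g z * exp (- h z)" and \<xi> = z])
    show "(\<lambda>z. g z * exp (- h z)) holomorphic_on interior (cball 0 1)"
      unfolding interior_cball by (intro holomorphic_intros g hh)
    show "continuous_on (closure (cball 0 1)) (\<lambda>z. g z * exp (- h z))"
      by (auto intro!: continuous_intros g hc)
    fix w :: complex assume "w \<in> frontier (cball 0 1)"
    then have w: "cmod w = 1" by simp
    have "cmod (g w) \<le> exp (M + Re (h w))" using bnd[OF w] h(2)[OF w] by (meson add_left_mono exp_le_cancel_iff order_trans)
    then show "cmod (g w * exp (- h w)) \<le> exp M" by (simp add: norm_mult norm_divide exp_add exp_minus divide_simps)
  qed (use z in auto)
  then have "cmod (g z) \<le> exp (M + Re (h z))" if "cmod z \<le> 1" for z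
    using that by (simp add: norm_mult norm_divide exp_add exp_minus divide_simps)
  then show ?thesis using that[OF h(1) pos _ h(3)] by blast
qed

text \<open>Harnack's inequality for the majorant. Only the mean of \<open>v\<close> is multiplied
  by the large factor, not \<open>M\<close>; this asymmetry is what later separates Smirnov from
  Nevanlinna growth.\<close>

lemma growth_from_boundary:
  assumes g: "continuous_on (cball 0 1) g" "g holomorphic_on ball 0 1"
    and v: "continuous_on (sphere 0 1) v" "\<And>w. cmod w = 1 \<Longrightarrow> 0 \<le> v w"
    and bnd: "\<And>w. cmod w = 1 \<Longrightarrow> cmod (g w) \<le> exp (M + v w)" and z: "cmod z < 1"
  shows "cmod (g z) \<le> exp (M + 2 / (1 - cmod z) * cmean (\<lambda>t. v (cis t)))"
proof (cases "g z = 0")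
  case False
  let ?c = "2 / (1 - cmod z)"
  have c: "?c > 0" using z by simp
  have "ln (cmod (g z)) \<le> M + ?c * cmean (\<lambda>t. v (cis t)) + d" if d: "d > 0" for d
  proof -
    \<comment> \<open>The error \<open>d / ?c\<close> becomes exactly \<open>d\<close> after
      multiplication by the Harnack factor.\<close>
    obtain h where h: "h holomorphic_on UNIV" "\<And>z. cmod z \<le> 1 \<Longrightarrow> 0 \<le> Re (h z)"
      "\<And>z. cmod z \<le> 1 \<Longrightarrow> cmod (g z) \<le> exp (M + Re (h z))"
      "Re (h 0) \<le> cmean (\<lambda>t. v (cis t)) + d / ?c"
      using boundary_majorant[OF g v bnd, of "d / ?c"] d c by (metis divide_pos_pos)
    have hc: "continuous_on A h" for A using h(1) holomorphic_on_imp_continuous_on holomorphic_on_subset by blast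
    have hh: "h holomorphic_on A" for A using h(1) holomorphic_on_subset by blast
    have "ln (cmod (g z)) \<le> M + Re (h z)"
      using h(3)[of z] z False by (metis exp_le_cancel_iff exp_ln less_imp_le zero_less_norm_iff)
    also have "Re (h z) \<le> ?c * Re (h 0)"
      using h(2) z by (intro Harnack_upper hc hh) auto
    also have "\<dots> \<le> ?c * (cmean (\<lambda>t. v (cis t)) + d / ?c)"
      using h(4) c by (intro mult_left_mono) auto
    also have "\<dots> = ?c * cmean (\<lambda>t. v (cis t)) + d" using c by (simp only: distrib_left nonzero_eq_divide_eq) simp
    finally show ?thesis by simp
  qed
  then have "ln (cmod (g z)) \<le> M + ?c * cmean (\<lambda>t. v (cis t))" by (rule field_le_epsilon)
  then show ?thesis using False by (metis exp_le_cancel_iff exp_ln zero_less_norm_iff)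
qed auto

lemma dilation_disc:
  assumes "f holomorphic_on ball 0 1" "0 \<le> R" "R < 1"
  shows "continuous_on (cball 0 1) (\<lambda>z. f (of_real R * z))" "(\<lambda>z. f (of_real R * z)) holomorphic_on ball 0 1"
proof -
  have m: "of_real R * z \<in> ball 0 1" if "z \<in> cball 0 1" for z :: complex
  proof -
    have "R * cmod z \<le> R * 1" using assms that by (intro mult_left_mono) auto
    then show ?thesis using assms by (simp add: norm_mult)
  qed
  have 1: "(\<lambda>z. f (of_real R * z)) holomorphic_on cball 0 1"
    using m by (intro holomorphic_on_compose_gen[unfolded o_def, OF _ assms(1)] holomorphic_intros) auto
  show "continuous_on (cball 0 1) (\<lambda>z. f (of_real R * z))" using 1 by (rule holomorphic_on_imp_continuous_on)
  show "(\<lambda>z. f (of_real R * z)) holomorphic_on ball 0 1" using 1 by (rule holomorphic_on_subset) auto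
qed

lemma log_plus_majorant:
  assumes f: "f holomorphic_on ball 0 1" and R: "0 \<le> R" "R < 1" and e: "e > 0"
  obtains h where "h holomorphic_on UNIV" "\<And>z. cmod z \<le> 1 \<Longrightarrow> 0 \<le> Re (h z)"
    "\<And>z. cmod z \<le> 1 \<Longrightarrow> cmod (f (of_real R * z)) \<le> exp (Re (h z))"
    "Re (h 0) \<le> circle_log_mean f R + e"
proof -
  have "continuous_on (sphere 0 1) (\<lambda>z. log_plus (cmod (f (of_real R * z))))"
    by (intro continuous_intros continuous_on_subset[OF dilation_disc(1)[OF f R]]) auto
  from boundary_majorant[OF dilation_disc(1,2)[OF f R] this, of 0 e]
  show ?thesis using that e unfolding circle_log_mean_eq_cmean by (auto simp: le_exp_log_plus)
qed

lemma integrable_log_plus_circle: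
  assumes f: "f holomorphic_on ball 0 1" and R: "0 \<le> R" "R < 1"
  shows "integrable circ (\<lambda>\<theta>. log_plus (cmod (f (of_real R * cis \<theta>))))"
  by (intro integrable_circ_cis[of "\<lambda>z. log_plus (cmod (f (of_real R * z)))"] continuous_intros
        continuous_on_subset[OF dilation_disc(1)[OF f R]]) auto

text \<open>A majorant built on the circle of radius \<open>R\<close> still dominates on the circle
  of radius \<open>r\<close>, and there its mean is again its value at 0. Since the disc of radius
  \<open>R\<close> has been rescaled to the unit disc, the smaller circle appears with radius
  \<open>r / R\<close>.\<close>

lemma circle_log_mean_mono:
  assumes f: "f holomorphic_on ball 0 1" and r: "0 \<le> r" "r \<le> R" "R < 1"
  shows "circle_log_mean f r \<le> circle_log_mean f R"
proof (cases "r = R")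
  case False
  then have R: "0 < R" using r by simp
  show ?thesis
  proof (rule field_le_epsilon)
    fix e :: real assume "e > 0"
    then obtain h where h: "h holomorphic_on UNIV" "\<And>z. cmod z \<le> 1 \<Longrightarrow> 0 \<le> Re (h z)"
    "\<And>z. cmod z \<le> 1 \<Longrightarrow> cmod (f (of_real R * z)) \<le> exp (Re (h z))"
    "Re (h 0) \<le> circle_log_mean f R + e"
      using log_plus_majorant[OF f _ r(3)] R by (metis less_imp_le)
    let ?k = "\<lambda>z. h (of_real (r / R) * z)"
    have k: "?k holomorphic_on A" for A
      by (intro holomorphic_on_compose_gen[unfolded o_def, OF _ h(1)] holomorphic_intros) auto
    then have kc: "continuous_on A ?k" for A by (rule holomorphic_on_imp_continuous_on)
    have "circle_log_mean f r \<le> cmean (\<lambda>\<theta>. Re (?k (cis \<theta>)))"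
      unfolding circle_log_mean_eq_cmean
    proof (rule cmean_mono)
      show "integrable circ (\<lambda>\<theta>. Re (?k (cis \<theta>)))"
        by (intro integrable_circ_cis[of "\<lambda>z. Re (?k z)"] continuous_intros kc)
      show "log_plus (cmod (f (of_real r * cis \<theta>))) \<le> Re (?k (cis \<theta>))" for \<theta>
      proof -
        have "cmod (of_real (r / R) * cis \<theta>) \<le> 1" using r R by (simp add: norm_mult norm_divide)
        from h(2,3)[OF this] show ?thesis using R by (subst log_plus_le_iff) (auto simp: mult.assoc[symmetric])
      qed
    qed (use integrable_log_plus_circle[OF f] r in auto)
    also have "\<dots> = Re (?k 0)" by (intro mean_value_Re k kc)
    finally show "circle_log_mean f r \<le> circle_log_mean f R + e" using h(4) by simp
  qed
qed auto

lemma nevanlinna_class_holomorphic: "f \<in> nevanlinna_class \<Longrightarrow> f holomorphic_on ball 0 1"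
  unfolding nevanlinna_class_def by auto

lemma nevanlinna_class_bounded_means:
  assumes "f \<in> nevanlinna_class"
  obtains C where "0 < C" "\<And>r. 0 \<le> r \<Longrightarrow> r < 1 \<Longrightarrow> circle_log_mean f r \<le> C"
proof -
  obtain L where L: "(circle_log_mean f \<longlongrightarrow> L) (at_left 1)" and f: "f holomorphic_on ball 0 1"
    using assms unfolding nevanlinna_class_def by auto
  have "circle_log_mean f r \<le> L" if r: "0 \<le> r" "r < 1" for r
  proof (rule tendsto_lowerbound[OF L])
    show "\<forall>\<^sub>F s in at_left 1. circle_log_mean f r \<le> circle_log_mean f s"
      using eventually_at_left_real[OF r(2)]
      by eventually_elim (use circle_log_mean_mono[OF f r(1)] in auto)
  qed auto
  then show ?thesis using that[of "\<bar>L\<bar> + 1"] by force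
qed

text \<open>The means increase with the radius, so boundedness already produces the limit in the
  definition, namely their supremum.\<close>

lemma nevanlinna_classI:
  assumes f: "f holomorphic_on ball 0 1" and C: "\<And>r. 0 < r \<Longrightarrow> r < 1 \<Longrightarrow> circle_log_mean f r \<le> C"
  shows "f \<in> nevanlinna_class"
proof -
  define L where "L = Sup (circle_log_mean f ` {0<..<1})"
  have bdd: "bdd_above (circle_log_mean f ` {0<..<1})" using C by (auto intro!: bdd_aboveI)
  have "(circle_log_mean f \<longlongrightarrow> L) (at_left 1)"
  proof (rule order_tendstoI)
    fix a assume "a < L"
    then obtain r where r: "0 < r" "r < 1" "a < circle_log_mean f r"
      unfolding L_def using less_cSup_iff[OF _ bdd] by auto
    show "\<forall>\<^sub>F s in at_left 1. a < circle_log_mean f s"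
      using eventually_at_left_real[OF r(2)]
    proof eventually_elim
      case (elim s)
      then show ?case using circle_log_mean_mono[OF f less_imp_le[OF r(1)], of s] r(3) by simp
    qed
  next
    fix a assume a: "L < a"
    show "\<forall>\<^sub>F s in at_left 1. circle_log_mean f s < a"
      using eventually_at_left_real[OF zero_less_one]
    proof eventually_elim
      case (elim s)
      then have "circle_log_mean f s \<le> L" unfolding L_def using bdd by (intro cSUP_upper) auto
      then show ?case using a by simp
    qed
  qed
  then show ?thesis using f unfolding nevanlinna_class_def by auto
qed

section \<open>Blaschke factors and division by finitely many zeros\<close>

lemma blaschke_factor_denom_nonzero:
  assumes "cmod \<mu> < 1" "cmod z \<le> 1" shows "1 - cnj \<mu> * z \<noteq> 0"
proof
  assume "1 - cnj \<mu> * z = 0"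
  then have "cmod (cnj \<mu> * z) = 1" by (metis eq_iff_diff_eq_0 norm_one)
  moreover have "cmod (cnj \<mu> * z) \<le> cmod \<mu> * 1" 
    unfolding norm_mult by (intro mult_mono) (use assms in auto)
  ultimately show False using assms by simp
qed

lemma norm_blaschke_factor: "cmod (blaschke_factor \<mu> z) = cmod (\<mu> - z) / cmod (1 - cnj \<mu> * z)"
  unfolding blaschke_factor_def by (simp add: norm_mult norm_divide norm_minus_commute)

text \<open>The pseudohyperbolic identity for 1 - |b|^2, cleared of denominators so that it holds
  for all complex numbers by expanding into real and imaginary parts.\<close>

lemma blaschke_factor_identity:
  "(cmod (1 - cnj \<mu> * z))\<^sup>2 - (cmod (\<mu> - z))\<^sup>2 = (1 - (cmod \<mu>)\<^sup>2) * (1 - (cmod z)\<^sup>2)"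
  unfolding cmod_power2 by (simp add: power2_eq_square algebra_simps)

lemma norm_diff_le_blaschke_denom:
  assumes "cmod \<mu> \<le> 1" "cmod z \<le> 1" shows "cmod (\<mu> - z) \<le> cmod (1 - cnj \<mu> * z)"
proof -
  have "0 \<le> (1 - (cmod \<mu>)\<^sup>2) * (1 - (cmod z)\<^sup>2)"
    using assms by (intro mult_nonneg_nonneg) (auto simp: abs_square_le_1)
  then have "(cmod (\<mu> - z))\<^sup>2 \<le> (cmod (1 - cnj \<mu> * z))\<^sup>2" using blaschke_factor_identity[of \<mu> z] by linarith
  then show ?thesis by (rule power2_le_imp_le) auto
qed

lemma norm_blaschke_factor_le_1:
  assumes "cmod \<mu> < 1" "cmod z \<le> 1" shows "cmod (blaschke_factor \<mu> z) \<le> 1"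
  unfolding norm_blaschke_factor
  using norm_diff_le_blaschke_denom[of \<mu> z] blaschke_factor_denom_nonzero[OF assms] assms by simp

lemma norm_blaschke_factor_eq_1:
  assumes "cmod \<mu> < 1" "cmod z = 1" shows "cmod (blaschke_factor \<mu> z) = 1"
proof -
  have "(cmod (1 - cnj \<mu> * z))\<^sup>2 = (cmod (\<mu> - z))\<^sup>2" using blaschke_factor_identity[of \<mu> z] assms by simp
  then have "cmod (1 - cnj \<mu> * z) = cmod (\<mu> - z)" by simp
  then show ?thesis unfolding norm_blaschke_factor
    using blaschke_factor_denom_nonzero[of \<mu> z] assms by auto
qed

lemma blaschke_factor_eq_0_iff:
  assumes "cmod \<mu> < 1" "cmod z \<le> 1" shows "blaschke_factor \<mu> z = 0 \<longleftrightarrow> z = \<mu>"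
proof -
  have "blaschke_factor \<mu> z = 0 \<longleftrightarrow> cmod (blaschke_factor \<mu> z) = 0" by simp
  also have "\<dots> \<longleftrightarrow> z = \<mu>"
    unfolding norm_blaschke_factor using blaschke_factor_denom_nonzero[OF assms] by auto
  finally show ?thesis .
qed

lemma norm_blaschke_factor_commute: "cmod (blaschke_factor \<mu> z) = cmod (blaschke_factor z \<mu>)"
proof -
  have "cmod (1 - cnj \<mu> * z) = cmod (cnj (1 - cnj \<mu> * z))" by (simp only: complex_mod_cnj)
  also have "\<dots> = cmod (1 - cnj z * \<mu>)" by (simp add: mult.commute)
  finally show ?thesis unfolding norm_blaschke_factor by (simp add: norm_minus_commute)
qed

lemma holomorphic_on_blaschke_factor:
  assumes "cmod \<mu> < 1" shows "blaschke_factor \<mu> holomorphic_on cball 0 1"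
  unfolding blaschke_factor_def[abs_def] using blaschke_factor_denom_nonzero[OF assms]
  by (cases "\<mu> = 0") (auto intro!: holomorphic_intros)

text \<open>One zero at a time: the difference quotient has a removable singularity, and the other
  points of \<open>F\<close> remain zeros of the quotient because a Blaschke factor vanishes in the
  disc at its own point only.\<close>

lemma divide_blaschke_zeros:
  assumes "finite F" "F \<subseteq> ball 0 1" "f holomorphic_on ball 0 1" "\<And>\<nu>. \<nu> \<in> F \<Longrightarrow> f \<nu> = 0"
  obtains g where "g holomorphic_on ball 0 1"
    "\<And>z. z \<in> ball 0 1 \<Longrightarrow> f z = (\<Prod>\<nu>\<in>F. blaschke_factor \<nu> z) * g z"
  using assms
proof (induction F arbitrary: f thesis rule: finite_induct)
  case empty
  show ?case by (rule empty(1)[of f]) (use empty in auto)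
next
  case (insert a F)
  have a: "cmod a < 1" "a \<in> ball 0 1" using insert by auto
  define q where "q = (\<lambda>z. if z = a then deriv f a else (f z - f a) / (z - a))"
  have q: "q holomorphic_on ball 0 1" unfolding q_def using insert by (intro pole_lemma_open) auto
  have fq: "f z = (z - a) * q z" for z unfolding q_def using insert(7)[of a] by auto
  \<comment> \<open>The unimodular constant that relates the Blaschke factor to
    \<open>z - a\<close>; its sign turns \<open>a - z\<close> around.\<close>
  define u where "u = (if a = 0 then 1 else - (of_real (cmod a) / a))"
  have u: "u \<noteq> 0" unfolding u_def by auto
  have b: "blaschke_factor a z = u * (z - a) / (1 - cnj a * z)" for z
    unfolding blaschke_factor_def u_def by (auto simp: divide_simps algebra_simps)
  define k where "k z = q z * (1 - cnj a * z) / u" for z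
  have k: "k holomorphic_on ball 0 1" unfolding k_def using u by (intro holomorphic_intros q) auto
  have fk: "f z = blaschke_factor a z * k z" if "z \<in> ball 0 1" for z
    using blaschke_factor_denom_nonzero[OF a(1), of z] that u unfolding b k_def fq[of z] by (simp add: divide_simps)
  have "k \<nu> = 0" if "\<nu> \<in> F" for \<nu>
  proof -
    have \<nu>: "\<nu> \<in> ball 0 1" "\<nu> \<noteq> a" using that insert by auto
    then have "blaschke_factor a \<nu> \<noteq> 0" using blaschke_factor_eq_0_iff[OF a(1), of \<nu>] by simp
    then show ?thesis using fk[OF \<nu>(1)] insert(7)[of \<nu>] that by simp
  qed
  then obtain g where g: "g holomorphic_on ball 0 1"
    "\<And>z. z \<in> ball 0 1 \<Longrightarrow> k z = (\<Prod>\<nu>\<in>F. blaschke_factor \<nu> z) * g z"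
    using insert(3)[OF _ _ k] insert(5) by auto
  show ?case
    by (rule insert(4)[OF g(1)]) (use fk g(2) insert(1,2) in \<open>simp add: mult.assoc\<close>)
qed

text \<open>The bound is uniform in the finite zero set \<open>F\<close>, because the finite Blaschke product has
  modulus close to 1 near the circle.\<close>
lemma growth_after_division:
  assumes F: "finite F" "F \<subseteq> ball 0 1" and f: "f holomorphic_on ball 0 1" and g: "g holomorphic_on ball 0 1"
    and fg: "\<And>z. z \<in> ball 0 1 \<Longrightarrow> f z = (\<Prod>\<nu>\<in>F. blaschke_factor \<nu> z) * g z"
    and \<kappa>: "\<forall>\<^sub>F R in at_left 1. cmean (\<lambda>\<theta>. max 0 (log_plus (cmod (f (of_real R * cis \<theta>))) - M)) \<le> \<kappa>"
    and z: "cmod z < 1"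
  shows "cmod (g z) \<le> exp (M + 2 / (1 - cmod z) * \<kappa>)"
proof (cases "g z = 0")
  case False
  define b where "b w = (\<Prod>\<nu>\<in>F. blaschke_factor \<nu> w)" for w
  have bc: "continuous_on (cball 0 1) b"
    unfolding b_def using F by (intro holomorphic_on_imp_continuous_on holomorphic_intros holomorphic_on_blaschke_factor) auto
  have b1: "cmod (b w) = 1" if "cmod w = 1" for w
    unfolding b_def prod_norm[symmetric] using F norm_blaschke_factor_eq_1[OF _ that] by (intro prod.neutral) auto
  have uc: "uniformly_continuous_on (cball 0 1) b" by (rule compact_uniformly_continuous[OF bc]) auto
  have "ln (cmod (g z)) \<le> M + 2 / (1 - cmod z) * \<kappa> + \<eta>" if \<eta>: "\<eta> > 0" for \<eta>
  proof -
    \<comment> \<open>On circles close enough to the unit circle the finite Blaschke product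
      \<open>b\<close> has modulus at least \<open>exp (-\<eta>)\<close>, so dividing by it costs
      \<open>\<eta>\<close> in the exponent. How close depends on \<open>F\<close>, but the radius
      tends to 1 before \<open>\<eta>\<close> tends to 0, and the final bound does not see
      it.\<close>
    have "1 - exp (-\<eta>) > 0" using \<eta> by simp
    then obtain d where d: "d > 0" "\<And>w w'. w \<in> cball 0 1 \<Longrightarrow> w' \<in> cball 0 1 \<Longrightarrow> dist w' w < d \<Longrightarrow> dist (b w') (b w) < 1 - exp (-\<eta>)"
      using uc unfolding uniformly_continuous_on_def by metis
    have "max 0 (1 - d) < (1::real)" using d by auto
    from eventually_at_left_real[OF this]
    have "\<forall>\<^sub>F R in at_left 1. cmod (g (of_real R * z)) \<le> exp (M + \<eta> + 2 / (1 - cmod z) * \<kappa>)"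
      using \<kappa>
    proof eventually_elim
      case (elim R)
      then have R: "0 < R" "R < 1" "1 - R < d" by auto
      define v where "v w = max 0 (log_plus (cmod (f (of_real R * w))) - M)" for w
      have "cmod (g (of_real R * z)) \<le> exp (M + \<eta> + 2 / (1 - cmod z) * cmean (\<lambda>t. v (cis t)))"
      proof (rule growth_from_boundary)
        show "continuous_on (cball 0 1) (\<lambda>z. g (of_real R * z))" "(\<lambda>z. g (of_real R * z)) holomorphic_on ball 0 1"
          using dilation_disc[OF g, of R] R by auto
        show "continuous_on (sphere 0 1) v" unfolding v_def
          using R by (intro continuous_intros continuous_on_subset[OF dilation_disc(1)[OF f]]) auto
        show "0 \<le> v w" for w unfolding v_def by simp
        fix w :: complex assume w: "cmod w = 1"
        have Rw: "of_real R * w \<in> ball 0 1" using R w by (simp add: norm_mult)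
        have "cmod (of_real R * w - w) = 1 - R"
        proof -
          have "of_real R * w - w = of_real (R - 1) * w" by (simp add: algebra_simps)
          then show ?thesis using w R by (simp only: norm_mult norm_of_real) simp
        qed
        then have "cmod (b (of_real R * w) - b w) < 1 - exp (-\<eta>)"
          using d(2)[of w "of_real R * w"] R w Rw by (simp add: dist_norm)
        then have lb: "exp (-\<eta>) \<le> cmod (b (of_real R * w))"
          using b1[OF w] norm_triangle_ineq2[of "b w" "b (of_real R * w)"] by (simp add: norm_minus_commute)
        have "exp (-\<eta>) * cmod (g (of_real R * w)) \<le> cmod (b (of_real R * w)) * cmod (g (of_real R * w))"
          using lb by (intro mult_right_mono) auto
        also have "\<dots> = cmod (f (of_real R * w))" using fg[OF Rw] by (simp add: b_def norm_mult)
        also have "\<dots> \<le> exp (log_plus (cmod (f (of_real R * w))))" by (rule le_exp_log_plus)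
        also have "\<dots> \<le> exp (M + v w)" unfolding v_def by simp
        finally have "exp (-\<eta>) * cmod (g (of_real R * w)) \<le> exp (M + v w)" .
        then show "cmod (g (of_real R * w)) \<le> exp (M + \<eta> + v w)"
          by (simp add: exp_add exp_minus divide_simps mult_ac)
      qed (use z in auto)
      also have "\<dots> \<le> exp (M + \<eta> + 2 / (1 - cmod z) * \<kappa>)"
        using elim z unfolding v_def by (auto intro!: divide_right_mono)
      finally show ?case .
    qed
    moreover have "((\<lambda>R. cmod (g (of_real R * z))) \<longlongrightarrow> cmod (g z)) (at_left 1)"
    proof -
      have "((\<lambda>R. of_real R * z) \<longlongrightarrow> of_real 1 * z) (at_left 1)" by (intro tendsto_intros)
      moreover have "isCont g z" using g z holomorphic_on_imp_continuous_on
        by (metis centre_in_ball continuous_on_eq_continuous_at mem_ball_0 open_ball)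
      ultimately show ?thesis by (intro tendsto_norm isCont_tendsto_compose[of z g]) auto
    qed
    ultimately have "cmod (g z) \<le> exp (M + \<eta> + 2 / (1 - cmod z) * \<kappa>)"
      by (intro tendsto_upperbound[of _ _ "at_left 1"]) auto
    then have "ln (cmod (g z)) \<le> M + \<eta> + 2 / (1 - cmod z) * \<kappa>"
      using False by (metis exp_le_cancel_iff exp_ln zero_less_norm_iff)
    then show ?thesis by simp
  qed
  then have "ln (cmod (g z)) \<le> M + 2 / (1 - cmod z) * \<kappa>" by (rule field_le_epsilon)
  then show ?thesis using False by (metis exp_le_cancel_iff exp_ln zero_less_norm_iff)
qed auto

section \<open>A nontangential maximal inequality\<close>

text \<open>Vitali covering: among the bad intervals a disjoint subfamily has fivefold enlargements
  that cover all bad centres. An enlargement has length ten times the radius \<open>h\<close>, and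
  \<open>l * h\<close> is below the integral over the interval itself; this gives
  \<open>10 / l\<close>. The range \<open>{-2*pi..4*pi}\<close> contains every interval of radius at
  most \<open>2 * pi\<close> about a centre in one period. Taking for \<open>T\<close> the countable
  union of enlargements, rather than the bad set, makes measurability evident.\<close>

lemma maximal_weak_type:
  fixes \<phi> :: "real \<Rightarrow> real"
  assumes cont: "continuous_on UNIV \<phi>" and nonneg: "\<And>t. 0 \<le> \<phi> t" and l: "l > 0"
  obtains T where "T \<in> lmeasurable" "measure lebesgue T \<le> 10 / l * integral {-2*pi..4*pi} \<phi>"
    "\<And>x h. x \<in> {0..2*pi} - T \<Longrightarrow> 0 < h \<Longrightarrow> h \<le> 2 * pi \<Longrightarrow> integral {x-h..x+h} \<phi> \<le> l * h"
proof -
  define K where "K = {(x, h). x \<in> {0..2*pi} \<and> 0 < h \<and> h \<le> 2 * pi \<and> l * h < integral {x-h..x+h} \<phi>}"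
  have int: "\<phi> integrable_on {a..b}" for a b
    using cont continuous_on_subset by (intro integrable_continuous_real) blast
  have radii: "0 < snd i \<and> snd i \<le> 2 * pi" if "i \<in> K" for i using that by (auto simp: K_def)
  obtain C where C: "countable C" "C \<subseteq> K"
    "pairwise (\<lambda>i j. disjnt (cball (fst i) (snd i)) (cball (fst j) (snd j))) C"
    "(\<Union>i\<in>K. cball (fst i) (snd i)) \<subseteq> (\<Union>i\<in>C. cball (fst i) (5 * snd i))"
    by (rule Vitali_covering_lemma_cballs[OF subset_refl radii])
  define T where "T = (\<Union>i\<in>C. cball (fst i) (5 * snd i))"
  \<comment> \<open>A bound for finite subfamilies, uniform in \<open>D\<close>, passes to the
    countable union.\<close>
  have bound: "measure lebesgue (\<Union>i\<in>D. cball (fst i) (5 * snd i)) \<le> 10 / l * integral {-2*pi..4*pi} \<phi>"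
    if D: "D \<subseteq> C" "finite D" for D
  proof -
    let ?I = "\<lambda>i. {fst i - snd i..fst i + snd i}"
    have DK: "D \<subseteq> K" using D C by blast
    have hasint: "(\<phi> has_integral (\<Sum>i\<in>D. integral (?I i) \<phi>)) (\<Union>i\<in>D. ?I i)"
    proof (rule has_integral_UN[OF D(2)])
      show "(\<phi> has_integral integral (?I i) \<phi>) (?I i)" for i
        using int by (rule integrable_integral)
      show "pairwise (\<lambda>i i'. negligible (?I i \<inter> ?I i')) D"
        using pairwise_subset[OF C(3) D(1)]
        by (auto simp: pairwise_def disjnt_def cball_eq_atLeastAtMost)
    qed
    have "integral (\<Union>i\<in>D. ?I i) \<phi> \<le> integral {-2*pi..4*pi} \<phi>"
    proof (rule integral_subset_le)
      show "(\<Union>i\<in>D. ?I i) \<subseteq> {-2*pi..4*pi}" using DK by (fastforce simp: K_def)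
    qed (use int nonneg hasint in \<open>auto simp: integrable_on_def\<close>)
    then have le: "(\<Sum>i\<in>D. integral (?I i) \<phi>) \<le> integral {-2*pi..4*pi} \<phi>"
      using integral_unique[OF hasint] by simp
    have "measure lebesgue (\<Union>i\<in>D. cball (fst i) (5 * snd i)) \<le> (\<Sum>i\<in>D. measure lebesgue (cball (fst i) (5 * snd i)))"
      using D by (intro measure_UNION_le) auto
    also have "\<dots> = (\<Sum>i\<in>D. 10 * snd i)"
      using DK by (intro sum.cong refl) (auto simp: cball_eq_atLeastAtMost K_def)
    also have "\<dots> \<le> (\<Sum>i\<in>D. 10 / l * integral (?I i) \<phi>)"
      using DK l by (intro sum_mono) (auto simp: K_def field_simps)
    also have "\<dots> = 10 / l * (\<Sum>i\<in>D. integral (?I i) \<phi>)" by (simp add: sum_distrib_left)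
    also have "\<dots> \<le> 10 / l * integral {-2*pi..4*pi} \<phi>"
      using le l by (intro mult_left_mono) auto
    finally show ?thesis .
  qed
  have "T \<in> lmeasurable" unfolding T_def
    by (rule fmeasurable_UN_bound[OF C(1) _ bound]) auto
  moreover have "measure lebesgue T \<le> 10 / l * integral {-2*pi..4*pi} \<phi>" unfolding T_def
    by (rule measure_UN_bound[OF C(1) _ bound]) auto
  moreover have "integral {x-h..x+h} \<phi> \<le> l * h" if "x \<in> {0..2*pi} - T" "0 < h" "h \<le> 2 * pi" for x h
  proof (rule ccontr)
    assume "\<not> integral {x-h..x+h} \<phi> \<le> l * h"
    then have "(x, h) \<in> K" using that by (auto simp: K_def)
    then have "x \<in> (\<Union>i\<in>K. cball (fst i) (snd i))" using that by (intro UN_I[of "(x, h)"]) auto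
    then have "x \<in> T" unfolding T_def using C(4) by blast
    then show False using that by simp
  qed
  ultimately show ?thesis using that by blast
qed

section \<open>The Poisson kernel in a Stolz angle\<close>

lemma norm_cis_diff_eq: "cmod (cis a - cis b) = 2 * \<bar>sin ((a - b) / 2)\<bar>"
proof -
  have "(cmod (cis a - cis b))\<^sup>2 = 2 - 2 * cos (a - b)"
    unfolding cmod_power2 by (simp add: cos_diff power2_diff) (use sin_cos_squared_add[of a] sin_cos_squared_add[of b] in argo)
  also have "cos (a - b) = 1 - 2 * (sin ((a - b) / 2))\<^sup>2"
    using cos_double_sin[of "(a - b) / 2"] by (simp only: times_divide_eq_right nonzero_mult_div_cancel_left zero_neq_numeral not_False_eq_True)
  finally have "(cmod (cis a - cis b))\<^sup>2 = (2 * \<bar>sin ((a - b) / 2)\<bar>)\<^sup>2" by (simp add: power_mult_distrib)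
  then show ?thesis by (rule power2_eq_imp_eq) auto
qed

text \<open>A weak form of Jordan's inequality: the Taylor bound \<open>x - x ^ 3 / 6\<close> is at
  least \<open>x / 2\<close> as long as the square of \<open>x\<close> is at most 3, and
  \<open>pi / 2\<close> is at most 1.6.\<close>

lemma sin_ge_half:
  assumes "0 \<le> x" "x \<le> pi / 2" shows "x / 2 \<le> sin x"
proof -
  have "\<bar>sin x - (\<Sum>m<3. sin_coeff m * x ^ m)\<bar> \<le> inverse (fact 3) * \<bar>x\<bar> ^ 3"
    by (rule Maclaurin_sin_bound)
  moreover have "(\<Sum>m<3. sin_coeff m * x ^ m) = x" by (simp add: eval_nat_numeral sin_coeff_def)
  moreover have "fact 3 = (6::real)" by (simp add: eval_nat_numeral)
  ultimately have "x - x ^ 3 / 6 \<le> sin x" using assms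
    by (auto simp: abs_if field_simps split: if_splits)
  moreover have "x \<le> 1.6" using assms pi_approx by simp
  then have "x * x \<le> 1.6 * 1.6" using assms by (intro mult_mono) auto
  then have "x * (x * x) \<le> x * 3" using assms by (intro mult_left_mono) auto
  ultimately show ?thesis by (simp add: power3_eq_cube)
qed

lemma norm_cis_diff_ge:
  assumes "\<bar>a - b\<bar> \<le> pi" shows "\<bar>a - b\<bar> / 2 \<le> cmod (cis a - cis b)"
proof -
  have "\<bar>a - b\<bar> / 2 / 2 \<le> sin (\<bar>a - b\<bar> / 2)" using assms by (intro sin_ge_half) auto
  also have "sin (\<bar>a - b\<bar> / 2) \<le> \<bar>sin ((a - b) / 2)\<bar>"
    using sin_minus[of "(a - b) / 2"] by (cases "a \<le> b") (auto simp: minus_divide_left)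
  finally show ?thesis unfolding norm_cis_diff_eq by simp
qed

text \<open>Turns the decay of the Poisson kernel into averages over dyadic intervals.\<close>
lemma dyadic_kernel_bound:
  fixes \<delta> s :: real
  assumes \<delta>: "0 < \<delta>" and s: "\<bar>s\<bar> \<le> 2 ^ n * \<delta>"
  shows "1 / (max \<delta> \<bar>s\<bar>)\<^sup>2 \<le> (\<Sum>k\<le>n. if \<bar>s\<bar> \<le> 2 ^ k * \<delta> then 4 / (4 ^ k * \<delta>\<^sup>2) else 0)"
proof -
  \<comment> \<open>The single term at the first dyadic scale that reaches \<open>s\<close> already
    suffices. By minimality \<open>s\<close> lies beyond half that scale, and the 4 in the numerator
    pays for this half, squared.\<close>
  define k where "k = (LEAST k. \<bar>s\<bar> \<le> 2 ^ k * \<delta>)"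
  have k: "\<bar>s\<bar> \<le> 2 ^ k * \<delta>" unfolding k_def using s by (rule LeastI)
  have kn: "k \<le> n" unfolding k_def using s by (rule Least_le)
  have "1 / (max \<delta> \<bar>s\<bar>)\<^sup>2 \<le> 4 / (4 ^ k * \<delta>\<^sup>2)"
  proof (cases k)
    case 0
    have "1 / (max \<delta> \<bar>s\<bar>)\<^sup>2 \<le> 1 / \<delta>\<^sup>2" using \<delta> by (intro divide_left_mono power_mono) auto
    also have "\<dots> \<le> 4 / \<delta>\<^sup>2" by (intro divide_right_mono) auto
    finally show ?thesis using 0 by simp
  next
    case (Suc j)
    then have "\<not> \<bar>s\<bar> \<le> 2 ^ j * \<delta>" unfolding k_def by (metis not_less_Least lessI)
    then have "2 ^ j * \<delta> \<le> max \<delta> \<bar>s\<bar>" by simp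
    then have "1 / (max \<delta> \<bar>s\<bar>)\<^sup>2 \<le> 1 / (2 ^ j * \<delta>)\<^sup>2" using \<delta> by (intro divide_left_mono power_mono) auto
    also have "(2 ^ j * \<delta>)\<^sup>2 = 4 ^ j * \<delta>\<^sup>2" by (simp add: power_mult_distrib power2_eq_square flip: power_mult_distrib)
    also have "1 / (4 ^ j * \<delta>\<^sup>2) = 4 / (4 ^ k * \<delta>\<^sup>2)" by (simp add: Suc)
    finally show ?thesis .
  qed
  also have "\<dots> = (\<Sum>i\<in>{k}. if \<bar>s\<bar> \<le> 2 ^ i * \<delta> then 4 / (4 ^ i * \<delta>\<^sup>2) else 0)" using k by simp
  also have "\<dots> \<le> (\<Sum>k\<le>n. if \<bar>s\<bar> \<le> 2 ^ k * \<delta> then 4 / (4 ^ k * \<delta>\<^sup>2) else 0)"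
    using kn \<delta> by (intro sum_mono2) auto
  finally show ?thesis .
qed

text \<open>Seen from a point \<open>z\<close> of the angle, the distance to \<open>cis t\<close>
  controls both \<open>1 - cmod z\<close> and the arc \<open>\<bar>t - pi\<bar>\<close>, up to the
  factor \<open>2 * (1 + A)\<close>: the distance from \<open>z\<close> to the vertex is itself at
  most \<open>A\<close> times \<open>1 - cmod z\<close>. Squaring this factor and bounding
  \<open>1 + cmod z\<close> by 2 gives the 8.\<close>

lemma poisson_kernel_stolz_bound:
  assumes z: "cmod z < 1" and A: "0 \<le> A" "cmod (z - cis pi) \<le> A * (1 - cmod z)" and t: "\<bar>t - pi\<bar> \<le> pi"
  shows "poisson_kernel z t \<le> 8 * (1 + A)\<^sup>2 * (1 - cmod z) * (1 / (max (1 - cmod z) \<bar>t - pi\<bar>)\<^sup>2)"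
proof -
  define \<delta> where "\<delta> = 1 - cmod z"
  have \<delta>: "\<delta> > 0" unfolding \<delta>_def using z by simp
  define D where "D = cmod (cis t - z)"
  have 1: "\<delta> \<le> D" unfolding D_def \<delta>_def using norm_triangle_ineq2[of "cis t" z] by simp
  have "\<bar>t - pi\<bar> / 2 \<le> cmod (cis t - cis pi)" using t by (rule norm_cis_diff_ge)
  also have "\<dots> \<le> D + cmod (z - cis pi)" unfolding D_def using norm_triangle_ineq[of "cis t - z" "z - cis pi"] by simp
  also have "\<dots> \<le> D + A * \<delta>" using A unfolding \<delta>_def by simp
  also have "\<dots> \<le> D + A * D" using A 1 by (intro add_left_mono mult_left_mono) auto
  finally have 2: "\<bar>t - pi\<bar> \<le> 2 * (1 + A) * D" by (simp add: algebra_simps)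
  have "\<delta> \<le> 2 * (1 + A) * D"
  proof -
    have "1 * D \<le> (2 * (1 + A)) * D" using A 1 \<delta> by (intro mult_right_mono) auto
    then show ?thesis using 1 by simp
  qed
  with 2 have m: "max \<delta> \<bar>t - pi\<bar> \<le> 2 * (1 + A) * D" by simp
  have D: "D > 0" using 1 \<delta> by simp
  have "poisson_kernel z t = \<delta> * (1 + cmod z) / D\<^sup>2"
    unfolding poisson_kernel_def D_def \<delta>_def by (simp add: power2_eq_square algebra_simps)
  also have "\<dots> \<le> \<delta> * 2 / D\<^sup>2" using z \<delta> by (intro divide_right_mono mult_left_mono) auto
  also have "\<dots> = 8 * (1 + A)\<^sup>2 * \<delta> * (1 / (2 * (1 + A) * D)\<^sup>2)"
  proof -
    have "(2 * (1 + A) * D)\<^sup>2 = 4 * (1 + A)\<^sup>2 * D\<^sup>2" by (simp only: power_mult_distrib) simp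
    moreover have "(1 + A)\<^sup>2 \<noteq> 0" using A by simp
    ultimately show ?thesis by simp
  qed
  also have "\<dots> \<le> 8 * (1 + A)\<^sup>2 * \<delta> * (1 / (max \<delta> \<bar>t - pi\<bar>)\<^sup>2)"
    using m \<delta> A D by (intro mult_left_mono divide_left_mono power_mono) (auto simp: max_def)
  finally show ?thesis unfolding \<delta>_def .
qed

text \<open>The kernel is cut into dyadic pieces. At scale \<open>2 ^ k * \<delta>\<close> its
  height decays like \<open>1 / 4 ^ k\<close>, while the integral of the boundary values over the
  interval grows at most like \<open>2 ^ k\<close>, so the pieces form a geometric series. The
  vertex \<open>cis pi\<close> is chosen because \<open>{0..2*pi}\<close> is then a period centred
  at its argument.\<close>

lemma stolz_maximal_bound_pi:
  assumes G: "continuous_on (cball 0 1) G" "G holomorphic_on ball 0 1"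
    and z: "cmod z < 1" and A: "0 \<le> A" "cmod (z - cis pi) \<le> A * (1 - cmod z)"
    and l: "0 \<le> l" "\<And>h. 0 < h \<Longrightarrow> h \<le> pi \<Longrightarrow> integral {pi-h..pi+h} (\<lambda>t. cmod (G (cis t))) \<le> l * h"
  shows "cmod (G z) \<le> 64 * (1 + A)\<^sup>2 * l"
proof -
  define \<delta> where "\<delta> = 1 - cmod z"
  have \<delta>: "\<delta> > 0" unfolding \<delta>_def using z by simp
  define \<phi> where "\<phi> t = cmod (G (cis t))" for t
  have c\<phi>: "continuous_on B \<phi>" for B unfolding \<phi>_def
    by (intro continuous_intros continuous_on_compose2[OF G(1)]) auto
  obtain n :: nat where "pi / \<delta> < 2 ^ n" using real_arch_pow[of 2 "pi / \<delta>"] by auto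
  then have n: "pi \<le> 2 ^ n * \<delta>" using \<delta> by (simp add: field_simps)
  define c where "c k = 8 * (1 + A)\<^sup>2 * \<delta> * (4 / (4 ^ k * \<delta>\<^sup>2))" for k :: nat
  have c0: "0 \<le> c k" for k unfolding c_def using \<delta> by simp
  \<comment> \<open>Capping at \<open>pi\<close> keeps the intervals inside \<open>{0..2*pi}\<close>
    and changes nothing for arguments \<open>t\<close> of that period.\<close>
  define h where "h k = min (2 ^ k * \<delta>) pi" for k :: nat
  have int: "(\<lambda>t. if t \<in> {pi - h k..pi + h k} then \<phi> t else 0) integrable_on {0..2*pi}" (is ?a)
    and inteq: "integral {0..2*pi} (\<lambda>t. if t \<in> {pi - h k..pi + h k} then \<phi> t else 0) = integral {pi - h k..pi + h k} \<phi>" (is ?b) for k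
  proof -
    have "(\<phi> has_integral (integral {pi - h k..pi + h k} \<phi>)) {pi - h k..pi + h k}"
      by (intro integrable_integral integrable_continuous_real c\<phi>)
    moreover have "{pi - h k..pi + h k} \<inter> {0..2*pi} = {pi - h k..pi + h k}"
      unfolding h_def by auto
    ultimately have "((\<lambda>t. if t \<in> {pi - h k..pi + h k} then \<phi> t else 0) has_integral (integral {pi - h k..pi + h k} \<phi>)) {0..2*pi}"
      unfolding has_integral_restrict_Int by (simp only:)
    then show ?a ?b by (auto simp: integrable_on_def integral_unique)
  qed
  have pc: "continuous_on {0..2*pi} (\<lambda>t. poisson_kernel z t * \<phi> t)"
    by (intro continuous_intros c\<phi> continuous_on_poisson_kernel z)
  have "2 * pi * cmod (G z) = cmod (\<integral>t. complex_of_real (poisson_kernel z t) * G (cis t) \<partial>circ)"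
    using Poisson_formula[OF G z] by (simp add: norm_mult)
  also have "\<dots> \<le> (\<integral>t. cmod (complex_of_real (poisson_kernel z t) * G (cis t)) \<partial>circ)"
    by (rule integral_norm_bound)
  also have "\<dots> = (\<integral>t. poisson_kernel z t * \<phi> t \<partial>circ)"
    using poisson_kernel_nonneg[of z] z by (simp add: norm_mult \<phi>_def)
  also have "\<dots> = integral {0..2*pi} (\<lambda>t. poisson_kernel z t * \<phi> t)"
    by (intro lebesgue_integral_eq_integral integrable_circ pc) auto
  also have "\<dots> \<le> integral {0..2*pi} (\<lambda>t. \<Sum>k\<le>n. c k * (if t \<in> {pi - h k..pi + h k} then \<phi> t else 0))"
  proof (rule integral_le)
    fix t assume t: "t \<in> {0..2*pi}"
    then have t': "\<bar>t - pi\<bar> \<le> pi" by auto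
    have "poisson_kernel z t \<le> 8 * (1 + A)\<^sup>2 * \<delta> * (1 / (max \<delta> \<bar>t - pi\<bar>)\<^sup>2)"
      using poisson_kernel_stolz_bound[OF z A t'] unfolding \<delta>_def .
    also have "\<dots> \<le> 8 * (1 + A)\<^sup>2 * \<delta> * (\<Sum>k\<le>n. if \<bar>t - pi\<bar> \<le> 2 ^ k * \<delta> then 4 / (4 ^ k * \<delta>\<^sup>2) else 0)"
      using \<delta> n t' by (intro mult_left_mono dyadic_kernel_bound) auto
    also have "\<dots> = (\<Sum>k\<le>n. if t \<in> {pi - h k..pi + h k} then c k else 0)"
      unfolding sum_distrib_left c_def using t' by (intro sum.cong refl) (auto simp: h_def)
    finally have "poisson_kernel z t * \<phi> t \<le> (\<Sum>k\<le>n. if t \<in> {pi - h k..pi + h k} then c k else 0) * \<phi> t"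
      by (intro mult_right_mono) (auto simp: \<phi>_def)
    also have "\<dots> = (\<Sum>k\<le>n. c k * (if t \<in> {pi - h k..pi + h k} then \<phi> t else 0))"
      unfolding sum_distrib_right by (intro sum.cong) auto
    finally show "poisson_kernel z t * \<phi> t \<le> (\<Sum>k\<le>n. c k * (if t \<in> {pi - h k..pi + h k} then \<phi> t else 0))" .
  qed (intro integrable_continuous_real pc, intro integrable_sum integrable_on_mult_right int, simp)
  also have "\<dots> = (\<Sum>k\<le>n. c k * integral {pi - h k..pi + h k} \<phi>)"
    by (subst integral_sum) (auto intro!: integrable_on_mult_right int simp del: atLeastAtMost_iff simp: inteq)
  also have "\<dots> \<le> (\<Sum>k\<le>n. c k * (l * (2 ^ k * \<delta>)))"
  proof (intro sum_mono mult_left_mono c0)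
    fix k
    have "0 < h k" "h k \<le> pi" unfolding h_def using \<delta> by auto
    then have "integral {pi - h k..pi + h k} \<phi> \<le> l * h k" using l(2)[of "h k"] unfolding \<phi>_def by simp
    also have "\<dots> \<le> l * (2 ^ k * \<delta>)" using l(1) unfolding h_def by (intro mult_left_mono) auto
    finally show "integral {pi - h k..pi + h k} \<phi> \<le> l * (2 ^ k * \<delta>)" .
  qed
  also have "\<dots> = (\<Sum>k\<le>n. 32 * (1 + A)\<^sup>2 * l * (1/2) ^ k)"
  proof (rule sum.cong[OF refl])
    fix k
    have "(4::real) ^ k = 2 ^ k * 2 ^ k" by (simp flip: power_mult_distrib)
    then show "c k * (l * (2 ^ k * \<delta>)) = 32 * (1 + A)\<^sup>2 * l * (1/2) ^ k"
      unfolding c_def using \<delta> by (simp add: power_one_over power2_eq_square)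
  qed
  also have "\<dots> = 32 * (1 + A)\<^sup>2 * l * (\<Sum>k\<le>n. (1/2) ^ k)" by (simp add: sum_distrib_left)
  also have "\<dots> \<le> 32 * (1 + A)\<^sup>2 * l * 2"
  proof -
    have "(\<Sum>k\<le>n. (1/2) ^ k) = 2 - (1/2 :: real) ^ n" by (induction n) auto
    then show ?thesis using l(1) A by (intro mult_left_mono) auto
  qed
  finally have "2 * pi * cmod (G z) \<le> 64 * (1 + A)\<^sup>2 * l" by simp
  \<comment> \<open>The factor \<open>2 * pi\<close> exceeds 1 and is simply given away.\<close>
  moreover have "1 * cmod (G z) \<le> 2 * pi * cmod (G z)" using pi_gt3 by (intro mult_right_mono) auto
  ultimately show ?thesis by linarith
qed

text \<open>Rotation by \<open>\<theta> - pi\<close> moves the vertex to \<open>cis pi\<close> and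
  turns the integrals around \<open>\<theta>\<close> into integrals around
  \<open>pi\<close>.\<close>

lemma stolz_maximal_bound:
  assumes G: "continuous_on (cball 0 1) G" "G holomorphic_on ball 0 1"
    and z: "cmod z < 1" and A: "0 \<le> A" "cmod (z - cis \<theta>) \<le> A * (1 - cmod z)"
    and l: "0 \<le> l" "\<And>h. 0 < h \<Longrightarrow> h \<le> pi \<Longrightarrow> integral {\<theta>-h..\<theta>+h} (\<lambda>t. cmod (G (cis t))) \<le> l * h"
  shows "cmod (G z) \<le> 64 * (1 + A)\<^sup>2 * l"
proof -
  define \<rho> where "\<rho> = cis (\<theta> - pi)"
  have \<rho>: "cmod \<rho> = 1" "\<rho> \<noteq> 0" unfolding \<rho>_def by auto
  define G' where "G' w = G (\<rho> * w)" for w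
  define z' where "z' = z / \<rho>"
  have zz: "cmod z' = cmod z" unfolding z'_def using \<rho> by (simp add: norm_divide)
  have "cmod (G' z') \<le> 64 * (1 + A)\<^sup>2 * l"
  proof (rule stolz_maximal_bound_pi[where G = G' and z = z'])
    show "continuous_on (cball 0 1) G'" unfolding G'_def
      by (rule continuous_on_compose2[OF G(1)]) (auto intro!: continuous_intros simp: norm_mult \<rho>)
    show "G' holomorphic_on ball 0 1" unfolding G'_def
      by (rule holomorphic_on_compose_gen[unfolded o_def, OF _ G(2)]) (auto intro!: holomorphic_intros simp: norm_mult \<rho>)
    have "z' - cis pi = (z - cis \<theta>) / \<rho>"
    proof -
      have "\<rho> * cis pi = cis \<theta>" unfolding \<rho>_def cis_mult by simp
      moreover have "z' - w = (z - \<rho> * w) / \<rho>" for w unfolding z'_def using \<rho>(2) by (simp add: diff_divide_distrib)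
      ultimately show ?thesis by (simp only:)
    qed
    then show "cmod (z' - cis pi) \<le> A * (1 - cmod z')" using A(2) zz \<rho> by (simp add: norm_divide)
    fix h :: real assume h: "0 < h" "h \<le> pi"
    have "integral {pi-h..pi+h} (\<lambda>t. cmod (G' (cis t))) = integral {pi-h..pi+h} ((\<lambda>t. cmod (G (cis t))) \<circ> ((+) (\<theta> - pi)))"
      unfolding G'_def \<rho>_def o_def cis_mult ..
    also have "\<dots> = integral {\<theta>-h..\<theta>+h} (\<lambda>t. cmod (G (cis t)))"
      unfolding integral_shift_Icc_real by (simp add: algebra_simps)
    finally show "integral {pi-h..pi+h} (\<lambda>t. cmod (G' (cis t))) \<le> l * h" using l(2)[OF h] by simp
  qed (use z zz A l in auto)
  then show ?thesis unfolding G'_def z'_def using \<rho> by simp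
qed

text \<open>Expresses the right-hand side of the maximal inequality, which integrates over three
  periods, by a circle mean.\<close>

lemma integral_three_periods:
  fixes u :: "complex \<Rightarrow> real"
  assumes "continuous_on (sphere 0 1) u"
  shows "integral {-2*pi..4*pi} (\<lambda>t. u (cis t)) = 6 * pi * cmean (\<lambda>t. u (cis t))"
proof -
  have c: "continuous_on A (\<lambda>t. u (cis t))" for A
    by (rule continuous_on_compose2[OF assms]) (auto intro!: continuous_intros)
  have i: "(\<lambda>t. u (cis t)) integrable_on {a..b}" for a b by (rule integrable_continuous_real[OF c])
  have "integral {0..2*pi} ((\<lambda>t. u (cis t)) \<circ> ((+) (2*pi))) = integral {0..2*pi} (\<lambda>t. u (cis t))"
    by (simp add: o_def flip: cis_mult)
  then have 1: "integral {2*pi..4*pi} (\<lambda>t. u (cis t)) = integral {0..2*pi} (\<lambda>t. u (cis t))"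
    unfolding integral_shift_Icc_real by simp
  have "cis (-2*pi) = 1" by (metis cis_2pi cis_inverse inverse_1 minus_mult_left)
  then have "integral {0..2*pi} ((\<lambda>t. u (cis t)) \<circ> ((+) (-2*pi))) = integral {0..2*pi} (\<lambda>t. u (cis t))"
    by (simp only: o_def cis_mult[symmetric] mult_1)
  then have 2: "integral {-2*pi..0} (\<lambda>t. u (cis t)) = integral {0..2*pi} (\<lambda>t. u (cis t))"
    unfolding integral_shift_Icc_real by simp
  have "integral {-2*pi..4*pi} (\<lambda>t. u (cis t)) = integral {-2*pi..0} (\<lambda>t. u (cis t)) + integral {0..4*pi} (\<lambda>t. u (cis t))"
    by (rule Henstock_Kurzweil_Integration.integral_combine[symmetric]) (auto intro: i)
  also have "integral {0..4*pi} (\<lambda>t. u (cis t)) = integral {0..2*pi} (\<lambda>t. u (cis t)) + integral {2*pi..4*pi} (\<lambda>t. u (cis t))"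
    by (rule Henstock_Kurzweil_Integration.integral_combine[symmetric]) (auto intro: i)
  finally have "integral {-2*pi..4*pi} (\<lambda>t. u (cis t)) = 3 * integral {0..2*pi} (\<lambda>t. u (cis t))" using 1 2 by simp
  also have "integral {0..2*pi} (\<lambda>t. u (cis t)) = (\<integral>t. u (cis t) \<partial>circ)"
    by (intro lebesgue_integral_eq_integral[symmetric] integrable_circ c) auto
  finally show ?thesis unfolding cmean_def by simp
qed

section \<open>Parseval's identity and mean square convergence of dilations\<close>

lemma circ_integral_power_cis:
  "(\<integral>t. cis t ^ n \<partial>circ) = (if n = 0 then 2 * pi else 0)"
  using Poisson_formula[of "\<lambda>w. w ^ n" 0]
  by (auto simp: poisson_kernel_def holomorphic_intros continuous_intros)

lemma circ_integral_cnj: "integrable circ f \<Longrightarrow> (\<integral>t. cnj (f t) \<partial>circ) = cnj (\<integral>t. f t \<partial>circ)"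
  by (rule integral_bounded_linear[OF bounded_linear_cnj])

lemma circ_integral_orthogonal:
  "(\<integral>t. cis t ^ m * cnj (cis t ^ n) \<partial>circ) = (if m = n then 2 * pi else 0)"
proof -
  have *: "cis t ^ m * cnj (cis t ^ n) = cis t ^ (m - n)" if "n \<le> m" for m n t
  proof -
    have "cis t ^ n * cnj (cis t ^ n) = 1"
      using complex_norm_square[of "cis t ^ n"] by (simp add: norm_power)
    moreover have "cis t ^ m = cis t ^ (m - n) * cis t ^ n" using that by (simp flip: power_add)
    ultimately show ?thesis by (simp only: mult.assoc mult_1_right)
  qed
  show ?thesis
  proof (cases "n \<le> m")
    case True
    then show ?thesis unfolding *[OF True] circ_integral_power_cis by auto
  next
    case False
    then have nm: "m \<le> n" by simp
    have "(\<integral>t. cis t ^ m * cnj (cis t ^ n) \<partial>circ) = (\<integral>t. cnj (cis t ^ n * cnj (cis t ^ m)) \<partial>circ)"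
      by (simp add: mult.commute)
    also have "\<dots> = cnj (\<integral>t. cis t ^ (n - m) \<partial>circ)" unfolding *[OF nm] by (intro circ_integral_cnj integrable_circ continuous_intros)
    finally show ?thesis unfolding circ_integral_power_cis using False by simp
  qed
qed

lemma cmean_cmult: "cmean (\<lambda>t. c * u t) = c * cmean u"
  unfolding cmean_def by simp

definition taylor_coeff :: "(complex \<Rightarrow> complex) \<Rightarrow> nat \<Rightarrow> complex" where
  "taylor_coeff f n = (deriv ^^ n) f 0 / fact n"

lemma taylor_coeff_sums:
  assumes "f holomorphic_on ball 0 1" "cmod w < 1"
  shows "(\<lambda>n. taylor_coeff f n * w ^ n) sums f w"
  using holomorphic_power_series[OF assms(1), of w] assms(2) unfolding taylor_coeff_def by simp

lemma taylor_coeff_abs_summable: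
  assumes f: "f holomorphic_on ball 0 1" and \<rho>: "0 \<le> \<rho>" "\<rho> < 1"
  shows "summable (\<lambda>n. cmod (taylor_coeff f n * of_real \<rho> ^ n))"
proof -
  obtain s where s: "\<rho> < s" "s < 1" using \<rho>(2) dense by blast
  have "cmod (of_real s) < 1" using s \<rho> by simp
  then have "summable (\<lambda>n. taylor_coeff f n * of_real s ^ n)"
    using taylor_coeff_sums[OF f, of "of_real s"] by (auto simp: sums_iff)
  then show ?thesis by (rule powser_insidea) (use s \<rho> in auto)
qed

text \<open>Termwise integration, justified by absolute convergence on a radius below 1. It is
  applied with \<open>g\<close> a conjugate monomial, to extract a Taylor coefficient, and with
  \<open>g\<close> a conjugate dilation of \<open>f\<close>, to form the inner product.\<close>

lemma circ_integral_powser: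
  assumes f: "f holomorphic_on ball 0 1" and \<rho>: "0 \<le> \<rho>" "\<rho> < 1"
    and g: "continuous_on {0..2*pi} g" "\<And>t. cmod (g t) \<le> B"
  shows "(\<lambda>n. taylor_coeff f n * of_real \<rho> ^ n * (\<integral>t. cis t ^ n * g t \<partial>circ)) sums (\<integral>t. f (of_real \<rho> * cis t) * g t \<partial>circ)"
proof -
  let ?c = "\<lambda>n. taylor_coeff f n * of_real \<rho> ^ n"
  let ?F = "\<lambda>n t. ?c n * (cis t ^ n * g t)"
  have sm: "summable (\<lambda>n. cmod (?c n))" by (rule taylor_coeff_abs_summable[OF f \<rho>])
  have int: "integrable circ (?F n)" for n
    by (intro integrable_circ continuous_intros g)
  have nle: "cmod (?F n t) \<le> cmod (?c n) * B" for n t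
    using g(2)[of t] by (simp add: norm_mult norm_power mult_left_mono)
  have smB: "summable (\<lambda>n. cmod (?c n) * B)" using sm by (rule summable_mult2)
  have "(\<lambda>n. \<integral>t. ?F n t \<partial>circ) sums (\<integral>t. (\<Sum>n. ?F n t) \<partial>circ)"
  proof (rule sums_integral[OF int])
    show "AE t in circ. summable (\<lambda>n. cmod (?F n t))"
      by (intro AE_I2 summable_comparison_test'[OF smB]) (use nle in auto)
    show "summable (\<lambda>n. \<integral>t. cmod (?F n t) \<partial>circ)"
    proof (rule summable_comparison_test')
      show "summable (\<lambda>n. 2 * pi * (cmod (?c n) * B))" using smB by (rule summable_mult)
      fix n
      have "(\<integral>t. cmod (?F n t) \<partial>circ) \<le> (\<integral>t. cmod (?c n) * B \<partial>circ)"
        by (intro integral_mono integrable_norm int nle) (auto intro: integrable_circ)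
      also have "\<dots> = 2 * pi * (cmod (?c n) * B)" by (simp add: measure_restrict_space)
      finally show "norm (\<integral>t. cmod (?F n t) \<partial>circ) \<le> 2 * pi * (cmod (?c n) * B)" by simp
    qed
  qed
  moreover have "(\<Sum>n. ?F n t) = f (of_real \<rho> * cis t) * g t" for t
  proof -
    have "(\<lambda>n. taylor_coeff f n * (of_real \<rho> * cis t) ^ n * g t) sums (f (of_real \<rho> * cis t) * g t)"
      by (intro sums_mult2 taylor_coeff_sums[OF f]) (use \<rho> in \<open>simp add: norm_mult\<close>)
    then show ?thesis by (simp add: sums_iff power_mult_distrib mult_ac)
  qed
  ultimately show ?thesis by simp
qed

lemma norm_bounded_on_circle:
  fixes f :: "complex \<Rightarrow> complex"
  assumes "continuous_on (cball 0 1) f"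
  obtains B where "\<And>w. cmod w \<le> 1 \<Longrightarrow> cmod (f w) \<le> B"
proof -
  have "bounded (f ` cball 0 1)" using assms by (intro compact_imp_bounded compact_continuous_image) auto
  then show ?thesis using that unfolding bounded_iff by (metis image_eqI mem_cball_0)
qed

text \<open>Parseval's identity with two radii. The inner product depends on the radii only through
  \<open>\<rho> * \<sigma>\<close>, so one monotone function describes all inner products of
  dilations.\<close>

lemma circle_inner_product:
  assumes f: "f holomorphic_on ball 0 1" and \<rho>: "0 \<le> \<rho>" "\<rho> < 1" and \<sigma>: "0 \<le> \<sigma>" "\<sigma> < 1"
  shows "(\<lambda>n. of_real (2 * pi * (cmod (taylor_coeff f n))\<^sup>2 * (\<rho> * \<sigma>) ^ n))
    sums (\<integral>t. f (of_real \<rho> * cis t) * cnj (f (of_real \<sigma> * cis t)) \<partial>circ)"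
proof -
  note cont = dilation_disc(1)[OF f \<sigma>]
  have cc: "continuous_on {0..2*pi} (\<lambda>t. f (of_real \<sigma> * cis t))"
    by (rule continuous_on_compose2[OF cont]) (auto intro!: continuous_intros)
  obtain B where B: "\<And>w. cmod w \<le> 1 \<Longrightarrow> cmod (f (of_real \<sigma> * w)) \<le> B"
    using norm_bounded_on_circle[OF cont] by blast
  have J: "(\<integral>t. cis t ^ n * cnj (f (of_real \<sigma> * cis t)) \<partial>circ) = 2 * pi * cnj (taylor_coeff f n) * of_real \<sigma> ^ n" for n
  proof -
    have "(\<lambda>m. taylor_coeff f m * of_real \<sigma> ^ m * (\<integral>t. cis t ^ m * cnj (cis t ^ n) \<partial>circ))
      sums (\<integral>t. f (of_real \<sigma> * cis t) * cnj (cis t ^ n) \<partial>circ)"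
      by (rule circ_integral_powser[OF f \<sigma>, where B = 1]) (auto intro!: continuous_intros simp: norm_power)
    moreover have "(\<lambda>m. taylor_coeff f m * of_real \<sigma> ^ m * (\<integral>t. cis t ^ m * cnj (cis t ^ n) \<partial>circ))
      = (\<lambda>m. if m = n then taylor_coeff f n * of_real \<sigma> ^ n * (2 * pi) else 0)"
      unfolding circ_integral_orthogonal by auto
    ultimately have "(\<integral>t. f (of_real \<sigma> * cis t) * cnj (cis t ^ n) \<partial>circ) = taylor_coeff f n * of_real \<sigma> ^ n * (2 * pi)"
      using sums_single[of n "\<lambda>_. taylor_coeff f n * of_real \<sigma> ^ n * (2 * pi)"] by (simp add: sums_unique2)
    moreover have "(\<integral>t. cis t ^ n * cnj (f (of_real \<sigma> * cis t)) \<partial>circ) = cnj (\<integral>t. f (of_real \<sigma> * cis t) * cnj (cis t ^ n) \<partial>circ)"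
    proof (subst circ_integral_cnj[symmetric])
      show "integrable circ (\<lambda>t. f (of_real \<sigma> * cis t) * cnj (cis t ^ n))"
        by (intro integrable_circ continuous_intros cc)
    qed (simp add: mult.commute)
    ultimately show ?thesis by simp
  qed
  have "(\<lambda>n. taylor_coeff f n * of_real \<rho> ^ n * (\<integral>t. cis t ^ n * cnj (f (of_real \<sigma> * cis t)) \<partial>circ))
    sums (\<integral>t. f (of_real \<rho> * cis t) * cnj (f (of_real \<sigma> * cis t)) \<partial>circ)"
    by (rule circ_integral_powser[OF f \<rho>, where B = B]) (auto intro!: continuous_intros cc B)
  moreover have "taylor_coeff f n * of_real \<rho> ^ n * (2 * pi * cnj (taylor_coeff f n) * of_real \<sigma> ^ n)
     = of_real (2 * pi * (cmod (taylor_coeff f n))\<^sup>2 * (\<rho> * \<sigma>) ^ n)" for n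
    unfolding of_real_mult of_real_power[symmetric] complex_norm_square by (simp add: power_mult_distrib)
  ultimately show ?thesis unfolding J by (simp only:)
qed

text \<open>With \<open>A s\<close> the power series in \<open>s\<close> whose coefficients are the
  squared moduli of the Taylor coefficients, the squared distance of two dilations is
  \<open>A (R * R) + A (r * r) - 2 * A (R * r)\<close>. On squares of radii \<open>A\<close> is at
  most 1, since \<open>f\<close> is bounded by 1, so it has a finite supremum \<open>L\<close>. By
  monotonicity all three values lie within \<open>e / 2\<close> below \<open>L\<close> once the
  radii exceed \<open>\<rho>\<close>.\<close>

lemma bounded_radial_L2_Cauchy:
  assumes f: "f holomorphic_on ball 0 1" and b: "\<And>z. cmod z < 1 \<Longrightarrow> cmod (f z) \<le> 1" and e: "e > 0"
  obtains \<rho> where "0 < \<rho>" "\<rho> < 1"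
    "\<And>r R. \<rho> \<le> r \<Longrightarrow> r < 1 \<Longrightarrow> \<rho> \<le> R \<Longrightarrow> R < 1 \<Longrightarrow>
      cmean (\<lambda>t. (cmod (f (of_real R * cis t) - f (of_real r * cis t)))\<^sup>2) \<le> e"
proof -
  define A where "A s = (\<Sum>n. (cmod (taylor_coeff f n))\<^sup>2 * s ^ n)" for s :: real
  have inner: "(\<integral>t. f (of_real \<rho> * cis t) * cnj (f (of_real \<sigma> * cis t)) \<partial>circ) = of_real (2 * pi * A (\<rho> * \<sigma>))"
    and sm: "summable (\<lambda>n. (cmod (taylor_coeff f n))\<^sup>2 * (\<rho> * \<sigma>) ^ n)"
    if "0 \<le> \<rho>" "\<rho> < 1" "0 \<le> \<sigma>" "\<sigma> < 1" for \<rho> \<sigma>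
  proof -
    have "summable (\<lambda>n. complex_of_real (2 * pi * (cmod (taylor_coeff f n))\<^sup>2 * (\<rho> * \<sigma>) ^ n))"
      using circle_inner_product[OF f that] by (simp add: sums_iff)
    then have *: "summable (\<lambda>n. 2 * pi * ((cmod (taylor_coeff f n))\<^sup>2 * (\<rho> * \<sigma>) ^ n))"
      unfolding summable_complex_of_real by (simp add: mult.assoc)
    then show s: "summable (\<lambda>n. (cmod (taylor_coeff f n))\<^sup>2 * (\<rho> * \<sigma>) ^ n)"
      by (subst (asm) summable_cmult_iff) auto
    show "(\<integral>t. f (of_real \<rho> * cis t) * cnj (f (of_real \<sigma> * cis t)) \<partial>circ) = of_real (2 * pi * A (\<rho> * \<sigma>))"
    proof (rule sums_unique2[OF circle_inner_product[OF f that]])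
      have "(\<lambda>n. 2 * pi * ((cmod (taylor_coeff f n))\<^sup>2 * (\<rho> * \<sigma>) ^ n)) sums (2 * pi * A (\<rho> * \<sigma>))"
        unfolding A_def by (intro sums_mult summable_sums s)
      then show "(\<lambda>n. complex_of_real (2 * pi * (cmod (taylor_coeff f n))\<^sup>2 * (\<rho> * \<sigma>) ^ n)) sums of_real (2 * pi * A (\<rho> * \<sigma>))"
        by (subst sums_of_real_iff) (simp only: mult.assoc)
    qed
  qed
  have fc: "continuous_on {0..2*pi} (\<lambda>t. f (of_real r * cis t))" if "0 \<le> r" "r < 1" for r
    by (rule continuous_on_compose2[OF dilation_disc(1)[OF f that]]) (auto intro!: continuous_intros)
  have sq: "cmean (\<lambda>t. Re (f (of_real R * cis t) * cnj (f (of_real r * cis t)))) = A (R * r)"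
    if "0 \<le> r" "r < 1" "0 \<le> R" "R < 1" for r R
  proof -
    have "(\<integral>t. Re (f (of_real R * cis t) * cnj (f (of_real r * cis t))) \<partial>circ) = Re (of_real (2 * pi * A (R * r)))"
      using inner[of R r] that by (subst integral_Re) (auto intro!: integrable_circ continuous_intros fc)
    then show ?thesis unfolding cmean_def by simp
  qed
  have int: "integrable circ (\<lambda>t. Re (f (of_real R * cis t) * cnj (f (of_real r * cis t))))"
    if "0 \<le> r" "r < 1" "0 \<le> R" "R < 1" for r R
    by (intro integrable_circ continuous_intros fc that)
  have dist: "cmean (\<lambda>t. (cmod (f (of_real R * cis t) - f (of_real r * cis t)))\<^sup>2) = A (R * R) + A (r * r) - 2 * A (R * r)"
    if "0 \<le> r" "r < 1" "0 \<le> R" "R < 1" for r R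
  proof -
    have "(cmod (x - y))\<^sup>2 = (Re (x * cnj x) + Re (y * cnj y)) - (Re (x * cnj y) + Re (x * cnj y))" for x y
      unfolding cmod_power2 by (simp add: power2_eq_square algebra_simps)
    then show ?thesis using that by (simp add: cmean_diff cmean_add cmean_cmult int sq del: times_complex.simps)
  qed
  have mono: "A (s * s) \<le> A (r * R)" if "0 \<le> s" "s \<le> r" "s \<le> R" "r < 1" "R < 1" for s r R
    unfolding A_def using that
    by (intro suminf_le sm mult_left_mono power_mono mult_mono) auto
  have A1: "A (r * r) \<le> 1" if "0 \<le> r" "r < 1" for r
  proof -
    have "A (r * r) \<le> cmean (\<lambda>t. 1)" unfolding sq[OF that that, symmetric]
    proof (intro cmean_mono int that)
      fix t
      have "Re (f (of_real r * cis t) * cnj (f (of_real r * cis t))) = (cmod (f (of_real r * cis t)))\<^sup>2"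
        by (simp only: complex_norm_square[symmetric] Re_complex_of_real)
      also have "\<dots> \<le> 1" using b[of "of_real r * cis t"] that by (simp add: norm_mult abs_square_le_1)
      finally show "Re (f (of_real r * cis t) * cnj (f (of_real r * cis t))) \<le> 1" .
    qed (auto intro!: integrable_circ)
    then show ?thesis by simp
  qed
  define L where "L = (SUP r\<in>{0<..<1}. A (r * r))"
  have bdd: "bdd_above ((\<lambda>r. A (r * r)) ` {0<..<1})" using A1 by (auto intro!: bdd_aboveI[of _ 1])
  have "L - e / 2 < L" using e by simp
  then obtain \<rho> where \<rho>: "0 < \<rho>" "\<rho> < 1" "L - e / 2 < A (\<rho> * \<rho>)"
    unfolding L_def using less_cSUP_iff[OF _ bdd] by auto
  have "cmean (\<lambda>t. (cmod (f (of_real R * cis t) - f (of_real r * cis t)))\<^sup>2) \<le> e"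
    if "\<rho> \<le> r" "r < 1" "\<rho> \<le> R" "R < 1" for r R
  proof -
    have "A (R * R) \<le> L" "A (r * r) \<le> L" unfolding L_def using that \<rho> by (auto intro!: cSUP_upper bdd)
    moreover have "A (\<rho> * \<rho>) \<le> A (R * r)" using that \<rho> by (intro mono) auto
    ultimately show ?thesis using \<rho> that by (subst dist) auto
  qed
  then show ?thesis using that \<rho> by blast
qed

text \<open>Expand the nonnegative variance of \<open>u\<close>.\<close>

lemma cmean_le_sqrt:
  assumes "continuous_on {0..2*pi} u"
  shows "(cmean u)\<^sup>2 \<le> cmean (\<lambda>t. (u t)\<^sup>2)"
proof -
  have "0 \<le> cmean (\<lambda>t. (u t - cmean u)\<^sup>2)" by (rule cmean_nonneg) auto
  also have "(\<lambda>t. (u t - cmean u)\<^sup>2) = (\<lambda>t. ((u t)\<^sup>2 + (cmean u)\<^sup>2) - 2 * cmean u * u t)"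
    by (auto simp: power2_eq_square algebra_simps)
  also have "cmean \<dots> = cmean (\<lambda>t. (u t)\<^sup>2 + (cmean u)\<^sup>2) - cmean (\<lambda>t. 2 * cmean u * u t)"
    by (rule cmean_diff) (intro integrable_circ continuous_intros assms)+
  also have "cmean (\<lambda>t. (u t)\<^sup>2 + (cmean u)\<^sup>2) = cmean (\<lambda>t. (u t)\<^sup>2) + (cmean u)\<^sup>2"
    by (subst cmean_add) (auto intro!: integrable_circ continuous_intros assms)
  also have "cmean (\<lambda>t. 2 * cmean u * u t) = 2 * cmean u * cmean u"
    unfolding cmean_def[of "\<lambda>t. _ * u t"] by (simp add: cmean_def)
  finally show ?thesis by (simp add: power2_eq_square)
qed

section \<open>Nontangential limits\<close>

lemma stolz_angle_mono:
  assumes "\<alpha> \<le> \<beta>" shows "stolz_angle \<alpha> \<zeta> \<subseteq> stolz_angle \<beta> \<zeta>"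
proof
  fix z assume z: "z \<in> stolz_angle \<alpha> \<zeta>"
  then have "0 \<le> 1 - (cmod z)\<^sup>2" unfolding stolz_angle_def by (simp add: abs_square_le_1)
  then have "\<alpha> * (1 - (cmod z)\<^sup>2) \<le> \<beta> * (1 - (cmod z)\<^sup>2)" using assms by (intro mult_right_mono)
  then show "z \<in> stolz_angle \<beta> \<zeta>" using z unfolding stolz_angle_def by auto
qed

lemma stolz_angle_bound:
  assumes "z \<in> stolz_angle \<alpha> \<zeta>" "0 \<le> \<alpha>"
  shows "cmod z < 1" "cmod (z - \<zeta>) \<le> 2 * \<alpha> * (1 - cmod z)"
proof -
  show z: "cmod z < 1" using assms unfolding stolz_angle_def by auto
  have "1 - (cmod z)\<^sup>2 = (1 + cmod z) * (1 - cmod z)" by (simp add: power2_eq_square algebra_simps)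
  also have "\<dots> \<le> 2 * (1 - cmod z)" using z by (intro mult_right_mono) auto
  finally have "\<alpha> * (1 - (cmod z)\<^sup>2) \<le> \<alpha> * (2 * (1 - cmod z))" using assms by (intro mult_left_mono)
  then show "cmod (z - \<zeta>) \<le> 2 * \<alpha> * (1 - cmod z)" using assms unfolding stolz_angle_def by (auto simp: mult_ac)
qed

lemma radius_minus_endpoint:
  assumes "cmod \<zeta> = 1" "0 \<le> r" "r < 1"
  shows "cmod (of_real r * \<zeta>) = r" "cmod (of_real r * \<zeta> - \<zeta>) = 1 - r"
proof -
  show "cmod (of_real r * \<zeta>) = r" using assms by (simp add: norm_mult)
  have "of_real r * \<zeta> - \<zeta> = of_real (r - 1) * \<zeta>" by (simp add: algebra_simps)
  then show "cmod (of_real r * \<zeta> - \<zeta>) = 1 - r" using assms by (simp only: norm_mult norm_of_real) simp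
qed

lemma radius_in_stolz_angle:
  assumes "cmod \<zeta> = 1" "0 \<le> r" "r < 1"
  shows "of_real r * \<zeta> \<in> stolz_angle 1 \<zeta>"
proof -
  have "r * r \<le> 1 * r" using assms by (intro mult_right_mono) auto
  then show ?thesis unfolding stolz_angle_def using radius_minus_endpoint[OF assms] assms
    by (simp add: power2_eq_square)
qed

lemma filterlim_radius_stolz_angle:
  assumes "cmod \<zeta> = 1" "1 \<le> \<alpha>"
  shows "filterlim (\<lambda>r. of_real r * \<zeta>) (at \<zeta> within stolz_angle \<alpha> \<zeta>) (at_left 1)"
  unfolding filterlim_at
proof
  show "\<forall>\<^sub>F r in at_left 1. complex_of_real r * \<zeta> \<in> stolz_angle \<alpha> \<zeta> \<and> complex_of_real r * \<zeta> \<noteq> \<zeta>"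
    using eventually_at_left_real[OF zero_less_one]
  proof eventually_elim
    case (elim r)
    then have "complex_of_real r * \<zeta> \<noteq> \<zeta>" using assms(1) by auto
    then show ?case using radius_in_stolz_angle[OF assms(1), of r] stolz_angle_mono[OF assms(2)] elim by auto
  qed
  have "((\<lambda>r. of_real r * \<zeta>) \<longlongrightarrow> of_real 1 * \<zeta>) (at_left 1)" by (intro tendsto_intros)
  then show "((\<lambda>r. complex_of_real r * \<zeta>) \<longlongrightarrow> \<zeta>) (at_left 1)" by simp
qed

lemma nontangential_limit_radial:
  assumes "has_nontangential_limit f \<zeta> l" "cmod \<zeta> = 1"
  shows "((\<lambda>r. f (of_real r * \<zeta>)) \<longlongrightarrow> l) (at_left 1)"
  using filterlim_compose[OF _ filterlim_radius_stolz_angle[OF assms(2) order_refl], of f "nhds l"] assms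
  unfolding has_nontangential_limit_def by simp

lemma nontangential_limit_unique:
  assumes "has_nontangential_limit f \<zeta> l" "has_nontangential_limit f \<zeta> l'" "cmod \<zeta> = 1"
  shows "l = l'"
  using nontangential_limit_radial[OF assms(1,3)] nontangential_limit_radial[OF assms(2,3)]
  by (rule tendsto_unique[rotated]) auto

lemma boundary_value_eqI:
  assumes "has_nontangential_limit f \<zeta> l" "cmod \<zeta> = 1"
  shows "boundary_value f \<zeta> = l"
  unfolding boundary_value_def using assms nontangential_limit_unique by blast

text \<open>The radius lies in every angle of aperture at least 1, which forces the limits for these
  apertures to agree; smaller apertures inherit the limit for aperture 1.\<close>

lemma nontangential_limitI:
  assumes \<zeta>: "cmod \<zeta> = 1" and ex: "\<And>\<alpha>. \<alpha> > 0 \<Longrightarrow> \<exists>l. (f \<longlongrightarrow> l) (at \<zeta> within stolz_angle \<alpha> \<zeta>)"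
  shows "\<exists>l. has_nontangential_limit f \<zeta> l"
proof -
  obtain l where l: "(f \<longlongrightarrow> l) (at \<zeta> within stolz_angle 1 \<zeta>)" using ex[of 1] by auto
  have rl: "((\<lambda>r. f (of_real r * \<zeta>)) \<longlongrightarrow> l) (at_left 1)"
    using filterlim_compose[OF l filterlim_radius_stolz_angle[OF \<zeta>]] by simp
  have "(f \<longlongrightarrow> l) (at \<zeta> within stolz_angle \<alpha> \<zeta>)" if \<alpha>: "\<alpha> > 0" for \<alpha>
  proof (cases "\<alpha> \<le> 1")
    case True
    then show ?thesis using l tendsto_within_subset stolz_angle_mono by blast
  next
    case False
    obtain l' where l': "(f \<longlongrightarrow> l') (at \<zeta> within stolz_angle \<alpha> \<zeta>)" using ex[OF \<alpha>] by blast
    have "((\<lambda>r. f (of_real r * \<zeta>)) \<longlongrightarrow> l') (at_left 1)"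
      using filterlim_compose[OF l' filterlim_radius_stolz_angle[OF \<zeta>]] False by simp
    then have "l = l'" using rl by (intro tendsto_unique) auto
    then show ?thesis using l' by simp
  qed
  then show ?thesis unfolding has_nontangential_limit_def by blast
qed

text \<open>Mean square increments of size \<open>(1/16) ^ k\<close> give mean increments of size
  \<open>(1/4) ^ k\<close>. The maximal inequality will split this rate into
  \<open>(1/2) ^ k\<close> for the level and \<open>(1/2) ^ k\<close> for the measure of the
  exceptional set.\<close>

lemma fast_radial_sequence:
  assumes f: "f holomorphic_on ball 0 1" and b: "\<And>z. cmod z < 1 \<Longrightarrow> cmod (f z) \<le> 1"
  obtains R :: "nat \<Rightarrow> real" where "\<And>k. 0 < R k" "\<And>k. R k < 1" "R \<longlonglongrightarrow> 1"
    "\<And>k. cmean (\<lambda>t. cmod (f (of_real (R (Suc k)) * cis t) - f (of_real (R k) * cis t))) \<le> (1/4) ^ k"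
proof -
  have "\<forall>k. \<exists>\<rho>. 0 < \<rho> \<and> \<rho> < 1 \<and> (\<forall>r R. \<rho> \<le> r \<longrightarrow> r < 1 \<longrightarrow> \<rho> \<le> R \<longrightarrow> R < 1 \<longrightarrow>
      cmean (\<lambda>t. (cmod (f (of_real R * cis t) - f (of_real r * cis t)))\<^sup>2) \<le> (1/16) ^ k)" (is "\<forall>k. ?P k")
  proof
    fix k show "?P k" by (rule bounded_radial_L2_Cauchy[OF f b, of "(1/16) ^ k"]) auto
  qed
  from choice[OF this] obtain \<rho> where \<rho>: "\<And>k. 0 < \<rho> k" "\<And>k. \<rho> k < 1"
    "\<And>k r R. \<rho> k \<le> r \<Longrightarrow> r < 1 \<Longrightarrow> \<rho> k \<le> R \<Longrightarrow> R < 1 \<Longrightarrow>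
      cmean (\<lambda>t. (cmod (f (of_real R * cis t) - f (of_real r * cis t)))\<^sup>2) \<le> (1/16) ^ k"
    by blast
  \<comment> \<open>The maximum over all earlier thresholds puts both \<open>R k\<close> and
    \<open>R (Suc k)\<close> above \<open>\<rho> k\<close>; the second entry forces convergence to
    1.\<close>
  define R where "R k = max (Max (\<rho> ` {..k})) (1 - 1 / (real k + 2))" for k
  have ge: "\<rho> j \<le> R k" if "j \<le> k" for j k
  proof -
    have "\<rho> j \<le> Max (\<rho> ` {..k})" using that by (intro Max_ge) auto
    then show ?thesis unfolding R_def by simp
  qed
  have R0: "0 < R k" for k using ge[of k k] \<rho>(1)[of k] by simp
  have R1: "R k < 1" for k unfolding R_def using \<rho>(2) by (auto simp: Max_less_iff)
  have lim: "R \<longlonglongrightarrow> 1"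
  proof (rule tendsto_sandwich[of "\<lambda>k. 1 - 1 / (real k + 2)"])
    show "(\<lambda>k. 1 - 1 / (real k + 2)) \<longlonglongrightarrow> 1" by real_asymp
    show "\<forall>\<^sub>F k in sequentially. R k \<le> 1" using R1 by (auto intro: always_eventually less_imp_le)
  qed (auto simp: R_def)
  have "cmean (\<lambda>t. cmod (f (of_real (R (Suc k)) * cis t) - f (of_real (R k) * cis t))) \<le> (1/4) ^ k" for k
  proof (rule power2_le_imp_le)
    have fc: "continuous_on {0..2*pi} (\<lambda>t. f (of_real r * cis t))" if "0 \<le> r" "r < 1" for r
      by (rule continuous_on_compose2[OF dilation_disc(1)[OF f that]]) (auto intro!: continuous_intros)
    have "(cmean (\<lambda>t. cmod (f (of_real (R (Suc k)) * cis t) - f (of_real (R k) * cis t))))\<^sup>2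
      \<le> cmean (\<lambda>t. (cmod (f (of_real (R (Suc k)) * cis t) - f (of_real (R k) * cis t)))\<^sup>2)"
      by (intro cmean_le_sqrt continuous_intros fc less_imp_le R0 R1)
    also have "\<dots> \<le> (1/16) ^ k" by (intro \<rho>(3) ge R1) auto
    also have "(1/16 :: real) ^ k = ((1/4) ^ k)\<^sup>2" by (simp add: power2_eq_square flip: power_mult_distrib)
    finally show "(cmean (\<lambda>t. cmod (f (of_real (R (Suc k)) * cis t) - f (of_real (R k) * cis t))))\<^sup>2 \<le> ((1/4) ^ k)\<^sup>2" .
  qed auto
  then show ?thesis using that R0 R1 lim by blast
qed

text \<open>Fatou's theorem for bounded functions: outside a null set of \<open>\<theta>\<close> the increments of the
  dilations along a fast radial sequence are summable uniformly on every Stolz angle at \<open>cis \<theta>\<close>.\<close>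
lemma bounded_nontangential_limit_AE:
  assumes f: "f holomorphic_on ball 0 1" and b: "\<And>z. cmod z < 1 \<Longrightarrow> cmod (f z) \<le> 1"
  shows "AE \<theta> in circ. \<exists>l. has_nontangential_limit f (cis \<theta>) l"
proof -
  obtain R :: "nat \<Rightarrow> real" where R: "\<And>k. 0 < R k" "\<And>k. R k < 1" "R \<longlonglongrightarrow> 1"
    "\<And>k. cmean (\<lambda>t. cmod (f (of_real (R (Suc k)) * cis t) - f (of_real (R k) * cis t))) \<le> (1/4) ^ k"
    using fast_radial_sequence[OF f b] by blast
  define G where "G k z = f (of_real (R (Suc k)) * z) - f (of_real (R k) * z)" for k z
  have Fc: "continuous_on (cball 0 1) (\<lambda>z. f (of_real (R k) * z))"
    and Fh: "(\<lambda>z. f (of_real (R k) * z)) holomorphic_on ball 0 1" for k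
    using dilation_disc[OF f] R(1,2) less_imp_le by blast+
  have Gc: "continuous_on (cball 0 1) (G k)" and Gh: "G k holomorphic_on ball 0 1" for k
    unfolding G_def by (intro continuous_intros holomorphic_intros Fc Fh)+
  have Gcis: "continuous_on UNIV (\<lambda>t. cmod (G k (cis t)))" for k
    by (intro continuous_intros continuous_on_compose2[OF Gc]) auto
  \<comment> \<open>The 60 is the 10 of the maximal inequality times the 6 of the three
    periods.\<close>
  have "\<exists>T. T \<in> lmeasurable \<and> measure lebesgue T \<le> 60 * pi * (1/2) ^ k \<and>
      (\<forall>x h. x \<in> {0..2*pi} - T \<longrightarrow> 0 < h \<longrightarrow> h \<le> 2 * pi \<longrightarrow> integral {x-h..x+h} (\<lambda>t. cmod (G k (cis t))) \<le> (1/2) ^ k * h)" for k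
  proof -
    have c: "continuous_on (sphere 0 1) (\<lambda>w. cmod (G k w))"
      by (intro continuous_intros continuous_on_subset[OF Gc]) auto
    have "10 / (1/2) ^ k * integral {-2*pi..4*pi} (\<lambda>t. cmod (G k (cis t))) \<le> 10 * 2 ^ k * (6 * pi * (1/4) ^ k)"
      unfolding integral_three_periods[OF c] using R(4)[of k] unfolding G_def
      by (intro mult_mono) (auto simp: power_one_over divide_simps intro!: cmean_nonneg mult_nonneg_nonneg)
    also have "\<dots> = 60 * pi * (1/2) ^ k"
    proof -
      have "(4::real) ^ k = 2 ^ k * 2 ^ k" by (simp flip: power_mult_distrib)
      then show ?thesis by (simp add: power_one_over)
    qed
    finally have le: "10 / (1/2) ^ k * integral {-2*pi..4*pi} (\<lambda>t. cmod (G k (cis t))) \<le> 60 * pi * (1/2) ^ k" .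
    show ?thesis
      by (rule maximal_weak_type[OF Gcis, of k "(1/2) ^ k"]) (use le order_trans in \<open>auto\<close>)
  qed
  then obtain T where T: "\<And>k. T k \<in> lmeasurable" "\<And>k. measure lebesgue (T k) \<le> 60 * pi * (1/2) ^ k"
    "\<And>k x h. x \<in> {0..2*pi} - T k \<Longrightarrow> 0 < h \<Longrightarrow> h \<le> 2 * pi \<Longrightarrow> integral {x-h..x+h} (\<lambda>t. cmod (G k (cis t))) \<le> (1/2) ^ k * h"
    by metis
  \<comment> \<open>Borel-Cantelli: almost every argument is exceptional for finitely many
    increments only, so from some index \<open>n\<close> on all increments obey the maximal
    bound.\<close>
  have "AE x in lebesgue. eventually (\<lambda>k. x \<in> space lebesgue - T k) sequentially"
  proof (rule borel_cantelli_AE1)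
    show "T k \<in> sets lebesgue" for k using T(1) by (rule fmeasurableD)
    show "emeasure lebesgue (T k) < \<infinity>" for k using T(1)[of k] fmeasurableD2[of "T k" lebesgue] by (simp add: top.not_eq_extremum)
    have "summable (\<lambda>k. 60 * pi * (1/2 :: real) ^ k)" by (intro summable_mult summable_geometric) auto
    then show "summable (\<lambda>k. measure lebesgue (T k))"
      by (rule summable_comparison_test') (use T(2) in auto)
  qed
  then have "AE x in lebesgue. x \<in> {0..2*pi} \<longrightarrow> (\<exists>l. has_nontangential_limit f (cis x) l)"
  proof (rule AE_mp, intro AE_I2 impI)
    fix \<theta> :: real
    assume "eventually (\<lambda>k. \<theta> \<in> space lebesgue - T k) sequentially" and \<theta>: "\<theta> \<in> {0..2*pi}"
    then obtain n where n: "\<And>k. n \<le> k \<Longrightarrow> \<theta> \<notin> T k" unfolding eventually_sequentially by auto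
    define \<zeta> where "\<zeta> = cis \<theta>"
    have \<zeta>: "cmod \<zeta> = 1" unfolding \<zeta>_def by simp
    show "\<exists>l. has_nontangential_limit f (cis \<theta>) l" unfolding \<zeta>_def[symmetric]
    proof (rule nontangential_limitI[OF \<zeta>])
      fix \<alpha> :: real assume \<alpha>: "\<alpha> > 0"
      \<comment> \<open>The part \<open>2 * \<alpha>\<close> comes from replacing
        \<open>1 - (cmod z)\<^sup>2\<close> by \<open>1 - cmod z\<close>; the extra 1 admits the
        radius, along which the bound reaches the vertex.\<close>
      let ?A = "2 * \<alpha> + 1"
      define C where "C = 64 * (1 + ?A)\<^sup>2"
      have bound: "cmod (G k z) \<le> C * (1/2) ^ k" if k: "n \<le> k" and z: "cmod z < 1" "cmod (z - \<zeta>) \<le> ?A * (1 - cmod z)" for k z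
        unfolding C_def
      proof (rule stolz_maximal_bound[OF Gc Gh z(1) _ z(2)[unfolded \<zeta>_def]])
        fix h :: real assume h: "0 < h" "h \<le> pi"
        then show "integral {\<theta>-h..\<theta>+h} (\<lambda>t. cmod (G k (cis t))) \<le> (1/2) ^ k * h"
          using T(3)[of \<theta> k h] n[OF k] \<theta> by auto
      qed (use \<alpha> in auto)
      \<comment> \<open>Adding the vertex turns the existence of a limit into continuity at a point:
        the dilations, unlike \<open>f\<close>, are defined and continuous there.\<close>
      let ?B = "insert \<zeta> (stolz_angle \<alpha> \<zeta>)"
      have B: "?B \<subseteq> cball 0 1" using \<zeta> stolz_angle_bound(1)[of _ \<alpha> \<zeta>] \<alpha> by force
      have boundB: "cmod (G k z) \<le> C * (1/2) ^ k" if k: "n \<le> k" and z: "z \<in> ?B" for k z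
      proof (cases "z = \<zeta>")
        case False
        then have "z \<in> stolz_angle \<alpha> \<zeta>" using z by simp
        from stolz_angle_bound[OF this] show ?thesis
          using \<alpha> by (intro bound k) (auto simp: algebra_simps)
      next
        case True
        have "((\<lambda>r. of_real r * \<zeta>) \<longlongrightarrow> of_real 1 * \<zeta>) (at_left 1)" by (intro tendsto_intros)
        moreover have "\<forall>\<^sub>F r in at_left 1. complex_of_real r * \<zeta> \<in> cball 0 1"
          using eventually_at_left_real[OF zero_less_one] by eventually_elim (auto simp: norm_mult \<zeta>)
        ultimately have "((\<lambda>r. G k (of_real r * \<zeta>)) \<longlongrightarrow> G k \<zeta>) (at_left 1)"
          using continuous_on_tendsto_compose[OF Gc[of k], of "\<lambda>r. of_real r * \<zeta>" \<zeta> "at_left 1"] \<zeta> by simp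
        then have "((\<lambda>r. cmod (G k (of_real r * \<zeta>))) \<longlongrightarrow> cmod (G k \<zeta>)) (at_left 1)" by (rule tendsto_norm)
        moreover have "\<forall>\<^sub>F r in at_left 1. cmod (G k (of_real r * \<zeta>)) \<le> C * (1/2) ^ k"
          using eventually_at_left_real[OF zero_less_one]
        proof eventually_elim
          case (elim r)
          then have r: "0 \<le> r" "r < 1" by auto
          have "(1 - r) * 1 \<le> (1 - r) * ?A" using r \<alpha> by (intro mult_left_mono) auto
          then show ?case using radius_minus_endpoint[OF \<zeta> r] r by (intro bound k) (auto simp: mult.commute)
        qed
        ultimately show ?thesis unfolding True by (rule tendsto_upperbound) auto
      qed
      \<comment> \<open>The series telescopes to \<open>f\<close> inside the angle, and its uniform
        convergence on \<open>?B\<close> makes \<open>H\<close> continuous at the vertex.\<close>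
      define H where "H z = f (of_real (R n) * z) + (\<Sum>i. G (n + i) z)" for z
      have ul: "uniform_limit ?B (\<lambda>N z. \<Sum>i<N. G (n + i) z) (\<lambda>z. \<Sum>i. G (n + i) z) sequentially"
      proof (rule Weierstrass_m_test)
        show "norm (G (n + i) z) \<le> C * (1/2) ^ (n + i)" if "z \<in> ?B" for i z
          using boundB[of "n + i" z] that by simp
        show "summable (\<lambda>i. C * (1/2) ^ (n + i))"
          unfolding power_add by (intro summable_mult summable_geometric) auto
      qed
      have "continuous_on ?B (\<lambda>z. \<Sum>i. G (n + i) z)"
        by (rule uniform_limit_theorem[OF _ ul])
           (auto intro!: always_eventually continuous_on_sum continuous_on_subset[OF Gc B])
      then have Hc: "continuous_on ?B H"
        unfolding H_def by (intro continuous_intros continuous_on_subset[OF Fc B])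
      have Hf: "H z = f z" if z: "z \<in> stolz_angle \<alpha> \<zeta>" for z
      proof -
        have "(\<Sum>i<N. G (n + i) z) = f (of_real (R (n + N)) * z) - f (of_real (R n) * z)" for N
          by (induction N) (auto simp: G_def)
        moreover have "(\<lambda>N. f (of_real (R (n + N)) * z)) \<longlonglongrightarrow> f z"
        proof -
          have "z \<in> ball 0 1" using stolz_angle_bound(1)[OF z] \<alpha> by simp
          then have "isCont f z" using f holomorphic_on_imp_continuous_on
            by (metis continuous_on_eq_continuous_at open_ball)
          moreover have "(\<lambda>N. R (n + N)) \<longlonglongrightarrow> 1" using LIMSEQ_ignore_initial_segment[OF R(3), of n] by (simp add: add.commute)
          then have "(\<lambda>N. of_real (R (n + N)) * z) \<longlonglongrightarrow> of_real 1 * z" by (intro tendsto_intros)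
          ultimately show ?thesis using isCont_tendsto_compose[of z f] by simp
        qed
        ultimately have "(\<lambda>N. \<Sum>i<N. G (n + i) z) \<longlonglongrightarrow> f z - f (of_real (R n) * z)"
          by (simp add: tendsto_diff)
        moreover have "(\<lambda>N. \<Sum>i<N. G (n + i) z) \<longlonglongrightarrow> (\<Sum>i. G (n + i) z)"
          using tendsto_uniform_limitI[OF ul] z by blast
        ultimately have "(\<Sum>i. G (n + i) z) = f z - f (of_real (R n) * z)" using LIMSEQ_unique by blast
        then show ?thesis unfolding H_def by simp
      qed
      have "(H \<longlongrightarrow> H \<zeta>) (at \<zeta> within ?B)" using Hc unfolding continuous_on_def by blast
      then have "(H \<longlongrightarrow> H \<zeta>) (at \<zeta> within stolz_angle \<alpha> \<zeta>)" by (rule tendsto_within_subset) auto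
      then have "(f \<longlongrightarrow> H \<zeta>) (at \<zeta> within stolz_angle \<alpha> \<zeta>)"
        by (rule Lim_transform_eventually) (auto simp: eventually_at_filter Hf)
      then show "\<exists>l. (f \<longlongrightarrow> l) (at \<zeta> within stolz_angle \<alpha> \<zeta>)" by blast
    qed
  qed
  then show ?thesis by (subst AE_restrict_space_iff) auto
qed

text \<open>The last conclusion is a quantitative form of \<open>g\<close> not vanishing
  identically: its bound does not depend on \<open>L\<close>, so it also limits how often the
  boundary values of \<open>g\<close> may be 0. Truncating at \<open>exp (- L)\<close> keeps the
  logarithm bounded, so that this bound survives the normal families limit by dominated
  convergence.\<close>

lemma nevanlinna_factorization:
  assumes "f \<in> nevanlinna_class"
  obtains g C where "g holomorphic_on ball 0 1" "\<And>z. cmod z < 1 \<Longrightarrow> cmod (g z) \<le> 1"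
    "\<And>z. cmod z < 1 \<Longrightarrow> cmod (f z * g z) \<le> 1"
    "\<And>L r. 0 \<le> L \<Longrightarrow> 0 \<le> r \<Longrightarrow> r < 1 \<Longrightarrow> cmean (\<lambda>\<theta>. - ln (max (cmod (g (of_real r * cis \<theta>))) (exp (- L)))) \<le> C"
proof -
  have f: "f holomorphic_on ball 0 1" using assms by (rule nevanlinna_class_holomorphic)
  obtain C where C: "\<And>r. 0 \<le> r \<Longrightarrow> r < 1 \<Longrightarrow> circle_log_mean f r \<le> C"
    using nevanlinna_class_bounded_means[OF assms] by metis
  define R where "R n = 1 - 1 / (real n + 2)" for n
  have R: "0 \<le> R n" "R n < 1" for n unfolding R_def by auto
  have Rlim: "R \<longlonglongrightarrow> 1" unfolding R_def by real_asymp
  have "\<exists>h. h holomorphic_on UNIV \<and> (\<forall>z. cmod z \<le> 1 \<longrightarrow> 0 \<le> Re (h z)) \<and>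
    (\<forall>z. cmod z \<le> 1 \<longrightarrow> cmod (f (of_real (R n) * z)) \<le> exp (Re (h z))) \<and> Re (h 0) \<le> C + 1" for n
    by (rule log_plus_majorant[OF f R(1)[of n] R(2) zero_less_one]) (use C[OF R(1)[of n] R(2)] in fastforce)
  then obtain h where h: "\<And>n. h n holomorphic_on UNIV" "\<And>n z. cmod z \<le> 1 \<Longrightarrow> 0 \<le> Re (h n z)"
    "\<And>n z. cmod z \<le> 1 \<Longrightarrow> cmod (f (of_real (R n) * z)) \<le> exp (Re (h n z))"
    "\<And>n. Re (h n 0) \<le> C + 1"
    by metis
  have hh: "h n holomorphic_on A" for n A using h(1) holomorphic_on_subset by blast
  define F where "F n z = exp (- h n z)" for n z
  define H where "H = {k. k holomorphic_on ball 0 1 \<and> (\<forall>z \<in> ball 0 1. cmod (k z) \<le> 1)}"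
  have FH: "range F \<subseteq> H" unfolding H_def F_def[abs_def] using h(2) by (auto intro!: holomorphic_intros hh)
  obtain g \<sigma> where g: "g holomorphic_on ball 0 1" and \<sigma>: "strict_mono (\<sigma> :: nat \<Rightarrow> nat)"
    and lim: "\<And>x. x \<in> ball 0 1 \<Longrightarrow> ((\<lambda>n. F (\<sigma> n) x) \<longlongrightarrow> g x) sequentially"
  proof (rule Montel[of "ball 0 1" H F])
    show "\<exists>B. \<forall>h\<in>H. \<forall>z\<in>K. cmod (h z) \<le> B" if "K \<subseteq> ball 0 1" for K
      using that unfolding H_def by blast
  qed (use FH in \<open>auto simp: H_def\<close>)
  have g1: "cmod (g z) \<le> 1" if z: "cmod z < 1" for z
    by (rule tendsto_upperbound[OF tendsto_norm[OF lim[of z]]]) (use z FH in \<open>auto simp: H_def image_subset_iff\<close>)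
  have fg: "cmod (f z * g z) \<le> 1" if z: "cmod z < 1" for z
  proof (rule tendsto_upperbound)
    have "isCont f z" using f z holomorphic_on_imp_continuous_on
      by (metis continuous_on_eq_continuous_at mem_ball_0 open_ball)
    moreover have "(\<lambda>n. R (\<sigma> n)) \<longlonglongrightarrow> 1" using LIMSEQ_subseq_LIMSEQ[OF Rlim \<sigma>] by (simp add: o_def)
    then have "(\<lambda>n. of_real (R (\<sigma> n)) * z) \<longlonglongrightarrow> of_real 1 * z" by (intro tendsto_intros)
    ultimately have "(\<lambda>n. f (of_real (R (\<sigma> n)) * z)) \<longlonglongrightarrow> f z" using isCont_tendsto_compose[of z f] by simp
    then show "(\<lambda>n. cmod (f (of_real (R (\<sigma> n)) * z) * F (\<sigma> n) z)) \<longlonglongrightarrow> cmod (f z * g z)"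
      using z by (intro tendsto_intros lim) auto
    show "\<forall>\<^sub>F n in sequentially. cmod (f (of_real (R (\<sigma> n)) * z) * F (\<sigma> n) z) \<le> 1"
      using h(3)[of z] z by (auto simp: F_def norm_mult norm_divide exp_minus norm_inverse divide_simps intro!: always_eventually)
  qed auto
  have "cmean (\<lambda>\<theta>. - ln (max (cmod (g (of_real r * cis \<theta>))) (exp (- L)))) \<le> C + 1"
    if L: "0 \<le> L" and r: "0 \<le> r" "r < 1" for L r
  proof (rule LIMSEQ_le_const2)
    let ?u = "\<lambda>w. - ln (max (cmod w) (exp (- L)))"
    have bnd: "\<bar>?u w\<bar> \<le> L" if "cmod w \<le> 1" for w
    proof -
      have "exp (- L) \<le> 1" using L by simp
      then have "ln (max (cmod w) (exp (- L))) \<le> ln 1" using that by (intro ln_mono) (auto simp: max_def)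
      moreover have "ln (exp (- L)) \<le> ln (max (cmod w) (exp (- L)))" by (intro ln_mono) auto
      ultimately show ?thesis by simp
    qed
    have uc: "continuous_on A ?u" for A by (intro continuous_intros) (auto simp: max_def)
    have rc: "of_real r * cis \<theta> \<in> ball 0 1" for \<theta> using r by (simp add: norm_mult)
    have cont: "continuous_on B (\<lambda>\<theta>. ?u (k (of_real r * cis \<theta>)))" if "k holomorphic_on ball 0 1" for k B
      by (intro continuous_on_compose2[OF uc[of UNIV]] continuous_on_compose2[OF holomorphic_on_imp_continuous_on[OF that]] continuous_intros)
        (use rc in auto)
    have Fhol: "F n holomorphic_on ball 0 1" for n using FH unfolding H_def by auto
    have "(\<lambda>n. \<integral>\<theta>. ?u (F (\<sigma> n) (of_real r * cis \<theta>)) \<partial>circ) \<longlonglongrightarrow> (\<integral>\<theta>. ?u (g (of_real r * cis \<theta>)) \<partial>circ)"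
    proof (rule integral_dominated_convergence)
      show "integrable circ (\<lambda>_. L)" by (rule integrable_circ) auto
      show "AE \<theta> in circ. (\<lambda>n. ?u (F (\<sigma> n) (of_real r * cis \<theta>))) \<longlonglongrightarrow> ?u (g (of_real r * cis \<theta>))"
        by (intro AE_I2 tendsto_intros lim rc) (auto simp: max_def)
      show "AE \<theta> in circ. norm (?u (F (\<sigma> n) (of_real r * cis \<theta>))) \<le> L" for n
      proof (rule AE_I2)
        fix \<theta>
        have "cmod (F (\<sigma> n) (of_real r * cis \<theta>)) \<le> 1" using FH rc[of \<theta>] unfolding H_def by blast
        from bnd[OF this] show "norm (?u (F (\<sigma> n) (of_real r * cis \<theta>))) \<le> L" by simp
      qed
      show "(\<lambda>\<theta>. ?u (g (of_real r * cis \<theta>))) \<in> borel_measurable circ"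
        by (rule continuous_imp_measurable_on_sets_lebesgue[OF cont[OF g]]) auto
      show "(\<lambda>\<theta>. ?u (F (\<sigma> n) (of_real r * cis \<theta>))) \<in> borel_measurable circ" for n
        by (rule continuous_imp_measurable_on_sets_lebesgue[OF cont[OF Fhol]]) auto
    qed
    then show "(\<lambda>n. cmean (\<lambda>\<theta>. ?u (F (\<sigma> n) (of_real r * cis \<theta>)))) \<longlonglongrightarrow> cmean (\<lambda>\<theta>. ?u (g (of_real r * cis \<theta>)))"
      unfolding cmean_def by (intro tendsto_divide) auto
    \<comment> \<open>Truncation only lowers the negative logarithm of \<open>F n\<close>, which is
      the real part of \<open>h n\<close>; the mean of the latter is its value at 0.\<close>
    have "cmean (\<lambda>\<theta>. ?u (F n (of_real r * cis \<theta>))) \<le> C + 1" for n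
    proof -
      let ?k = "\<lambda>z. h n (of_real r * z)"
      have k: "?k holomorphic_on A" for A
        by (intro holomorphic_on_compose_gen[unfolded o_def, OF _ h(1)] holomorphic_intros) auto
      then have kc: "continuous_on A ?k" for A by (rule holomorphic_on_imp_continuous_on)
      have "cmean (\<lambda>\<theta>. ?u (F n (of_real r * cis \<theta>))) \<le> cmean (\<lambda>\<theta>. Re (?k (cis \<theta>)))"
      proof (rule cmean_mono)
        show "integrable circ (\<lambda>\<theta>. ?u (F n (of_real r * cis \<theta>)))" by (intro integrable_circ cont Fhol)
        show "integrable circ (\<lambda>\<theta>. Re (?k (cis \<theta>)))"
          by (intro integrable_circ_cis[of "\<lambda>z. Re (?k z)"] continuous_intros kc)
        fix \<theta>
        have "ln (exp (- Re (?k (cis \<theta>)))) \<le> ln (max (cmod (F n (of_real r * cis \<theta>))) (exp (- L)))"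
          by (intro ln_mono) (auto simp: F_def)
        then show "?u (F n (of_real r * cis \<theta>)) \<le> Re (?k (cis \<theta>))" by simp
      qed
      also have "\<dots> = Re (?k 0)" by (intro mean_value_Re k kc)
      finally show ?thesis using h(4)[of n] by simp
    qed
    then show "\<exists>N. \<forall>n\<ge>N. cmean (\<lambda>\<theta>. ?u (F (\<sigma> n) (of_real r * cis \<theta>))) \<le> C + 1" by blast
  qed
  then show ?thesis using that[OF g g1 fg] by blast
qed

lemma radial_sequence:
  fixes r :: "nat \<Rightarrow> real"
  defines "r \<equiv> \<lambda>k. 1 - 1 / (real k + 2)"
  shows "0 < r k" "r k < 1" "filterlim r (at_left 1) sequentially"
proof -
  show r: "0 < r k" "r k < 1" for k unfolding r_def by auto
  have "r \<longlonglongrightarrow> 1" unfolding r_def by real_asymp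
  then show "filterlim r (at_left 1) sequentially"
    using r by (auto simp: filterlim_at less_imp_neq intro!: always_eventually)
qed

text \<open>A bounded function whose boundary values vanished on a set of positive measure would have
  unbounded truncated logarithmic means.\<close>
lemma nevanlinna_nontangential_limit_AE:
  assumes N: "f \<in> nevanlinna_class"
  shows "AE \<theta> in circ. \<exists>l. has_nontangential_limit f (cis \<theta>) l"
proof -
  have f: "f holomorphic_on ball 0 1" using N by (rule nevanlinna_class_holomorphic)
  obtain g C where g: "g holomorphic_on ball 0 1" "\<And>z. cmod z < 1 \<Longrightarrow> cmod (g z) \<le> 1"
    "\<And>z. cmod z < 1 \<Longrightarrow> cmod (f z * g z) \<le> 1"
    "\<And>L r. 0 \<le> L \<Longrightarrow> 0 \<le> r \<Longrightarrow> r < 1 \<Longrightarrow> cmean (\<lambda>\<theta>. - ln (max (cmod (g (of_real r * cis \<theta>))) (exp (- L)))) \<le> C"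
    using nevanlinna_factorization[OF N] by metis
  have AEg: "AE \<theta> in circ. \<exists>l. has_nontangential_limit g (cis \<theta>) l"
    by (rule bounded_nontangential_limit_AE[OF g(1,2)])
  have AEfg: "AE \<theta> in circ. \<exists>l. has_nontangential_limit (\<lambda>z. f z * g z) (cis \<theta>) l"
    by (rule bounded_nontangential_limit_AE) (auto intro!: holomorphic_intros f g)
  define r :: "nat \<Rightarrow> real" where "r = (\<lambda>k. 1 - 1 / (real k + 2))"
  have r: "0 < r k" "r k < 1" "filterlim r (at_left 1) sequentially" for k
    using radial_sequence unfolding r_def by auto
  have rball: "cmod (of_real (r k) * cis \<theta>) < 1" for k \<theta>
    using r(1,2)[of k] by (simp add: norm_mult)
  \<comment> \<open>A limit along a sequence is measurable by construction, and almost everywhere it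
    is the modulus of the boundary value of \<open>g\<close>.\<close>
  define m where "m \<theta> = lim (\<lambda>k. cmod (g (of_real (r k) * cis \<theta>)))" for \<theta>
  have rad: "(\<lambda>k. cmod (g (of_real (r k) * cis \<theta>))) \<longlonglongrightarrow> cmod l" if "has_nontangential_limit g (cis \<theta>) l" for \<theta> l
    using filterlim_compose[OF nontangential_limit_radial[OF that] r(3)] by (auto intro: tendsto_norm)
  have cont: "continuous_on B (\<lambda>\<theta>. cmod (g (of_real (r k) * cis \<theta>)))" for k B
    by (intro continuous_intros continuous_on_compose2[OF holomorphic_on_imp_continuous_on[OF g(1)]])
      (use rball in auto)
  have meas[measurable]: "(\<lambda>\<theta>. cmod (g (of_real (r k) * cis \<theta>))) \<in> borel_measurable circ" for k
    by (rule continuous_imp_measurable_on_sets_lebesgue[OF cont]) auto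
  have mm[measurable]: "m \<in> borel_measurable circ" unfolding m_def by measurable
  have AEm: "AE \<theta> in circ. (\<lambda>k. cmod (g (of_real (r k) * cis \<theta>))) \<longlonglongrightarrow> m \<theta>"
    using AEg by eventually_elim (use rad limI in \<open>fastforce simp: m_def\<close>)
  define Z where "Z = {\<theta> \<in> space circ. m \<theta> = 0}"
  have Z: "Z \<in> sets circ" unfolding Z_def by measurable
  \<comment> \<open>On \<open>Z\<close> the truncated logarithm contributes exactly
    \<open>L\<close>, and elsewhere it is nonnegative almost everywhere. As \<open>C\<close> does
    not depend on \<open>L\<close>, the set must be null.\<close>
  have Zb: "L * measure circ Z \<le> 2 * pi * C" if L: "L > 0" for L
  proof -
    let ?u = "\<lambda>x. - ln (max x (exp (- L)))"
    have bnd: "\<bar>ln (max x (exp (- L)))\<bar> \<le> L" if "x \<le> 1" for x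
    proof -
      have "exp (- L) \<le> 1" using L by simp
      then have "ln (max x (exp (- L))) \<le> ln 1" using that by (intro ln_mono) (auto simp: less_max_iff_disj)
      moreover have "ln (exp (- L)) \<le> ln (max x (exp (- L)))" by (intro ln_mono) auto
      ultimately show ?thesis by simp
    qed
    have mle: "AE \<theta> in circ. m \<theta> \<le> 1"
      using AEm by eventually_elim
        (rule LIMSEQ_le_const2, assumption, use rball g(2) in auto)
    have "(\<lambda>k. \<integral>\<theta>. ?u (cmod (g (of_real (r k) * cis \<theta>))) \<partial>circ) \<longlonglongrightarrow> (\<integral>\<theta>. ?u (m \<theta>) \<partial>circ)"
    proof (rule integral_dominated_convergence)
      show "integrable circ (\<lambda>_. L)" by (rule integrable_circ) auto
      show "AE \<theta> in circ. (\<lambda>k. ?u (cmod (g (of_real (r k) * cis \<theta>)))) \<longlonglongrightarrow> ?u (m \<theta>)"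
        using AEm by eventually_elim (intro tendsto_intros, auto simp: max_def)
      show "AE \<theta> in circ. norm (?u (cmod (g (of_real (r k) * cis \<theta>)))) \<le> L" for k
        using g(2)[OF rball] by (intro AE_I2) (auto intro!: bnd)
    qed measurable
    moreover have "(\<integral>\<theta>. ?u (cmod (g (of_real (r k) * cis \<theta>))) \<partial>circ) \<le> 2 * pi * C" for k
      using g(4)[of L "r k"] L r(1,2)[of k] unfolding cmean_def by (simp add: field_simps)
    ultimately have "(\<integral>\<theta>. ?u (m \<theta>) \<partial>circ) \<le> 2 * pi * C" by (intro LIMSEQ_le_const2) auto
    moreover have "(\<integral>\<theta>. L * indicator Z \<theta> \<partial>circ) \<le> (\<integral>\<theta>. ?u (m \<theta>) \<partial>circ)"
    proof (rule integral_mono_AE)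
      show "integrable circ (\<lambda>\<theta>. L * indicator Z \<theta>)"
        by (rule finite_measure.integrable_const_bound[OF finite_measure_circ, of _ L])
          (use L Z in \<open>auto simp: indicator_def\<close>)
      show "integrable circ (\<lambda>\<theta>. ?u (m \<theta>))"
        by (rule finite_measure.integrable_const_bound[OF finite_measure_circ, of _ L])
          (use mle bnd in auto)
      show "AE \<theta> in circ. L * indicator Z \<theta> \<le> ?u (m \<theta>)"
        using mle
      proof eventually_elim
        case (elim \<theta>)
        have "\<theta> \<in> Z \<Longrightarrow> ?u (m \<theta>) = L" unfolding Z_def by (simp add: max_def)
        moreover have "ln (max (m \<theta>) (exp (- L))) \<le> ln 1" using elim L by (intro ln_mono) (auto simp: less_max_iff_disj)
        ultimately show ?case by (auto simp: indicator_def)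
      qed
    qed
    moreover have "Z \<inter> {0..2 * pi} = Z" unfolding Z_def by auto
    ultimately show ?thesis by simp
  qed
  have "measure circ Z = 0"
  proof (rule ccontr)
    assume "measure circ Z \<noteq> 0"
    then have p: "0 < measure circ Z" by (simp add: zero_less_measure_iff)
    have "(\<bar>2 * pi * C\<bar> + 1) / measure circ Z * measure circ Z \<le> 2 * pi * C" by (intro Zb divide_pos_pos p) auto
    then show False using p by simp
  qed
  then have "Z \<in> null_sets circ"
    using Z finite_measure.emeasure_eq_measure[OF finite_measure_circ] by (auto intro!: null_setsI)
  then have "AE \<theta> in circ. \<theta> \<notin> Z" by (rule AE_not_in)
  then show ?thesis using AEg AEfg AEm AE_space
  proof eventually_elim
    case (elim \<theta>)
    then obtain l l' where l: "has_nontangential_limit g (cis \<theta>) l" and l': "has_nontangential_limit (\<lambda>z. f z * g z) (cis \<theta>) l'"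
      by blast
    have "m \<theta> = cmod l" unfolding m_def using rad[OF l] by (rule limI)
    moreover have "m \<theta> \<noteq> 0" using elim unfolding Z_def by auto
    ultimately have l0: "l \<noteq> 0" by auto
    have "(f \<longlongrightarrow> l' / l) (at (cis \<theta>) within stolz_angle \<alpha> (cis \<theta>))" if \<alpha>: "\<alpha> > 0" for \<alpha>
    proof (rule Lim_transform_eventually)
      have g: "(g \<longlongrightarrow> l) (at (cis \<theta>) within stolz_angle \<alpha> (cis \<theta>))"
        using l \<alpha> unfolding has_nontangential_limit_def by blast
      show "((\<lambda>z. f z * g z / g z) \<longlongrightarrow> l' / l) (at (cis \<theta>) within stolz_angle \<alpha> (cis \<theta>))"
        using l' \<alpha> l0 unfolding has_nontangential_limit_def by (intro tendsto_divide g) auto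
      show "\<forall>\<^sub>F z in at (cis \<theta>) within stolz_angle \<alpha> (cis \<theta>). f z * g z / g z = f z"
        using tendsto_imp_eventually_ne[OF g l0] by eventually_elim simp
    qed
    then show ?case unfolding has_nontangential_limit_def by blast
  qed
qed

section \<open>Uniform integrability in the Smirnov class\<close>

lemma measurable_circ_AE_limit:
  fixes u :: "real \<Rightarrow> real"
  assumes "\<And>k. s k \<in> borel_measurable circ" and lim: "AE \<theta> in circ. (\<lambda>k. s k \<theta>) \<longlonglongrightarrow> u \<theta>"
  shows "u \<in> borel_measurable circ"
proof -
  have 1: "(\<lambda>\<theta>. lim (\<lambda>k. s k \<theta>)) \<in> borel_measurable circ" using assms(1) by measurable
  have "AE \<theta> in circ. lim (\<lambda>k. s k \<theta>) = u \<theta>" using lim by eventually_elim (rule limI)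
  then have "AE \<theta> in lebesgue. (if \<theta> \<in> {0..2*pi} then lim (\<lambda>k. s k \<theta>) else 0) = (if \<theta> \<in> {0..2*pi} then u \<theta> else 0)"
    by (subst (asm) AE_restrict_space_iff) auto
  moreover have "(\<lambda>\<theta>. if \<theta> \<in> {0..2*pi} then lim (\<lambda>k. s k \<theta>) else 0) \<in> borel_measurable lebesgue"
    using 1 by (rule borel_measurable_if_I) auto
  \<comment> \<open>Completeness of Lebesgue measure: boundary values are arbitrary on a null set,
    and changing a function there preserves measurability.\<close>
  ultimately have "(\<lambda>\<theta>. if \<theta> \<in> {0..2*pi} then u \<theta> else 0) \<in> borel_measurable lebesgue"
    by (rule borel_measurable_AE[rotated])
  then show ?thesis by (rule borel_measurable_if_D)
qed

lemma cmean_tendsto_bounded: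
  fixes s :: "nat \<Rightarrow> real \<Rightarrow> real"
  assumes s: "\<And>k. s k \<in> borel_measurable circ" and lim: "AE \<theta> in circ. (\<lambda>k. s k \<theta>) \<longlonglongrightarrow> u \<theta>"
    and bnd: "\<And>k. AE \<theta> in circ. \<bar>s k \<theta>\<bar> \<le> w \<theta>" and w: "integrable circ w"
  shows "(\<lambda>k. cmean (s k)) \<longlonglongrightarrow> cmean u"
proof -
  have "(\<lambda>k. \<integral>\<theta>. s k \<theta> \<partial>circ) \<longlonglongrightarrow> (\<integral>\<theta>. u \<theta> \<partial>circ)"
    by (rule integral_dominated_convergence[OF measurable_circ_AE_limit[OF s lim] s w lim]) (use bnd in auto)
  then show ?thesis unfolding cmean_def by (intro tendsto_divide) auto
qed

text \<open>Pointwise convergence together with convergence of the means prevents mass from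
  escaping. After truncation at a level \<open>n\<close> the means converge by dominated
  convergence, and the full means converge by definition of the class. So the mean of the excess
  over \<open>n\<close> tends to the mean excess of the boundary function, which is small for large
  \<open>n\<close>.\<close>

lemma smirnov_class_uniformly_integrable:
  assumes f: "f \<in> smirnov_class" and e: "e > 0"
  obtains M where "0 \<le> M"
    "\<forall>\<^sub>F R in at_left 1. cmean (\<lambda>\<theta>. max 0 (log_plus (cmod (f (of_real R * cis \<theta>))) - M)) \<le> e"
proof -
  have N: "f \<in> nevanlinna_class" using f unfolding smirnov_class_def by auto
  have fh: "f holomorphic_on ball 0 1" using N by (rule nevanlinna_class_holomorphic)
  define u where "u \<theta> = log_plus (cmod (boundary_value f (cis \<theta>)))" for \<theta>
  have L: "(circle_log_mean f \<longlongrightarrow> cmean u) (at_left 1)"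
    using f unfolding smirnov_class_def cmean_def u_def set_lebesgue_integral_def
    by (simp add: integral_restrict_space)
  let ?v = "\<lambda>R \<theta>. log_plus (cmod (f (of_real R * cis \<theta>)))"
  have vint: "integrable circ (?v R)" if "0 < R" "R < 1" for R
    using integrable_log_plus_circle[OF fh] that by simp
  have lim: "AE \<theta> in circ. (\<lambda>k. ?v (R k) \<theta>) \<longlonglongrightarrow> u \<theta>" if R: "filterlim R (at_left 1) sequentially" for R
    using nevanlinna_nontangential_limit_AE[OF N]
  proof eventually_elim
    case (elim \<theta>)
    then obtain l where l: "has_nontangential_limit f (cis \<theta>) l" by blast
    have "boundary_value f (cis \<theta>) = l" using boundary_value_eqI[OF l] by simp
    moreover have "(\<lambda>k. f (of_real (R k) * cis \<theta>)) \<longlonglongrightarrow> l"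
      using filterlim_compose[OF nontangential_limit_radial[OF l] R] by simp
    ultimately show ?case unfolding u_def by (auto intro!: tendsto_intros)
  qed
  have umeas[measurable]: "u \<in> borel_measurable circ"
    by (rule measurable_circ_AE_limit[OF _ lim[OF radial_sequence(3)]])
      (use vint[OF radial_sequence(1,2)] in auto)
  show ?thesis
  proof (cases "integrable circ u")
    case False
    \<comment> \<open>The integral of a non-integrable function is 0 by convention. Membership in
      the class would then say that the means tend to 0, and \<open>M = 0\<close> works.\<close>
    then have "cmean u = 0" unfolding cmean_def by (simp add: not_integrable_integral_eq)
    then have "\<forall>\<^sub>F R in at_left 1. circle_log_mean f R < e" using order_tendstoD(2)[OF L] e by simp
    then have "\<forall>\<^sub>F R in at_left 1. cmean (\<lambda>\<theta>. max 0 (?v R \<theta> - 0)) \<le> e"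
      by eventually_elim (simp add: circle_log_mean_eq_cmean max_absorb2)
    then show ?thesis using that[of 0] by simp
  next
    case True
    have "(\<lambda>n. cmean (\<lambda>\<theta>. min (u \<theta>) (real n))) \<longlonglongrightarrow> cmean u"
    proof (rule cmean_tendsto_bounded[where w = u])
      show "AE \<theta> in circ. (\<lambda>n. min (u \<theta>) (real n)) \<longlonglongrightarrow> u \<theta>"
      proof (rule AE_I2)
        fix \<theta>
        obtain n where "u \<theta> \<le> real n" using real_arch_simple by blast
        then have "\<forall>\<^sub>F k in sequentially. u \<theta> = min (u \<theta>) (real k)"
          by (intro eventually_sequentiallyI[of n]) (auto simp: min_def)
        then show "(\<lambda>n. min (u \<theta>) (real n)) \<longlonglongrightarrow> u \<theta>" by (rule Lim_transform_eventually[OF tendsto_const])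
      qed
    qed (use True in \<open>auto simp: u_def[abs_def]\<close>)
    then obtain n where n: "cmean u - e / 2 < cmean (\<lambda>\<theta>. min (u \<theta>) (real n))"
      using order_tendstoD(1)[of _ "cmean u" sequentially "cmean u - e / 2"] e eventually_happens by force
    have "((\<lambda>R. cmean (\<lambda>\<theta>. min (?v R \<theta>) (real n))) \<longlongrightarrow> cmean (\<lambda>\<theta>. min (u \<theta>) (real n))) (at_left 1)"
    proof (rule tendsto_at_left_sequentially[OF zero_less_one])
      fix R :: "nat \<Rightarrow> real" assume R: "\<And>k. R k < 1" "\<And>k. 0 < R k" "R \<longlonglongrightarrow> 1"
      then have R': "filterlim R (at_left 1) sequentially"
        by (auto simp: filterlim_at less_imp_neq intro!: always_eventually)
      show "(\<lambda>k. cmean (\<lambda>\<theta>. min (?v (R k) \<theta>) (real n))) \<longlonglongrightarrow> cmean (\<lambda>\<theta>. min (u \<theta>) (real n))"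
      proof (rule cmean_tendsto_bounded[where w = "\<lambda>_. real n"])
        show "(\<lambda>\<theta>. min (?v (R k) \<theta>) (real n)) \<in> borel_measurable circ" for k
          using borel_measurable_integrable[OF vint[OF R(2,1)]] by measurable
        show "AE \<theta> in circ. (\<lambda>k. min (?v (R k) \<theta>) (real n)) \<longlonglongrightarrow> min (u \<theta>) (real n)"
          using lim[OF R'] by eventually_elim (intro tendsto_intros)
      qed (auto intro: integrable_circ)
    qed
    from tendsto_diff[OF L this]
    have "\<forall>\<^sub>F R in at_left 1. circle_log_mean f R - cmean (\<lambda>\<theta>. min (?v R \<theta>) (real n)) < e"
      by (rule order_tendstoD) (use n e in simp)
    then have "\<forall>\<^sub>F R in at_left 1. cmean (\<lambda>\<theta>. max 0 (?v R \<theta> - real n)) \<le> e"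
      using eventually_at_left_real[OF zero_less_one]
    proof eventually_elim
      case (elim R)
      have "(\<lambda>\<theta>. max 0 (?v R \<theta> - real n)) = (\<lambda>\<theta>. ?v R \<theta> - min (?v R \<theta>) (real n))" by (auto simp: min_def max_def)
      then have "cmean (\<lambda>\<theta>. max 0 (?v R \<theta> - real n)) = circle_log_mean f R - cmean (\<lambda>\<theta>. min (?v R \<theta>) (real n))"
        using elim vint[of R] unfolding circle_log_mean_eq_cmean by (simp add: cmean_diff)
      then show ?case using elim by simp
    qed
    then show ?thesis using that[of "real n"] by simp
  qed
qed

section \<open>Blaschke products over points in Stolz angles\<close>

text \<open>The Cauchy criterion for unconditional sums: the sums over \<open>F0\<close> and over
  its union with \<open>F\<close> are both close to the total.\<close>

lemma summable_on_small_tail: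
  fixes M :: "'a \<Rightarrow> real"
  assumes "M summable_on X" "e > 0"
  shows "\<exists>F0. finite F0 \<and> F0 \<subseteq> X \<and> (\<forall>F. finite F \<longrightarrow> F \<subseteq> X \<longrightarrow> F \<inter> F0 = {} \<longrightarrow> sum M F < e)"
proof -
  have "(sum M \<longlongrightarrow> infsum M X) (finite_subsets_at_top X)"
    using assms(1) has_sum_infsum unfolding has_sum_def by blast
  then have "\<forall>\<^sub>F F in finite_subsets_at_top X. dist (sum M F) (infsum M X) < e / 2"
    using assms(2) by (intro tendstoD) auto
  then obtain F0 where F0: "finite F0" "F0 \<subseteq> X"
    "\<And>F. finite F \<Longrightarrow> F0 \<subseteq> F \<Longrightarrow> F \<subseteq> X \<Longrightarrow> dist (sum M F) (infsum M X) < e / 2"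
    unfolding eventually_finite_subsets_at_top by auto
  have "sum M F < e" if F: "finite F" "F \<subseteq> X" "F \<inter> F0 = {}" for F
  proof -
    have "sum M (F \<union> F0) = sum M F + sum M F0" using F F0 by (intro sum.union_disjoint) auto
    moreover have "dist (sum M (F \<union> F0)) (infsum M X) < e / 2" "dist (sum M F0) (infsum M X) < e / 2"
      using F F0 by auto
    ultimately show ?thesis by (auto simp: dist_real_def abs_if split: if_splits)
  qed
  then show ?thesis using F0(1,2) by (intro exI[of _ F0]) simp
qed

lemma norm_prod_minus_one_le:
  fixes f :: "'a \<Rightarrow> complex"
  assumes "\<And>x. x \<in> F \<Longrightarrow> cmod (f x) \<le> 1"
  shows "cmod ((\<Prod>x\<in>F. f x) - 1) \<le> (\<Sum>x\<in>F. cmod (f x - 1))"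
  using norm_prod_diff[of F f "\<lambda>_. 1"] assms by simp

lemma norm_prod_le_one:
  fixes f :: "'a \<Rightarrow> complex"
  assumes "\<And>x. x \<in> F \<Longrightarrow> cmod (f x) \<le> 1"
  shows "cmod (\<Prod>x\<in>F. f x) \<le> 1"
  unfolding prod_norm[symmetric] using assms by (intro prod_le_1) auto

text \<open>For factors of modulus at most 1, a finite product differs from 1 by at most the sum of
  the single deviations. Enlarging the index set beyond \<open>F0\<close> therefore changes the
  product by no more than a tail of \<open>M\<close>, uniformly in \<open>z\<close>; logarithms are
  avoided, so factors may vanish.\<close>

lemma uniform_limit_unconditional_product:
  fixes f :: "'a \<Rightarrow> 'b \<Rightarrow> complex" and M :: "'a \<Rightarrow> real"
  assumes bnd: "\<And>x z. x \<in> X \<Longrightarrow> z \<in> S \<Longrightarrow> cmod (f x z - 1) \<le> M x"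
    and le1: "\<And>x z. x \<in> X \<Longrightarrow> z \<in> S \<Longrightarrow> cmod (f x z) \<le> 1"
    and M: "M summable_on X"
  shows "uniform_limit S (\<lambda>F z. \<Prod>x\<in>F. f x z)
    (\<lambda>z. Lim (finite_subsets_at_top X) (\<lambda>F. \<Prod>x\<in>F. f x z)) (finite_subsets_at_top X)"
proof -
  let ?P = "\<lambda>F z. \<Prod>x\<in>F. f x z"
  let ?N = "finite_subsets_at_top X"
  define good where "good e F0 \<longleftrightarrow> finite F0 \<and> F0 \<subseteq> X \<and>
    (\<forall>F z. finite F \<longrightarrow> F0 \<subseteq> F \<longrightarrow> F \<subseteq> X \<longrightarrow> z \<in> S \<longrightarrow> cmod (?P F z - ?P F0 z) \<le> e)" for e F0
  have goodD: "finite F0" "F0 \<subseteq> X"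
    "\<And>F z. finite F \<Longrightarrow> F0 \<subseteq> F \<Longrightarrow> F \<subseteq> X \<Longrightarrow> z \<in> S \<Longrightarrow> cmod (?P F z - ?P F0 z) \<le> e"
    if "good e F0" for e F0
    using that unfolding good_def by simp_all
  have close: "\<exists>F0. good e F0" if e: "e > 0" for e
  proof -
    obtain F0 where F0: "finite F0" "F0 \<subseteq> X" "\<forall>F. finite F \<longrightarrow> F \<subseteq> X \<longrightarrow> F \<inter> F0 = {} \<longrightarrow> sum M F < e"
      using summable_on_small_tail[OF M e] by auto
    have "cmod (?P F z - ?P F0 z) \<le> e" if F: "finite F" "F0 \<subseteq> F" "F \<subseteq> X" "z \<in> S" for F z
    proof -
      have "?P F z = ?P F0 z * ?P (F - F0) z"
        using prod.subset_diff[OF F(2,1), of "\<lambda>x. f x z"] by (simp add: mult.commute)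
      then have "?P F z - ?P F0 z = ?P F0 z * (?P (F - F0) z - 1)" by (simp add: algebra_simps)
      then have "cmod (?P F z - ?P F0 z) = cmod (?P F0 z) * cmod (?P (F - F0) z - 1)" by (simp add: norm_mult)
      also have "\<dots> \<le> 1 * (\<Sum>x\<in>F - F0. cmod (f x z - 1))"
        using F F0 by (intro mult_mono norm_prod_le_one norm_prod_minus_one_le le1) auto
      also have "\<dots> \<le> 1 * (\<Sum>x\<in>F - F0. M x)" using F by (intro mult_left_mono sum_mono bnd) auto
      also have "\<dots> < e" using F0(3)[rule_format, of "F - F0"] F by auto
      finally show ?thesis by simp
    qed
    then have "good e F0" unfolding good_def using F0(1,2) by simp
    then show ?thesis ..
  qed
  have conv: "((\<lambda>F. ?P F z) \<longlongrightarrow> Lim ?N (\<lambda>F. ?P F z)) ?N" if z: "z \<in> S" for z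
  proof -
    \<comment> \<open>Convergence along the directed family comes from completeness; only then is
      \<open>Lim\<close> known to be an actual limit.\<close>
    have "cauchy_filter (filtermap (\<lambda>F. ?P F z) ?N)"
      unfolding cauchy_filter_metric_filtermap
    proof (intro allI impI)
      fix e :: real assume "e > 0"
      then have "e / 3 > 0" by simp
      from close[OF this] obtain F0 where "good (e / 3) F0" ..
      note F0 = goodD[OF this]
      let ?Q = "\<lambda>F. finite F \<and> F0 \<subseteq> F \<and> F \<subseteq> X"
      have "eventually ?Q ?N" unfolding eventually_finite_subsets_at_top using F0 by blast
      moreover have "dist (?P F z) (?P G z) < e" if "?Q F" "?Q G" for F G
      proof -
        have "cmod (?P F z - ?P G z) \<le> cmod (?P F z - ?P F0 z) + cmod (?P G z - ?P F0 z)"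
          using norm_triangle_ineq4[of "?P F z - ?P F0 z" "?P G z - ?P F0 z"] by simp
        also have "\<dots> \<le> e / 3 + e / 3" using that F0(3) z by (intro add_mono) auto
        also have "\<dots> < e" using \<open>e > 0\<close> by simp
        finally show ?thesis by (simp add: dist_norm)
      qed
      ultimately show "\<exists>Q. eventually Q ?N \<and> (\<forall>F G. Q F \<and> Q G \<longrightarrow> dist (?P F z) (?P G z) < e)"
        by (intro exI[of _ ?Q]) simp
    qed
    then have "\<exists>c. filtermap (\<lambda>F. ?P F z) ?N \<le> nhds c"
      by (rule cauchy_filter_complete_converges[OF _ complete_UNIV]) (auto simp: filtermap_bot_iff)
    then obtain c where "filtermap (\<lambda>F. ?P F z) ?N \<le> nhds c" ..
    then have "((\<lambda>F. ?P F z) \<longlongrightarrow> c) ?N" by (simp add: filterlim_def)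
    moreover from this have "Lim ?N (\<lambda>F. ?P F z) = c" by (intro tendsto_Lim) auto
    ultimately show ?thesis by simp
  qed
  show ?thesis
  proof (rule uniform_limitI)
    fix e :: real assume "e > 0"
    then have "e / 3 > 0" by simp
    from close[OF this] obtain F0 where "good (e / 3) F0" ..
    note F0 = goodD[OF this]
    let ?Q = "\<lambda>F. finite F \<and> F0 \<subseteq> F \<and> F \<subseteq> X"
    have Q: "eventually ?Q ?N" unfolding eventually_finite_subsets_at_top using F0 by blast
    have lim: "cmod (Lim ?N (\<lambda>F. ?P F z) - ?P F0 z) \<le> e / 3" if z: "z \<in> S" for z
    proof (rule tendsto_upperbound)
      show "((\<lambda>F. cmod (?P F z - ?P F0 z)) \<longlongrightarrow> cmod (Lim ?N (\<lambda>F. ?P F z) - ?P F0 z)) ?N"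
        by (intro tendsto_intros conv z)
      show "\<forall>\<^sub>F F in ?N. cmod (?P F z - ?P F0 z) \<le> e / 3"
        using Q by eventually_elim (use F0 z in auto)
    qed auto
    show "\<forall>\<^sub>F F in ?N. \<forall>z\<in>S. dist (?P F z) (Lim ?N (\<lambda>F. ?P F z)) < e"
      using Q
    proof eventually_elim
      case (elim F)
      show ?case
      proof
        fix z assume z: "z \<in> S"
        have "cmod (?P F z - Lim ?N (\<lambda>F. ?P F z)) \<le> cmod (?P F z - ?P F0 z) + cmod (Lim ?N (\<lambda>F. ?P F z) - ?P F0 z)"
          using norm_triangle_ineq4[of "?P F z - ?P F0 z" "Lim ?N (\<lambda>F. ?P F z) - ?P F0 z"] by simp
        also have "\<dots> \<le> e / 3 + e / 3" using elim z F0(3) lim by (intro add_mono) auto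
        also have "\<dots> < e" using \<open>e > 0\<close> by simp
        finally show "dist (?P F z) (Lim ?N (\<lambda>F. ?P F z)) < e" by (simp add: dist_norm)
      qed
    qed
  qed
qed

text \<open>Beyond a finite set the deviations from 1 sum to less than \<open>1 / 2\<close>, so the
  remaining factors multiply to modulus at least \<open>1 / 2\<close>. The limit is at least half
  the modulus of a finite product of nonzero factors.\<close>

lemma unconditional_product_nonzero:
  fixes f :: "'a \<Rightarrow> complex" and M :: "'a \<Rightarrow> real"
  assumes bnd: "\<And>x. x \<in> X \<Longrightarrow> cmod (f x - 1) \<le> M x"
    and le1: "\<And>x. x \<in> X \<Longrightarrow> cmod (f x) \<le> 1"
    and M: "M summable_on X" and nz: "\<And>x. x \<in> X \<Longrightarrow> f x \<noteq> 0"
    and lim: "((\<lambda>F. \<Prod>x\<in>F. f x) \<longlongrightarrow> l) (finite_subsets_at_top X)"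
  shows "l \<noteq> 0"
proof -
  obtain F0 where F0: "finite F0" "F0 \<subseteq> X" "\<forall>F. finite F \<longrightarrow> F \<subseteq> X \<longrightarrow> F \<inter> F0 = {} \<longrightarrow> sum M F < 1 / 2"
    using summable_on_small_tail[OF M half_gt_zero[OF zero_less_one]] by auto
  let ?P = "\<lambda>F. \<Prod>x\<in>F. f x"
  have "cmod (?P F0) / 2 \<le> cmod l"
  proof (rule tendsto_lowerbound[OF tendsto_norm[OF lim]])
    have "eventually (\<lambda>F. finite F \<and> F0 \<subseteq> F \<and> F \<subseteq> X) (finite_subsets_at_top X)"
      unfolding eventually_finite_subsets_at_top using F0 by blast
    then show "\<forall>\<^sub>F F in finite_subsets_at_top X. cmod (?P F0) / 2 \<le> cmod (?P F)"
    proof eventually_elim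
      case (elim F)
      have "cmod (?P (F - F0) - 1) \<le> (\<Sum>x\<in>F - F0. cmod (f x - 1))"
        using elim by (intro norm_prod_minus_one_le le1) auto
      also have "\<dots> \<le> sum M (F - F0)" using elim by (intro sum_mono bnd) auto
      also have "\<dots> < 1 / 2" using F0(3)[rule_format, of "F - F0"] elim by auto
      finally have "1 / 2 \<le> cmod (?P (F - F0))"
        using norm_triangle_ineq2[of 1 "?P (F - F0)"] by (simp add: norm_minus_commute)
      then have "cmod (?P F0) * (1 / 2) \<le> cmod (?P F0) * cmod (?P (F - F0))" by (intro mult_left_mono) auto
      also have "\<dots> = cmod (?P F)"
        using prod.subset_diff[of F0 F f] elim by (simp add: norm_mult mult.commute)
      finally show ?case by simp
    qed
  qed auto
  moreover have "?P F0 \<noteq> 0" using F0 nz by (auto simp: prod_zero_iff)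
  ultimately show ?thesis by auto
qed

lemma holomorphic_on_ball_uniform_limit:
  assumes hol: "\<forall>\<^sub>F n in F. f n holomorphic_on ball 0 1"
    and lim: "\<And>r. r < 1 \<Longrightarrow> uniform_limit (cball 0 r) f g F" and F: "F \<noteq> bot"
  shows "g holomorphic_on ball 0 1"
proof -
  have *: "g holomorphic_on ball 0 r" if r: "r < 1" for r
  proof (rule holomorphic_uniform_limit[OF _ lim[OF r] F])
    show "\<forall>\<^sub>F n in F. continuous_on (cball 0 r) (f n) \<and> f n holomorphic_on ball 0 r"
      using hol by eventually_elim (use r in \<open>auto intro!: holomorphic_on_imp_continuous_on elim!: holomorphic_on_subset\<close>)
  qed
  show ?thesis
  proof (rule holomorphic_onI)
    fix z :: complex assume "z \<in> ball 0 1"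
    then obtain r where r: "cmod z < r" "r < 1" using dense by auto
    have "g field_differentiable (at z)"
      using *[OF r(2)] r(1) by (intro holomorphic_on_imp_differentiable_at[of _ "ball 0 r"]) auto
    then show "g field_differentiable (at z within ball 0 1)" by (rule field_differentiable_at_within)
  qed
qed

text \<open>The normalising factor \<open>of_real (cmod \<mu>) / \<mu>\<close> is what makes
  \<open>1 - cmod \<mu>\<close> split off from the numerator exactly. The other numerator factor has
  modulus at most \<open>2 * cmod \<mu>\<close>, which cancels the \<open>\<mu>\<close> of the
  denominator.\<close>

lemma norm_blaschke_factor_minus_one:
  assumes "cmod \<mu> < 1" "cmod z \<le> 1"
  shows "cmod (blaschke_factor \<mu> z - 1) \<le> 2 * (1 - cmod \<mu>) / cmod (1 - cnj \<mu> * z)"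
proof (cases "\<mu> = 0")
  case True
  then show ?thesis using norm_triangle_ineq4[of z 1] assms by (simp add: blaschke_factor_def)
next
  case False
  let ?d = "1 - cnj \<mu> * z"
  have d: "?d \<noteq> 0" by (rule blaschke_factor_denom_nonzero[OF assms])
  have c: "\<mu> * cnj \<mu> = of_real (cmod \<mu>) * of_real (cmod \<mu>)"
    by (simp flip: complex_norm_square add: power2_eq_square)
  have "blaschke_factor \<mu> z - 1 = (of_real (cmod \<mu>) * (\<mu> - z) - \<mu> * ?d) / (\<mu> * ?d)"
    using False d unfolding blaschke_factor_def by (simp add: divide_simps)
  also have "of_real (cmod \<mu>) * (\<mu> - z) - \<mu> * ?d = - (of_real (1 - cmod \<mu>) * (\<mu> + of_real (cmod \<mu>) * z))"
  proof -
    have eq: "\<mu> * ?d = \<mu> - of_real (cmod \<mu>) * of_real (cmod \<mu>) * z"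
      unfolding c[symmetric] right_diff_distrib by (simp only: mult_1_right mult.assoc)
    show ?thesis unfolding eq by (simp add: algebra_simps)
  qed
  finally have "cmod (blaschke_factor \<mu> z - 1) = (1 - cmod \<mu>) * cmod (\<mu> + of_real (cmod \<mu>) * z) / (cmod \<mu> * cmod ?d)"
    using assms by (simp add: norm_divide norm_mult del: of_real_diff)
  also have "\<dots> \<le> (1 - cmod \<mu>) * (2 * cmod \<mu>) / (cmod \<mu> * cmod ?d)"
  proof (intro divide_right_mono mult_left_mono)
    have "cmod (\<mu> + of_real (cmod \<mu>) * z) \<le> cmod \<mu> + cmod \<mu> * cmod z"
      using norm_triangle_ineq[of \<mu> "of_real (cmod \<mu>) * z"] by (simp add: norm_mult)
    also have "\<dots> \<le> cmod \<mu> + cmod \<mu> * 1" using assms by (intro add_left_mono mult_left_mono) auto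
    finally show "cmod (\<mu> + of_real (cmod \<mu>) * z) \<le> 2 * cmod \<mu>" by simp
  qed (use assms in auto)
  also have "\<dots> = 2 * (1 - cmod \<mu>) / cmod ?d" using False by simp
  finally show ?thesis .
qed

lemma blaschke_denom_ge:
  assumes "cmod \<mu> < 1" "cmod z \<le> 1" shows "1 - cmod \<mu> \<le> cmod (1 - cnj \<mu> * z)"
proof -
  have "cmod (cnj \<mu> * z) \<le> cmod \<mu> * 1" unfolding norm_mult complex_mod_cnj using assms by (intro mult_left_mono) auto
  then show ?thesis using norm_triangle_ineq2[of 1 "cnj \<mu> * z"] by simp
qed

definition blaschke_product :: "complex set \<Rightarrow> complex \<Rightarrow> complex" where
  "blaschke_product X z = Lim (finite_subsets_at_top X) (\<lambda>F. \<Prod>\<nu>\<in>F. blaschke_factor \<nu> z)"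

lemma blaschke_product_omit_eq: "blaschke_product_omit \<Lambda> \<mu> z = blaschke_product (\<Lambda> - {\<mu>}) z"
  unfolding blaschke_product_omit_def blaschke_product_def ..

text \<open>The hypotheses on Lambda in working form: \<open>E\<close> contains the vertices of all
  angles, one constant \<open>A\<close> serves for every aperture, and distances are compared with
  \<open>1 - cmod \<mu>\<close> rather than with the difference of squares.\<close>

locale stolz_blaschke =
  fixes \<Lambda> E :: "complex set" and A :: real
  assumes disc: "\<And>\<mu>. \<mu> \<in> \<Lambda> \<Longrightarrow> cmod \<mu> < 1"
    and summable: "(\<lambda>\<mu>. 1 - cmod \<mu>) summable_on \<Lambda>"
    and finE: "finite E" and circleE: "\<And>\<zeta>. \<zeta> \<in> E \<Longrightarrow> cmod \<zeta> = 1" and A: "0 \<le> A"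
    and stolz: "\<And>\<mu>. \<mu> \<in> \<Lambda> \<Longrightarrow> \<exists>\<zeta>\<in>E. cmod (\<mu> - \<zeta>) \<le> A * (1 - cmod \<mu>)"
begin

text \<open>Boundary arcs are included, so uniform convergence on these sets gives continuity up to
  the circle except at the vertices.\<close>

definition away :: "real \<Rightarrow> complex set" where
  "away d = {z. cmod z \<le> 1 \<and> (\<forall>\<zeta>\<in>E. d \<le> cmod (z - \<zeta>))}"

lemma away_neighbourhood:
  assumes "z \<notin> E"
  obtains d where "d > 0" "\<And>w. cmod w \<le> 1 \<Longrightarrow> w \<in> ball z d \<Longrightarrow> w \<in> away d"
proof -
  obtain d where d: "d > 0" "\<And>\<zeta>. \<zeta> \<in> E \<Longrightarrow> d \<le> dist z \<zeta>"
    using finite_set_avoid[OF finE, of z] assms by metis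
  have "d / 2 \<le> cmod (w - \<zeta>)" if "\<zeta> \<in> E" "w \<in> ball z (d / 2)" for w \<zeta>
    using d(2)[OF that(1)] that(2) norm_triangle_ineq[of "z - w" "w - \<zeta>"] by (simp add: dist_norm)
  then show ?thesis using that[of "d / 2"] d(1) unfolding away_def by auto
qed

lemma cball_subset_away: "cball 0 r \<subseteq> away (1 - r)" if "r < 1"
proof
  fix z :: complex assume z: "z \<in> cball 0 r"
  have "1 - r \<le> cmod (z - \<zeta>)" if "\<zeta> \<in> E" for \<zeta>
    using norm_triangle_ineq2[of \<zeta> z] circleE[OF that] z by (simp add: norm_minus_commute)
  then show "z \<in> away (1 - r)" unfolding away_def using z that by auto
qed

text \<open>The distance \<open>d\<close> to the vertex belonging to \<open>\<mu>\<close> is at most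
  the distance from \<open>z\<close> to \<open>\<mu>\<close> plus that from \<open>\<mu>\<close> to
  the vertex. The first is bounded by the denominator of the Blaschke factor, the second by
  \<open>A\<close> times it, so the denominator is at least \<open>d / (1 + A)\<close>, even for
  \<open>z\<close> on the circle.\<close>

lemma blaschke_factor_minus_one_away:
  assumes d: "d > 0" and \<mu>: "\<mu> \<in> \<Lambda>" and z: "z \<in> away d"
  shows "cmod (blaschke_factor \<mu> z - 1) \<le> 2 * (1 + A) / d * (1 - cmod \<mu>)"
proof -
  obtain \<zeta> where \<zeta>: "\<zeta> \<in> E" "cmod (\<mu> - \<zeta>) \<le> A * (1 - cmod \<mu>)" using stolz[OF \<mu>] by blast
  let ?D = "cmod (1 - cnj \<mu> * z)"
  have z1: "cmod z \<le> 1" using z unfolding away_def by simp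
  have \<mu>1: "cmod \<mu> < 1" by (rule disc[OF \<mu>])
  have D: "1 - cmod \<mu> \<le> ?D" by (rule blaschke_denom_ge[OF \<mu>1 z1])
  have "d \<le> cmod (z - \<zeta>)" using z \<zeta> unfolding away_def by auto
  also have "\<dots> \<le> cmod (\<mu> - z) + cmod (\<mu> - \<zeta>)"
    using norm_triangle_ineq4[of "\<mu> - \<zeta>" "\<mu> - z"] by simp
  also have "\<dots> \<le> ?D + A * ?D"
  proof (intro add_mono)
    show "cmod (\<mu> - \<zeta>) \<le> A * ?D" using \<zeta>(2) mult_left_mono[OF D A] by simp
  qed (use norm_diff_le_blaschke_denom \<mu>1 z1 in auto)
  finally have "d \<le> (1 + A) * ?D" by (simp add: algebra_simps)
  then have "2 * (1 - cmod \<mu>) / ?D \<le> 2 * (1 - cmod \<mu>) / (d / (1 + A))"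
    using d A \<mu>1 D by (intro divide_left_mono mult_nonneg_nonneg mult_pos_pos) (auto simp: field_simps)
  also have "\<dots> = 2 * (1 + A) / d * (1 - cmod \<mu>)" by (simp add: algebra_simps)
  finally show ?thesis using norm_blaschke_factor_minus_one[OF \<mu>1 z1] by simp
qed

lemma summable_scaled: "X \<subseteq> \<Lambda> \<Longrightarrow> (\<lambda>\<mu>. c * (1 - cmod \<mu>)) summable_on X"
  using summable_on_cmult_right summable_on_subset_banach[OF summable] by blast

lemma uniform_limit_blaschke_product:
  assumes X: "X \<subseteq> \<Lambda>" and d: "d > 0"
  shows "uniform_limit (away d) (\<lambda>F z. \<Prod>\<nu>\<in>F. blaschke_factor \<nu> z) (blaschke_product X) (finite_subsets_at_top X)"
  unfolding blaschke_product_def[abs_def]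
proof (rule uniform_limit_unconditional_product)
  show "(\<lambda>\<mu>. 2 * (1 + A) / d * (1 - cmod \<mu>)) summable_on X" by (rule summable_scaled[OF X])
  show "cmod (blaschke_factor \<mu> z - 1) \<le> 2 * (1 + A) / d * (1 - cmod \<mu>)" if "\<mu> \<in> X" "z \<in> away d" for \<mu> z
    using that X d by (intro blaschke_factor_minus_one_away) auto
  show "cmod (blaschke_factor \<mu> z) \<le> 1" if "\<mu> \<in> X" "z \<in> away d" for \<mu> z
    using that X disc by (intro norm_blaschke_factor_le_1) (auto simp: away_def)
qed

lemma tendsto_blaschke_product:
  assumes X: "X \<subseteq> \<Lambda>" and z: "cmod z \<le> 1" "z \<notin> E"
  shows "((\<lambda>F. \<Prod>\<nu>\<in>F. blaschke_factor \<nu> z) \<longlongrightarrow> blaschke_product X z) (finite_subsets_at_top X)"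
proof -
  obtain d where d: "d > 0" "\<And>w. cmod w \<le> 1 \<Longrightarrow> w \<in> ball z d \<Longrightarrow> w \<in> away d"
    using away_neighbourhood[OF z(2)] by blast
  then show ?thesis using tendsto_uniform_limitI[OF uniform_limit_blaschke_product[OF X d(1)]] z by simp
qed

lemma ball_notin_E: "cmod z < 1 \<Longrightarrow> z \<notin> E"
  using circleE by auto

lemma continuous_on_away_limit:
  assumes "\<And>d. d > 0 \<Longrightarrow> continuous_on (away d) f"
  shows "continuous_on (cball 0 1 - E) f"
  unfolding continuous_on_eq_continuous_within
proof
  fix z assume z: "z \<in> cball 0 1 - E"
  then obtain d where d: "d > 0" "\<And>w. cmod w \<le> 1 \<Longrightarrow> w \<in> ball z d \<Longrightarrow> w \<in> away d"
    using away_neighbourhood[of z] by auto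
  have "continuous_on ((cball 0 1 - E) \<inter> ball z d) f"
    by (rule continuous_on_subset[OF assms[OF d(1)]]) (use d(2) in auto)
  then have "continuous (at z within (cball 0 1 - E) \<inter> ball z d) f"
    using z d(1) unfolding continuous_on_eq_continuous_within by auto
  moreover have "at z within (cball 0 1 - E) \<inter> ball z d = at z within (cball 0 1 - E)"
    by (rule at_within_nhd[of z "ball z d"]) (use d(1) in auto)
  ultimately show "continuous (at z within cball 0 1 - E) f" by simp
qed

lemma continuous_on_blaschke_product:
  assumes X: "X \<subseteq> \<Lambda>" shows "continuous_on (cball 0 1 - E) (blaschke_product X)"
proof (rule continuous_on_away_limit)
  fix d :: real assume d: "d > 0"
  show "continuous_on (away d) (blaschke_product X)"
  proof (rule uniform_limit_theorem[OF _ uniform_limit_blaschke_product[OF X d]])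
    show "\<forall>\<^sub>F F in finite_subsets_at_top X. continuous_on (away d) (\<lambda>z. \<Prod>\<nu>\<in>F. blaschke_factor \<nu> z)"
    proof (rule eventually_finite_subsets_at_top_weakI)
      fix F assume F: "finite F" "F \<subseteq> X"
      have "(\<lambda>z. \<Prod>\<nu>\<in>F. blaschke_factor \<nu> z) holomorphic_on cball 0 1"
        using F X disc by (intro holomorphic_intros holomorphic_on_blaschke_factor) auto
      then show "continuous_on (away d) (\<lambda>z. \<Prod>\<nu>\<in>F. blaschke_factor \<nu> z)"
        by (rule continuous_on_subset[OF holomorphic_on_imp_continuous_on]) (auto simp: away_def)
    qed
  qed auto
qed

lemma holomorphic_on_blaschke_product:
  assumes X: "X \<subseteq> \<Lambda>" shows "blaschke_product X holomorphic_on ball 0 1"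
proof (rule holomorphic_on_ball_uniform_limit)
  show "\<forall>\<^sub>F F in finite_subsets_at_top X. (\<lambda>z. \<Prod>\<nu>\<in>F. blaschke_factor \<nu> z) holomorphic_on ball 0 1"
  proof (rule eventually_finite_subsets_at_top_weakI)
    fix F assume F: "finite F" "F \<subseteq> X"
    have "(\<lambda>z. \<Prod>\<nu>\<in>F. blaschke_factor \<nu> z) holomorphic_on cball 0 1"
      using F X disc by (intro holomorphic_intros holomorphic_on_blaschke_factor) auto
    then show "(\<lambda>z. \<Prod>\<nu>\<in>F. blaschke_factor \<nu> z) holomorphic_on ball 0 1" by (rule holomorphic_on_subset) auto
  qed
  show "uniform_limit (cball 0 r) (\<lambda>F z. \<Prod>\<nu>\<in>F. blaschke_factor \<nu> z) (blaschke_product X) (finite_subsets_at_top X)"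
    if "r < 1" for r
    by (rule uniform_limit_on_subset[OF uniform_limit_blaschke_product[OF X, of "1 - r"] cball_subset_away[OF that]]) (use that in simp)
qed auto

lemma norm_blaschke_product_le_1:
  assumes X: "X \<subseteq> \<Lambda>" and z: "cmod z \<le> 1" "z \<notin> E"
  shows "cmod (blaschke_product X z) \<le> 1"
  by (rule tendsto_upperbound[OF tendsto_norm[OF tendsto_blaschke_product[OF assms]]])
     (use X disc z in \<open>auto intro!: eventually_finite_subsets_at_top_weakI norm_prod_le_one norm_blaschke_factor_le_1\<close>)

lemma blaschke_product_zero:
  assumes X: "X \<subseteq> \<Lambda>" and \<mu>: "\<mu> \<in> X"
  shows "blaschke_product X \<mu> = 0"
proof (rule tendsto_unique[OF _ tendsto_blaschke_product[OF X]])
  have m: "cmod \<mu> < 1" using X \<mu> disc by auto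
  then show "cmod \<mu> \<le> 1" "\<mu> \<notin> E" using ball_notin_E by auto
  have "\<forall>\<^sub>F F in finite_subsets_at_top X. finite F \<and> {\<mu>} \<subseteq> F \<and> F \<subseteq> X"
    unfolding eventually_finite_subsets_at_top using \<mu> by (intro exI[of _ "{\<mu>}"]) auto
  then have "\<forall>\<^sub>F F in finite_subsets_at_top X. 0 = (\<Prod>\<nu>\<in>F. blaschke_factor \<nu> \<mu>)"
  proof eventually_elim
    case (elim F)
    then show ?case using blaschke_factor_eq_0_iff[OF m, of \<mu>] m by (subst eq_commute) (auto intro!: prod_zero)
  qed
  then show "((\<lambda>F. \<Prod>\<nu>\<in>F. blaschke_factor \<nu> \<mu>) \<longlongrightarrow> 0) (finite_subsets_at_top X)"
    by (rule Lim_transform_eventually[OF tendsto_const])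
qed auto

lemma blaschke_product_nonzero:
  assumes X: "X \<subseteq> \<Lambda>" and z: "cmod z < 1" "z \<notin> X"
  shows "blaschke_product X z \<noteq> 0"
proof (rule unconditional_product_nonzero[OF _ _ _ _ tendsto_blaschke_product[OF X]])
  have za: "z \<in> away (1 - cmod z)" using cball_subset_away[OF z(1)] by auto
  show "(\<lambda>\<mu>. 2 * (1 + A) / (1 - cmod z) * (1 - cmod \<mu>)) summable_on X" by (rule summable_scaled[OF X])
  show "cmod (blaschke_factor \<mu> z - 1) \<le> 2 * (1 + A) / (1 - cmod z) * (1 - cmod \<mu>)" if "\<mu> \<in> X" for \<mu>
    using that X z za by (intro blaschke_factor_minus_one_away) auto
  show "cmod (blaschke_factor \<mu> z) \<le> 1" if "\<mu> \<in> X" for \<mu>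
    using that X disc z by (intro norm_blaschke_factor_le_1) auto
  show "blaschke_factor \<mu> z \<noteq> 0" if "\<mu> \<in> X" for \<mu>
    using that X disc z by (subst blaschke_factor_eq_0_iff) auto
qed (use z ball_notin_E in auto)

text \<open>The product that omits \<open>\<mu>\<close> vanishes at all other points of
  \<open>\<Lambda>\<close>, so at each point a single term of the series survives. Since the
  products have modulus at most 1, absolute summability of the coefficients gives uniform
  convergence off the vertices.\<close>

lemma bounded_interpolation:
  fixes c :: "complex \<Rightarrow> complex"
  assumes c: "(\<lambda>\<mu>. cmod (c \<mu>)) summable_on \<Lambda>"
  obtains G where "G holomorphic_on ball 0 1" "continuous_on (cball 0 1 - E) G"
    "\<And>z. cmod z \<le> 1 \<Longrightarrow> z \<notin> E \<Longrightarrow> cmod (G z) \<le> (\<Sum>\<^sub>\<infinity>\<mu>\<in>\<Lambda>. cmod (c \<mu>))"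
    "\<And>\<mu>. \<mu> \<in> \<Lambda> \<Longrightarrow> G \<mu> = c \<mu> * blaschke_product (\<Lambda> - {\<mu>}) \<mu>"
proof -
  let ?B = "\<lambda>\<mu>. blaschke_product (\<Lambda> - {\<mu>})"
  define G where "G z = (\<Sum>\<^sub>\<infinity>\<mu>\<in>\<Lambda>. c \<mu> * ?B \<mu> z)" for z
  have bnd: "cmod (c \<mu> * ?B \<mu> z) \<le> cmod (c \<mu>)" if "z \<in> cball 0 1 - E" for z \<mu>
  proof -
    have "cmod (c \<mu>) * cmod (?B \<mu> z) \<le> cmod (c \<mu>) * 1"
      using that by (intro mult_left_mono norm_blaschke_product_le_1) auto
    then show ?thesis by (simp add: norm_mult)
  qed
  have ul: "uniform_limit (cball 0 1 - E) (\<lambda>F z. \<Sum>\<mu>\<in>F. c \<mu> * ?B \<mu> z) G (finite_subsets_at_top \<Lambda>)"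
    unfolding G_def[abs_def] by (rule Weierstrass_m_test_general[OF bnd c])
  have "continuous_on (cball 0 1 - E) G"
    by (rule uniform_limit_theorem[OF _ ul])
       (auto intro!: always_eventually continuous_intros continuous_on_blaschke_product)
  moreover have "G holomorphic_on ball 0 1"
  proof (rule holomorphic_on_ball_uniform_limit)
    show "\<forall>\<^sub>F F in finite_subsets_at_top \<Lambda>. (\<lambda>z. \<Sum>\<mu>\<in>F. c \<mu> * ?B \<mu> z) holomorphic_on ball 0 1"
      by (intro always_eventually allI holomorphic_intros holomorphic_on_blaschke_product) auto
    show "uniform_limit (cball 0 r) (\<lambda>F z. \<Sum>\<mu>\<in>F. c \<mu> * ?B \<mu> z) G (finite_subsets_at_top \<Lambda>)" if "r < 1" for r
      by (rule uniform_limit_on_subset[OF ul]) (use that circleE in force)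
  qed auto
  moreover have "cmod (G z) \<le> (\<Sum>\<^sub>\<infinity>\<mu>\<in>\<Lambda>. cmod (c \<mu>))" if "cmod z \<le> 1" "z \<notin> E" for z
  proof -
    have abs: "(\<lambda>\<mu>. cmod (c \<mu> * ?B \<mu> z)) summable_on \<Lambda>"
      by (rule summable_on_comparison_test[OF c]) (use bnd that in auto)
    have "cmod (G z) \<le> (\<Sum>\<^sub>\<infinity>\<mu>\<in>\<Lambda>. cmod (c \<mu> * ?B \<mu> z))" unfolding G_def by (rule norm_infsum_bound[OF abs])
    also have "\<dots> \<le> (\<Sum>\<^sub>\<infinity>\<mu>\<in>\<Lambda>. cmod (c \<mu>))" by (rule infsum_mono[OF abs c]) (use bnd that in auto)
    finally show ?thesis .
  qed
  moreover have "G \<mu> = c \<mu> * ?B \<mu> \<mu>" if \<mu>: "\<mu> \<in> \<Lambda>" for \<mu>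
  proof -
    have "G \<mu> = (\<Sum>\<^sub>\<infinity>\<nu>\<in>{\<mu>}. c \<nu> * ?B \<nu> \<mu>)" unfolding G_def
    proof (rule infsum_cong_neutral)
      fix \<nu> assume "\<nu> \<in> \<Lambda> - {\<mu>}"
      then show "c \<nu> * ?B \<nu> \<mu> = 0" using \<mu> blaschke_product_zero[of "\<Lambda> - {\<nu>}" \<mu>] by auto
    qed (use \<mu> in auto)
    then show ?thesis by simp
  qed
  ultimately show ?thesis using that by blast
qed

end

section \<open>Positive harmonic majorants\<close>

text \<open>Dominated convergence with a moving dominating function, known as Pratt's lemma. The
  positive part of \<open>w' - w k\<close> is dominated by \<open>w'\<close>; with convergence of
  the means this yields that the mean of the positive part of \<open>w k - w'\<close> tends to 0.
  That quantity bounds what is lost when \<open>u k\<close> is cut off at \<open>w'\<close>, and the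
  cut-off functions are dominated by \<open>w'\<close>.\<close>

lemma cmean_tendsto_dominated_varying:
  fixes u w :: "nat \<Rightarrow> real \<Rightarrow> real"
  assumes u: "\<And>k. integrable circ (u k)" and w: "\<And>k. integrable circ (w k)" and w': "integrable circ w'"
    and ulim: "AE \<theta> in circ. (\<lambda>k. u k \<theta>) \<longlonglongrightarrow> u' \<theta>"
    and wlim: "AE \<theta> in circ. (\<lambda>k. w k \<theta>) \<longlonglongrightarrow> w' \<theta>"
    and bnd: "\<And>k. AE \<theta> in circ. 0 \<le> u k \<theta> \<and> u k \<theta> \<le> w k \<theta>"
    and means: "(\<lambda>k. cmean (w k)) \<longlonglongrightarrow> cmean w'"
  shows "(\<lambda>k. cmean (u k)) \<longlonglongrightarrow> cmean u'"
proof -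
  have all: "AE \<theta> in circ. \<forall>k. 0 \<le> u k \<theta> \<and> u k \<theta> \<le> w k \<theta>" using bnd by (simp add: AE_all_countable)
  have nn: "AE \<theta> in circ. 0 \<le> w' \<theta> \<and> u' \<theta> \<le> w' \<theta>"
    using all ulim wlim
  proof eventually_elim
    case (elim \<theta>)
    then have "0 \<le> w' \<theta>" by (intro LIMSEQ_le_const[of "\<lambda>k. w k \<theta>"]) (auto intro: order_trans)
    moreover have "u' \<theta> \<le> w' \<theta>" using elim by (intro LIMSEQ_le) auto
    ultimately show ?case by simp
  qed
  have "(\<lambda>k. cmean (\<lambda>\<theta>. max 0 (w' \<theta> - w k \<theta>))) \<longlonglongrightarrow> cmean (\<lambda>_. 0)"
  proof (rule cmean_tendsto_bounded[OF _ _ _ w'])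
    show "AE \<theta> in circ. (\<lambda>k. max 0 (w' \<theta> - w k \<theta>)) \<longlonglongrightarrow> 0"
      using wlim
    proof eventually_elim
      case (elim \<theta>)
      have "(\<lambda>k. max 0 (w' \<theta> - w k \<theta>)) \<longlonglongrightarrow> max 0 (w' \<theta> - w' \<theta>)" by (intro tendsto_intros elim)
      then show ?case by simp
    qed
    show "AE \<theta> in circ. \<bar>max 0 (w' \<theta> - w k \<theta>)\<bar> \<le> w' \<theta>" for k
      using all nn
    proof eventually_elim
      case (elim \<theta>)
      then have "0 \<le> w k \<theta>" using order_trans by blast
      then show ?case using elim by auto
    qed
  qed (use w w' in measurable)
  from tendsto_add[OF tendsto_diff[OF means tendsto_const[of "cmean w'"]] this]
  have "(\<lambda>k. cmean (w k) - cmean w' + cmean (\<lambda>\<theta>. max 0 (w' \<theta> - w k \<theta>))) \<longlonglongrightarrow> 0" by simp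
  moreover have "cmean (w k) - cmean w' + cmean (\<lambda>\<theta>. max 0 (w' \<theta> - w k \<theta>)) = cmean (\<lambda>\<theta>. max 0 (w k \<theta> - w' \<theta>))" for k
  proof -
    have "cmean (w k) - cmean w' + cmean (\<lambda>\<theta>. max 0 (w' \<theta> - w k \<theta>)) = cmean (\<lambda>\<theta>. (w k \<theta> - w' \<theta>) + max 0 (w' \<theta> - w k \<theta>))"
      using w w' by (subst cmean_add) (auto simp: cmean_diff)
    also have "(\<lambda>\<theta>. (w k \<theta> - w' \<theta>) + max 0 (w' \<theta> - w k \<theta>)) = (\<lambda>\<theta>. max 0 (w k \<theta> - w' \<theta>))" by (auto simp: max_def)
    finally show ?thesis .
  qed
  ultimately have 1: "(\<lambda>k. cmean (\<lambda>\<theta>. max 0 (w k \<theta> - w' \<theta>))) \<longlonglongrightarrow> 0" by simp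
  have 2: "(\<lambda>k. cmean (\<lambda>\<theta>. min (u k \<theta>) (w' \<theta>))) \<longlonglongrightarrow> cmean u'"
  proof (rule cmean_tendsto_bounded[OF _ _ _ w'])
    show "AE \<theta> in circ. (\<lambda>k. min (u k \<theta>) (w' \<theta>)) \<longlonglongrightarrow> u' \<theta>"
      using ulim nn
    proof eventually_elim
      case (elim \<theta>)
      have "(\<lambda>k. min (u k \<theta>) (w' \<theta>)) \<longlonglongrightarrow> min (u' \<theta>) (w' \<theta>)" by (intro tendsto_intros elim)
      then show ?case using elim by (simp add: min_absorb1)
    qed
    show "AE \<theta> in circ. \<bar>min (u k \<theta>) (w' \<theta>)\<bar> \<le> w' \<theta>" for k
      using all nn by eventually_elim (auto simp: min_def abs_le_iff intro: order_trans[of _ 0])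
  qed (use u w' in measurable)
  have up: "cmean (u k) - cmean (\<lambda>\<theta>. min (u k \<theta>) (w' \<theta>)) \<le> cmean (\<lambda>\<theta>. max 0 (w k \<theta> - w' \<theta>))" for k
  proof -
    have "cmean (u k) - cmean (\<lambda>\<theta>. min (u k \<theta>) (w' \<theta>)) = cmean (\<lambda>\<theta>. u k \<theta> - min (u k \<theta>) (w' \<theta>))"
      using u w' by (subst cmean_diff) auto
    also have "\<dots> \<le> cmean (\<lambda>\<theta>. max 0 (w k \<theta> - w' \<theta>))"
      unfolding cmean_def
    proof (intro divide_right_mono integral_mono_AE)
      show "AE \<theta> in circ. u k \<theta> - min (u k \<theta>) (w' \<theta>) \<le> max 0 (w k \<theta> - w' \<theta>)"
        using bnd[of k] by eventually_elim (auto simp: min_def max_def)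
    qed (use u w w' in auto)
    finally show ?thesis .
  qed
  have lo: "0 \<le> cmean (u k) - cmean (\<lambda>\<theta>. min (u k \<theta>) (w' \<theta>))" for k
    using cmean_mono[of "\<lambda>\<theta>. min (u k \<theta>) (w' \<theta>)" "u k"] u w' by auto
  have "(\<lambda>k. cmean (u k) - cmean (\<lambda>\<theta>. min (u k \<theta>) (w' \<theta>))) \<longlonglongrightarrow> 0"
    by (rule tendsto_sandwich[OF _ _ tendsto_const 1]) (use up lo in auto)
  from tendsto_add[OF this 2] show ?thesis by simp
qed

lemma AE_circ_avoids_finite:
  assumes "finite E" shows "AE \<theta> in circ. cis \<theta> \<notin> E"
proof -
  have "countable {\<theta>. cis \<theta> = \<zeta>}" for \<zeta>
  proof (cases "\<exists>\<theta>0. cis \<theta>0 = \<zeta>")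
    case True
    then obtain \<theta>0 where \<theta>0: "cis \<theta>0 = \<zeta>" by blast
    have "{\<theta>. cis \<theta> = \<zeta>} \<subseteq> range (\<lambda>n::int. \<theta>0 + 2 * pi * of_int n)"
    proof
      fix \<theta> assume "\<theta> \<in> {\<theta>. cis \<theta> = \<zeta>}"
      then have "sin \<theta> = sin \<theta>0 \<and> cos \<theta> = cos \<theta>0" using \<theta>0 by (auto simp: complex_eq_iff)
      then show "\<theta> \<in> range (\<lambda>n::int. \<theta>0 + 2 * pi * of_int n)" unfolding sin_cos_eq_iff by auto
    qed
    then show ?thesis by (rule countable_subset) auto
  qed auto
  then have "countable (\<Union>\<zeta>\<in>E. {\<theta>. cis \<theta> = \<zeta>})" using assms by (intro countable_UN) (auto intro: countable_finite)
  then have "AE \<theta> in lebesgue. \<theta> \<notin> (\<Union>\<zeta>\<in>E. {\<theta>. cis \<theta> = \<zeta>})"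
    by (intro AE_not_in null_sets_completionI countable_imp_null_set_lborel)
  then show ?thesis by (subst AE_restrict_space_iff) (auto elim: eventually_mono)
qed

section \<open>Membership in the two classes by harmonic domination\<close>

lemma nevanlinna_class_dominated:
  assumes g: "g holomorphic_on ball 0 1" and H: "H holomorphic_on ball 0 1" "\<And>z. cmod z < 1 \<Longrightarrow> 0 \<le> Re (H z)"
    and M: "0 \<le> M" and bnd: "\<And>z. cmod z < 1 \<Longrightarrow> cmod (g z) \<le> exp (Re (H z) + M)"
  shows "g \<in> nevanlinna_class"
proof (rule nevanlinna_classI[OF g])
  fix r :: real assume r: "0 < r" "r < 1"
  let ?k = "\<lambda>z. H (of_real r * z)"
  note k = dilation_disc[OF H(1) less_imp_le[OF r(1)] r(2)]
  have int: "integrable circ (\<lambda>\<theta>. Re (?k (cis \<theta>)))"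
    by (intro integrable_circ_cis[of "\<lambda>z. Re (?k z)"] continuous_intros continuous_on_subset[OF k(1)]) auto
  have "circle_log_mean g r \<le> cmean (\<lambda>\<theta>. Re (?k (cis \<theta>)) + M)"
    unfolding circle_log_mean_eq_cmean
  proof (rule cmean_mono)
    show "integrable circ (\<lambda>\<theta>. Re (?k (cis \<theta>)) + M)"
      using int integrable_circ[of "\<lambda>_. M"] by auto
    fix \<theta>
    have "cmod (of_real r * cis \<theta>) < 1" using r by (simp add: norm_mult)
    then show "log_plus (cmod (g (of_real r * cis \<theta>))) \<le> Re (?k (cis \<theta>)) + M"
      using bnd H(2) M by (subst log_plus_le_iff) auto
  qed (use integrable_log_plus_circle[OF g] r in auto)
  also have "\<dots> = Re (H 0) + M"
    using int mean_value_Re[OF k(1,2)] integrable_circ[of "\<lambda>_. M"] by (subst cmean_add) auto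
  finally show "circle_log_mean g r \<le> Re (H 0) + M" .
qed

text \<open>The hypothesis \<open>mean\<close> says that no mass of \<open>Re (H z)\<close> sits on
  a singular measure. All dilations of \<open>H\<close> have the mean \<open>Re (H 0)\<close>, hence
  their means converge to that of the boundary values, and domination transfers this to
  \<open>g\<close>. Boundary values of \<open>g\<close> are its values by continuity, except at
  finitely many points.\<close>

lemma smirnov_class_dominated:
  assumes E: "finite E"
    and g: "g holomorphic_on ball 0 1" "continuous_on (cball 0 1 - E) g"
    and H: "H holomorphic_on ball 0 1" "continuous_on (cball 0 1 - E) H"
    and pos: "\<And>z. cmod z \<le> 1 \<Longrightarrow> z \<notin> E \<Longrightarrow> 0 \<le> Re (H z)"
    and int: "integrable circ (\<lambda>\<theta>. Re (H (cis \<theta>)))" and mean: "cmean (\<lambda>\<theta>. Re (H (cis \<theta>))) = Re (H 0)"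
    and disjE: "\<And>\<zeta>. \<zeta> \<in> E \<Longrightarrow> cmod \<zeta> = 1"
    and M: "0 \<le> M" and bnd: "\<And>z. cmod z < 1 \<Longrightarrow> cmod (g z) \<le> exp (Re (H z) + M)"
  shows "g \<in> smirnov_class"
proof -
  have nE: "z \<notin> E" if "cmod z < 1" for z using disjE that by auto
  have N: "g \<in> nevanlinna_class"
    using pos nE by (intro nevanlinna_class_dominated[OF g(1) H(1) _ M bnd]) auto
  have bv: "boundary_value g \<zeta> = g \<zeta>" if \<zeta>: "cmod \<zeta> = 1" "\<zeta> \<notin> E" for \<zeta>
  proof (rule boundary_value_eqI[OF _ \<zeta>(1)])
    have "(g \<longlongrightarrow> g \<zeta>) (at \<zeta> within cball 0 1 - E)" using g(2) \<zeta> unfolding continuous_on_def by auto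
    moreover have "stolz_angle \<alpha> \<zeta> \<subseteq> cball 0 1 - E" for \<alpha> using nE unfolding stolz_angle_def by auto
    ultimately show "has_nontangential_limit g \<zeta> (g \<zeta>)"
      unfolding has_nontangential_limit_def using tendsto_within_subset by blast
  qed
  have AEE: "AE \<theta> in circ. cis \<theta> \<notin> E" by (rule AE_circ_avoids_finite[OF E])
  have radial: "(\<lambda>k. f (of_real (r k) * cis \<theta>)) \<longlonglongrightarrow> f (cis \<theta>)"
    if f: "continuous_on (cball 0 1 - E) f" and r: "\<And>k. r k < 1" "\<And>k. 0 < r k" "r \<longlonglongrightarrow> 1" and \<theta>: "cis \<theta> \<notin> E"
    for f :: "complex \<Rightarrow> complex" and r \<theta>
  proof (rule continuous_on_tendsto_compose[OF f])
    have "(\<lambda>k. of_real (r k) * cis \<theta>) \<longlonglongrightarrow> of_real 1 * cis \<theta>" by (intro tendsto_intros r)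
    then show "(\<lambda>k. of_real (r k) * cis \<theta>) \<longlonglongrightarrow> cis \<theta>" by simp
    have "of_real (r k) * cis \<theta> \<in> cball 0 1 - E" for k
      using nE[of "of_real (r k) * cis \<theta>"] r(1,2)[of k] by (simp add: norm_mult)
    then show "\<forall>\<^sub>F k in sequentially. of_real (r k) * cis \<theta> \<in> cball 0 1 - E" by simp
  qed (use \<theta> in auto)
  let ?u = "\<lambda>\<theta>. log_plus (cmod (boundary_value g (cis \<theta>)))"
  have "(circle_log_mean g \<longlongrightarrow> cmean ?u) (at_left 1)"
  proof (rule tendsto_at_left_sequentially[OF zero_less_one])
    fix r :: "nat \<Rightarrow> real" assume r: "\<And>k. r k < 1" "\<And>k. 0 < r k" "r \<longlonglongrightarrow> 1"
    have k: "continuous_on (cball 0 1) (\<lambda>z. H (of_real (r k) * z))"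
      "(\<lambda>z. H (of_real (r k) * z)) holomorphic_on ball 0 1" for k
      using dilation_disc[OF H(1) less_imp_le[OF r(2)] r(1)] by auto
    have kint: "integrable circ (\<lambda>\<theta>. Re (H (of_real (r k) * cis \<theta>)))" for k
      by (intro integrable_circ_cis[of "\<lambda>z. Re (H (of_real (r k) * z))"] continuous_intros continuous_on_subset[OF k(1)]) auto
    have Mint: "integrable circ (\<lambda>_. M)" by (rule integrable_circ) auto
    show "(\<lambda>k. circle_log_mean g (r k)) \<longlonglongrightarrow> cmean ?u"
      unfolding circle_log_mean_eq_cmean
    proof (rule cmean_tendsto_dominated_varying)
      show "integrable circ (\<lambda>\<theta>. log_plus (cmod (g (of_real (r k) * cis \<theta>))))" for k
        by (rule integrable_log_plus_circle[OF g(1) less_imp_le[OF r(2)] r(1)])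
      show "integrable circ (\<lambda>\<theta>. Re (H (of_real (r k) * cis \<theta>)) + M)" for k using kint Mint by auto
      show "integrable circ (\<lambda>\<theta>. Re (H (cis \<theta>)) + M)" using int Mint by auto
      show "AE \<theta> in circ. (\<lambda>k. log_plus (cmod (g (of_real (r k) * cis \<theta>)))) \<longlonglongrightarrow> ?u \<theta>"
        using AEE by eventually_elim (auto simp: bv intro!: tendsto_intros radial[OF g(2) r])
      show "AE \<theta> in circ. (\<lambda>k. Re (H (of_real (r k) * cis \<theta>)) + M) \<longlonglongrightarrow> Re (H (cis \<theta>)) + M"
        using AEE by eventually_elim (auto intro!: tendsto_intros radial[OF H(2) r])
      show "AE \<theta> in circ. 0 \<le> log_plus (cmod (g (of_real (r k) * cis \<theta>))) \<and>
        log_plus (cmod (g (of_real (r k) * cis \<theta>))) \<le> Re (H (of_real (r k) * cis \<theta>)) + M" for k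
      proof (intro AE_I2 conjI)
        fix \<theta>
        have "cmod (of_real (r k) * cis \<theta>) < 1" using r(1,2)[of k] by (simp add: norm_mult)
        then show "log_plus (cmod (g (of_real (r k) * cis \<theta>))) \<le> Re (H (of_real (r k) * cis \<theta>)) + M"
          using bnd pos nE M by (subst log_plus_le_iff) auto
      qed auto
      have "cmean (\<lambda>\<theta>. Re (H (of_real (r k) * cis \<theta>)) + M) = Re (H 0) + M" for k
        using kint[of k] Mint mean_value_Re[OF k] by (simp add: cmean_add)
      moreover have "cmean (\<lambda>\<theta>. Re (H (cis \<theta>)) + M) = Re (H 0) + M"
        using int Mint mean by (simp add: cmean_add)
      ultimately show "(\<lambda>k. cmean (\<lambda>\<theta>. Re (H (of_real (r k) * cis \<theta>)) + M)) \<longlonglongrightarrow> cmean (\<lambda>\<theta>. Re (H (cis \<theta>)) + M)"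
        by simp
    qed
  qed
  then show ?thesis using N unfolding smirnov_class_def cmean_def set_lebesgue_integral_def
    by (simp add: integral_restrict_space)
qed

section \<open>Herglotz kernels and the construction of majorants\<close>

definition herglotz_kernel :: "complex \<Rightarrow> complex \<Rightarrow> complex" where
  "herglotz_kernel a z = (a + z) / (a - z)"

text \<open>For \<open>a\<close> on the circle this is the Poisson kernel as a function of
  \<open>z\<close>; for \<open>a\<close> outside the closed disc it is continuous and positive up to
  the circle.\<close>

lemma Re_herglotz_kernel:
  "Re (herglotz_kernel a z) = ((cmod a)\<^sup>2 - (cmod z)\<^sup>2) / (cmod (a - z))\<^sup>2"
proof -
  have "Re ((a + z) * cnj (a - z)) = (cmod a)\<^sup>2 - (cmod z)\<^sup>2"
    unfolding cmod_power2 by (simp add: power2_eq_square algebra_simps)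
  then show ?thesis unfolding herglotz_kernel_def complex_div_cnj[of "a + z"]
    by (simp flip: of_real_power)
qed

text \<open>Moving a point of the circle radially outwards increases its distance from every point
  of the disc. Hence the shifted poles obey the same lower bound on \<open>away d\<close> as the
  vertices, uniformly in the shift.\<close>

lemma norm_scaled_diff_ge:
  assumes "cmod \<zeta> = 1" "cmod z \<le> 1" "0 \<le> s"
  shows "cmod (\<zeta> - z) \<le> cmod (of_real (1 + s) * \<zeta> - z)"
proof -
  have "Re (z * cnj \<zeta>) \<le> cmod (z * cnj \<zeta>)" by (rule complex_Re_le_cmod)
  also have "\<dots> \<le> 1" using assms by (simp add: norm_mult)
  finally have 1: "Re (z * cnj \<zeta>) \<le> 1" .
  have \<zeta>2: "(Re \<zeta>)\<^sup>2 + (Im \<zeta>)\<^sup>2 = 1" using assms(1) cmod_power2[of \<zeta>] by simp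
  have "(cmod (of_real (1 + s) * \<zeta> - z))\<^sup>2 - (cmod (\<zeta> - z))\<^sup>2 = (2 * s + s\<^sup>2) * ((Re \<zeta>)\<^sup>2 + (Im \<zeta>)\<^sup>2) - 2 * s * Re (z * cnj \<zeta>)"
    unfolding cmod_power2 by (simp add: power2_eq_square algebra_simps)
  also have "\<dots> = s\<^sup>2 + 2 * s * (1 - Re (z * cnj \<zeta>))" unfolding \<zeta>2 by (simp add: algebra_simps)
  also have "\<dots> \<ge> 0" using 1 assms by (intro add_nonneg_nonneg mult_nonneg_nonneg) auto
  finally have "(cmod (\<zeta> - z))\<^sup>2 \<le> (cmod (of_real (1 + s) * \<zeta> - z))\<^sup>2" by simp
  then show ?thesis by (rule power2_le_imp_le) auto
qed

context stolz_blaschke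
begin

text \<open>Shifting the pole from \<open>\<zeta>\<close> to \<open>(1 + s\<^sub>k) \<zeta>\<close> makes the majorant quasi-bounded,
  while it still has size \<open>c\<^sub>k / (1 - \<bar>\<mu>\<bar>)\<close> at the points with \<open>1 - \<bar>\<mu>\<bar> \<ge> s\<^sub>k\<close>.\<close>
lemma positive_majorant:
  fixes c s :: "nat \<Rightarrow> real"
  assumes c: "\<And>k. 0 \<le> c k" "Series.summable c" and s: "\<And>k. 0 \<le> s k" "\<And>k. s k \<le> 1"
  obtains H where "H holomorphic_on ball 0 1" "continuous_on (cball 0 1 - E) H"
    "\<And>z. cmod z \<le> 1 \<Longrightarrow> z \<notin> E \<Longrightarrow> 0 \<le> Re (H z)"
    "(\<And>k. 0 < s k) \<Longrightarrow> integrable circ (\<lambda>\<theta>. Re (H (cis \<theta>))) \<and> cmean (\<lambda>\<theta>. Re (H (cis \<theta>))) = Re (H 0)"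
    "\<And>\<mu> k. \<mu> \<in> \<Lambda> \<Longrightarrow> s k \<le> 1 - cmod \<mu> \<Longrightarrow> c k / ((1 + A)\<^sup>2 * (1 - cmod \<mu>)) \<le> Re (H \<mu>)"
proof -
  \<comment> \<open>Shifts \<open>s k = 0\<close>, with poles on the circle, serve the Nevanlinna
    class; positive shifts serve the Smirnov class. Every vertex carries the same masses, so the
    vertex nearest to a given point need not be tracked.\<close>
  define t where "t \<zeta> k z = of_real (c k) * herglotz_kernel (of_real (1 + s k) * \<zeta>) z" for \<zeta> k z
  define h where "h \<zeta> z = (\<Sum>k. t \<zeta> k z)" for \<zeta> z
  define H where "H z = (\<Sum>\<zeta>\<in>E. h \<zeta> z)" for z
  have den: "d \<le> cmod (of_real (1 + s k) * \<zeta> - z)" if "\<zeta> \<in> E" "z \<in> away d" for \<zeta> z k d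
    using norm_scaled_diff_ge[OF circleE[OF that(1)], of z "s k"] that s(1)[of k]
    unfolding away_def by (auto simp: norm_minus_commute intro: order_trans)
  \<comment> \<open>The 3 bounds \<open>(1 + s k) + cmod z\<close>.\<close>
  have tb: "cmod (t \<zeta> k z) \<le> 3 / d * c k" if "\<zeta> \<in> E" "z \<in> away d" "d > 0" for \<zeta> z k d
  proof -
    have "cmod (of_real (1 + s k) * \<zeta> + z) \<le> cmod (of_real (1 + s k) * \<zeta>) + cmod z" by (rule norm_triangle_ineq)
    also have "cmod (of_real (1 + s k) * \<zeta>) = 1 + s k"
      using circleE[OF that(1)] s(1)[of k] by (simp only: norm_mult norm_of_real) simp
    finally have "cmod (of_real (1 + s k) * \<zeta> + z) \<le> 3" using s(2)[of k] that unfolding away_def by simp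
    then have "cmod (herglotz_kernel (of_real (1 + s k) * \<zeta>) z) \<le> 3 / d"
      unfolding herglotz_kernel_def norm_divide using den[OF that(1,2), of k] that(3) by (intro frac_le) auto
    then have "c k * cmod (herglotz_kernel (of_real (1 + s k) * \<zeta>) z) \<le> c k * (3 / d)" using c(1) by (intro mult_left_mono)
    then show ?thesis unfolding t_def using c(1)[of k] by (simp add: norm_mult mult.commute)
  qed
  have sm: "Series.summable (\<lambda>k. 3 / d * c k)" for d using c(2) by (rule summable_mult)
  have ul: "uniform_limit (away d) (\<lambda>n z. \<Sum>k<n. t \<zeta> k z) (h \<zeta>) sequentially" if "\<zeta> \<in> E" "d > 0" for \<zeta> d
    unfolding h_def[abs_def] by (rule Weierstrass_m_test[OF _ sm]) (use tb that in auto)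
  have thol: "t \<zeta> k holomorphic_on {z. z \<noteq> of_real (1 + s k) * \<zeta>}" for \<zeta> k
    unfolding t_def[abs_def] herglotz_kernel_def by (intro holomorphic_intros) auto
  have away_ne: "z \<noteq> of_real (1 + s k) * \<zeta>" if "\<zeta> \<in> E" "z \<in> away d" "d > 0" for z \<zeta> k d
    using den[OF that(1,2), of k] that(3) by auto
  have away_sub: "away d \<subseteq> {z. z \<noteq> of_real (1 + s k) * \<zeta>}" if "\<zeta> \<in> E" "d > 0" for \<zeta> k d
    using away_ne[OF that(1) _ that(2)] by blast
  have ball_away: "z \<in> away (1 - cmod z)" if "cmod z < 1" for z using cball_subset_away[OF that] by auto
  have hc: "continuous_on (cball 0 1 - E) (h \<zeta>)" if \<zeta>: "\<zeta> \<in> E" for \<zeta>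
  proof (rule continuous_on_away_limit)
    fix d :: real assume d: "d > 0"
    show "continuous_on (away d) (h \<zeta>)"
      by (rule uniform_limit_theorem[OF _ ul[OF \<zeta> d]])
        (auto intro!: always_eventually continuous_on_sum
          continuous_on_subset[OF holomorphic_on_imp_continuous_on[OF thol] away_sub[OF \<zeta> d]])
  qed
  have hh: "h \<zeta> holomorphic_on ball 0 1" if \<zeta>: "\<zeta> \<in> E" for \<zeta>
  proof (rule holomorphic_on_ball_uniform_limit)
    show "\<forall>\<^sub>F n in sequentially. (\<lambda>z. \<Sum>k<n. t \<zeta> k z) holomorphic_on ball 0 1"
    proof (intro always_eventually allI holomorphic_on_sum holomorphic_on_subset[OF thol])
      show "ball 0 1 \<subseteq> {z. z \<noteq> of_real (1 + s k) * \<zeta>}" for k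
        using away_ne[OF \<zeta> ball_away] by (simp only: subset_iff mem_ball_0 mem_Collect_eq diff_gt_0_iff_gt) blast
    qed
    show "uniform_limit (cball 0 r) (\<lambda>n z. \<Sum>k<n. t \<zeta> k z) (h \<zeta>) sequentially" if "r < 1" for r
      by (rule uniform_limit_on_subset[OF ul[OF \<zeta>] cball_subset_away[OF that]]) (use that in simp)
  qed auto
  have tnn: "0 \<le> Re (t \<zeta> k z)" if "\<zeta> \<in> E" "cmod z \<le> 1" for \<zeta> k z
  proof -
    have "cmod (of_real (1 + s k) * \<zeta>) = 1 + s k"
      using circleE[OF that(1)] s(1)[of k] by (simp only: norm_mult norm_of_real) simp
    then have "(cmod z)\<^sup>2 \<le> (cmod (of_real (1 + s k) * \<zeta>))\<^sup>2" using that s(1)[of k] by (intro power_mono) auto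
    then have "0 \<le> Re (herglotz_kernel (of_real (1 + s k) * \<zeta>) z)" unfolding Re_herglotz_kernel by simp
    then show ?thesis unfolding t_def using c(1)[of k] by simp
  qed
  have tsum: "(\<lambda>k. t \<zeta> k z) sums h \<zeta> z" if \<zeta>: "\<zeta> \<in> E" and z: "cmod z \<le> 1" "z \<notin> E" for \<zeta> z
  proof -
    obtain d where d: "d > 0" "\<And>w. cmod w \<le> 1 \<Longrightarrow> w \<in> ball z d \<Longrightarrow> w \<in> away d"
      using away_neighbourhood[OF z(2)] by blast
    then show ?thesis unfolding sums_def using tendsto_uniform_limitI[OF ul[OF \<zeta> d(1)]] z by simp
  qed
  have Resum: "(\<lambda>k. Re (t \<zeta> k z)) sums Re (h \<zeta> z)" if "\<zeta> \<in> E" "cmod z \<le> 1" "z \<notin> E" for \<zeta> z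
    using tsum[OF that] by (rule sums_Re)
  have hpos: "0 \<le> Re (h \<zeta> z)" if "\<zeta> \<in> E" "cmod z \<le> 1" "z \<notin> E" for \<zeta> z
    using sums_le[OF _ sums_zero Resum[OF that]] tnn[OF that(1,2)] by auto
  show ?thesis
  proof (rule that[of H])
    show "H holomorphic_on ball 0 1" unfolding H_def[abs_def] by (intro holomorphic_intros hh)
    show "continuous_on (cball 0 1 - E) H" unfolding H_def[abs_def] by (intro continuous_intros hc)
    show "0 \<le> Re (H z)" if "cmod z \<le> 1" "z \<notin> E" for z
      unfolding H_def Re_sum using that hpos by (intro sum_nonneg) auto
    show "c k / ((1 + A)\<^sup>2 * (1 - cmod \<mu>)) \<le> Re (H \<mu>)" if \<mu>: "\<mu> \<in> \<Lambda>" and k: "s k \<le> 1 - cmod \<mu>" for \<mu> k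
    proof -
      have m: "cmod \<mu> < 1" using disc[OF \<mu>] .
      have mE: "\<mu> \<notin> E" by (rule ball_notin_E[OF m])
      obtain \<zeta> where \<zeta>: "\<zeta> \<in> E" "cmod (\<mu> - \<zeta>) \<le> A * (1 - cmod \<mu>)" using stolz[OF \<mu>] by blast
      let ?a = "of_real (1 + s k) * \<zeta>" and ?x = "1 - cmod \<mu>"
      have na: "cmod ?a = 1 + s k"
        using circleE[OF \<zeta>(1)] s(1)[of k] by (simp only: norm_mult norm_of_real) simp
      \<comment> \<open>Since the shift is at most \<open>1 - cmod \<mu>\<close>, moving the pole
        only replaces \<open>A\<close> by \<open>1 + A\<close> in the distance estimate.\<close>
      have "?a - \<mu> = (\<zeta> - \<mu>) + of_real (s k) * \<zeta>" by (simp add: algebra_simps)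
      then have "cmod (?a - \<mu>) \<le> cmod (\<zeta> - \<mu>) + cmod (of_real (s k) * \<zeta>)" by (metis norm_triangle_ineq)
      also have "\<dots> \<le> A * ?x + ?x" using \<zeta> k s(1)[of k] circleE[OF \<zeta>(1)] by (simp add: norm_mult norm_minus_commute)
      finally have up: "cmod (?a - \<mu>) \<le> (1 + A) * ?x" by (simp add: algebra_simps)
      have "\<mu> \<noteq> ?a" using away_ne[OF \<zeta>(1) ball_away[OF m]] m by simp
      then have pos: "0 < cmod (?a - \<mu>)" by simp
      have "?x \<le> (cmod ?a)\<^sup>2 - (cmod \<mu>)\<^sup>2"
      proof -
        have "1 \<le> (cmod ?a)\<^sup>2" unfolding na using s(1)[of k] by (simp add: one_le_power)
        moreover have "(cmod \<mu>)\<^sup>2 \<le> cmod \<mu>" using m by (simp add: power2_eq_square mult_left_le)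
        ultimately show ?thesis by simp
      qed
      moreover have "0 \<le> (cmod ?a)\<^sup>2 - (cmod \<mu>)\<^sup>2" using calculation m by linarith
      moreover have "(cmod (?a - \<mu>))\<^sup>2 \<le> ((1 + A) * ?x)\<^sup>2" by (rule power_mono[OF up]) simp
      moreover have "0 < (cmod (?a - \<mu>))\<^sup>2" using pos by (rule zero_less_power)
      ultimately have "?x / ((1 + A) * ?x)\<^sup>2 \<le> Re (herglotz_kernel ?a \<mu>)"
        unfolding Re_herglotz_kernel by (intro frac_le)
      then have "c k * (?x / ((1 + A) * ?x)\<^sup>2) \<le> c k * Re (herglotz_kernel ?a \<mu>)"
        using c(1) by (intro mult_left_mono)
      also have "\<dots> = Re (t \<zeta> k \<mu>)" unfolding t_def by simp
      finally have "c k * (?x / ((1 + A) * ?x)\<^sup>2) \<le> Re (t \<zeta> k \<mu>)" .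
      moreover have "c k * (?x / ((1 + A) * ?x)\<^sup>2) = c k / ((1 + A)\<^sup>2 * ?x)"
        using m by (simp add: power2_eq_square)
      ultimately have "c k / ((1 + A)\<^sup>2 * ?x) \<le> Re (t \<zeta> k \<mu>)" by simp
      also have "\<dots> = (\<Sum>k\<in>{k}. Re (t \<zeta> k \<mu>))" by simp
      also have "\<dots> \<le> (\<Sum>k. Re (t \<zeta> k \<mu>))"
        using Resum[OF \<zeta>(1) less_imp_le[OF m] mE] tnn[OF \<zeta>(1) less_imp_le[OF m]]
        by (intro sum_le_suminf) (auto simp: sums_iff)
      also have "\<dots> = Re (h \<zeta> \<mu>)" using Resum[OF \<zeta>(1) less_imp_le[OF m] mE] by (simp add: sums_iff)
      also have "\<dots> = (\<Sum>\<zeta>\<in>{\<zeta>}. Re (h \<zeta> \<mu>))" by simp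
      also have "\<dots> \<le> Re (H \<mu>)"
        unfolding H_def Re_sum using \<zeta>(1) finE hpos m mE by (intro sum_mono2) auto
      finally show ?thesis .
    qed
    assume spos: "\<And>k. 0 < s k"
    have AEE: "AE \<theta> in circ. cis \<theta> \<notin> E" by (rule AE_circ_avoids_finite[OF finE])
    have one: "integrable circ (\<lambda>\<theta>. Re (h \<zeta> (cis \<theta>))) \<and> cmean (\<lambda>\<theta>. Re (h \<zeta> (cis \<theta>))) = Re (h \<zeta> 0)" if \<zeta>: "\<zeta> \<in> E" for \<zeta>
    proof -
      have ne: "z \<noteq> of_real (1 + s k) * \<zeta>" if "cmod z \<le> 1" for z k
      proof
        assume "z = of_real (1 + s k) * \<zeta>"
        then have "cmod z = 1 + s k" using circleE[OF \<zeta>] s(1)[of k] by (simp only: norm_mult norm_of_real) simp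
        then show False using that spos[of k] by simp
      qed
      have th: "t \<zeta> k holomorphic_on cball 0 1" for k
        by (rule holomorphic_on_subset[OF thol]) (use ne mem_cball_0 in blast)
      have tc: "continuous_on (cball 0 1) (t \<zeta> k)" for k by (rule holomorphic_on_imp_continuous_on[OF th])
      have tint: "integrable circ (\<lambda>\<theta>. Re (t \<zeta> k (cis \<theta>)))" for k
        by (intro integrable_circ_cis[of "\<lambda>z. Re (t \<zeta> k z)"] continuous_intros continuous_on_subset[OF tc]) auto
      have "\<zeta> \<noteq> 0" using circleE[OF \<zeta>] by auto
      then have t0: "Re (t \<zeta> k 0) = c k" for k using ne[of 0 k] unfolding t_def herglotz_kernel_def by simp
      \<comment> \<open>With its pole off the closed disc each term satisfies the mean value
        formula. The terms are nonnegative with summable integrals, so the formula passes to the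
        series.\<close>
      have tmean: "(\<integral>\<theta>. Re (t \<zeta> k (cis \<theta>)) \<partial>circ) = 2 * pi * c k" for k
        using mean_value_Re[OF tc holomorphic_on_subset[OF th]] t0[of k] unfolding cmean_def
        by (auto simp: field_simps)
      have AEsum: "AE \<theta> in circ. (\<lambda>k. Re (t \<zeta> k (cis \<theta>))) sums Re (h \<zeta> (cis \<theta>))"
        using AEE by eventually_elim (use Resum[OF \<zeta>] in auto)
      have norm_eq: "norm (Re (t \<zeta> k (cis \<theta>))) = Re (t \<zeta> k (cis \<theta>))" for k \<theta> using tnn[OF \<zeta>, of "cis \<theta>" k] by simp
      have 1: "AE \<theta> in circ. Series.summable (\<lambda>k. norm (Re (t \<zeta> k (cis \<theta>))))"
        using AEsum unfolding norm_eq by eventually_elim (auto simp: sums_iff)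
      have 2: "Series.summable (\<lambda>k. \<integral>\<theta>. norm (Re (t \<zeta> k (cis \<theta>))) \<partial>circ)"
        unfolding norm_eq tmean using c(2) by (rule summable_mult)
      have AEeq: "AE \<theta> in circ. (\<Sum>k. Re (t \<zeta> k (cis \<theta>))) = Re (h \<zeta> (cis \<theta>))"
        using AEsum by eventually_elim (auto simp: sums_iff)
      have S: "integrable circ (\<lambda>\<theta>. \<Sum>k. Re (t \<zeta> k (cis \<theta>)))" by (rule integrable_suminf[OF tint 1 2])
      have meas: "(\<lambda>\<theta>. Re (h \<zeta> (cis \<theta>))) \<in> borel_measurable circ"
        by (rule measurable_circ_AE_limit[of "\<lambda>n \<theta>. \<Sum>k<n. Re (t \<zeta> k (cis \<theta>))"])
          (use AEsum in \<open>auto simp: sums_def intro!: borel_measurable_sum borel_measurable_integrable[OF tint]\<close>)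
      have "integrable circ (\<lambda>\<theta>. Re (h \<zeta> (cis \<theta>)))"
        using S AEeq meas by (subst integrable_cong_AE[symmetric]) auto
      moreover have "(\<integral>\<theta>. Re (h \<zeta> (cis \<theta>)) \<partial>circ) = (\<integral>\<theta>. (\<Sum>k. Re (t \<zeta> k (cis \<theta>))) \<partial>circ)"
        using S AEeq meas by (intro integral_cong_AE) auto
      moreover have "(\<integral>\<theta>. (\<Sum>k. Re (t \<zeta> k (cis \<theta>))) \<partial>circ) = (\<Sum>k. 2 * pi * c k)"
        unfolding integral_suminf[OF tint 1 2] tmean ..
      moreover have "(\<Sum>k. 2 * pi * c k) = 2 * pi * (\<Sum>k. c k)" by (rule suminf_mult[OF c(2)])
      moreover have "Re (h \<zeta> 0) = (\<Sum>k. c k)"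
        using Resum[OF \<zeta>, of 0] ball_notin_E[of 0] unfolding t0 by (simp add: sums_iff)
      ultimately show ?thesis unfolding cmean_def by simp
    qed
    have i: "integrable circ (\<lambda>\<theta>. Re (H (cis \<theta>)))"
      unfolding H_def Re_sum using one by (intro Bochner_Integration.integrable_sum) auto
    have "(\<integral>\<theta>. Re (H (cis \<theta>)) \<partial>circ) = (\<Sum>\<zeta>\<in>E. \<integral>\<theta>. Re (h \<zeta> (cis \<theta>)) \<partial>circ)"
      unfolding H_def Re_sum using one by (intro Bochner_Integration.integral_sum) auto
    then have "cmean (\<lambda>\<theta>. Re (H (cis \<theta>))) = (\<Sum>\<zeta>\<in>E. cmean (\<lambda>\<theta>. Re (h \<zeta> (cis \<theta>))))"
      unfolding cmean_def by (simp add: sum_divide_distrib)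
    also have "\<dots> = Re (H 0)" unfolding H_def Re_sum using one by (intro sum.cong) auto
    finally show "integrable circ (\<lambda>\<theta>. Re (H (cis \<theta>))) \<and> cmean (\<lambda>\<theta>. Re (H (cis \<theta>))) = Re (H 0)" using i by simp
  qed
qed

end

section \<open>Interpolation\<close>

lemma free_interpolating_iff:
  "free_interpolating \<Lambda> X \<longleftrightarrow>
    (\<forall>f\<in>X. \<forall>\<omega> :: complex \<Rightarrow> complex. bounded (\<omega> ` \<Lambda>) \<longrightarrow> (\<exists>g\<in>X. \<forall>\<mu>\<in>\<Lambda>. g \<mu> = \<omega> \<mu> * f \<mu>))"
proof -
  have "(\<lambda>\<mu>\<in>\<Lambda>. \<omega> \<mu> * restrict f \<Lambda> \<mu>) \<in> trace_space X \<Lambda> \<longleftrightarrow> (\<exists>g\<in>X. \<forall>\<mu>\<in>\<Lambda>. g \<mu> = \<omega> \<mu> * f \<mu>)" for \<omega> f :: "complex \<Rightarrow> complex"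
    unfolding trace_space_def image_iff fun_eq_iff restrict_def by (metis (full_types))
  then show ?thesis unfolding free_interpolating_def by (simp add: trace_space_def)
qed

lemma one_smirnov_class: "(\<lambda>_. 1) \<in> smirnov_class"
  by (rule smirnov_class_dominated[of "{}" _ "\<lambda>_. 0" 0]) (auto intro: integrable_circ)

lemma smirnov_subset_nevanlinna: "smirnov_class \<subseteq> nevanlinna_class"
  unfolding smirnov_class_def by auto

lemma nevanlinna_class_truncated_means:
  assumes "f \<in> nevanlinna_class"
  obtains C where "0 < C" "\<forall>\<^sub>F R in at_left 1. cmean (\<lambda>\<theta>. max 0 (log_plus (cmod (f (of_real R * cis \<theta>))) - 0)) \<le> C"
proof -
  obtain C where C: "0 < C" "\<And>r. 0 \<le> r \<Longrightarrow> r < 1 \<Longrightarrow> circle_log_mean f r \<le> C"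
    using nevanlinna_class_bounded_means[OF assms] by metis
  have "\<forall>\<^sub>F R in at_left 1. cmean (\<lambda>\<theta>. max 0 (log_plus (cmod (f (of_real R * cis \<theta>))) - 0)) \<le> C"
    using eventually_at_left_real[OF zero_less_one]
    by eventually_elim (use C(2) in \<open>simp add: circle_log_mean_eq_cmean max_absorb2\<close>)
  then show ?thesis using that C(1) by blast
qed

text \<open>The division estimate with an empty zero set. After multiplication by
  \<open>1 - cmod z\<close> the contribution of \<open>M\<close> dies at the circle and
  \<open>2 * \<kappa>\<close> is left: a constant for the Nevanlinna class, arbitrarily small for
  the Smirnov class.\<close>

lemma log_plus_growth:
  assumes f: "f holomorphic_on ball 0 1" and M: "0 \<le> M" and \<kappa>: "0 \<le> \<kappa>"
    "\<forall>\<^sub>F R in at_left 1. cmean (\<lambda>\<theta>. max 0 (log_plus (cmod (f (of_real R * cis \<theta>))) - M)) \<le> \<kappa>"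
    and z: "cmod z < 1"
  shows "(1 - cmod z) * log_plus (cmod (f z)) \<le> (1 - cmod z) * M + 2 * \<kappa>"
proof -
  have "cmod (f z) \<le> exp (M + 2 / (1 - cmod z) * \<kappa>)"
    by (rule growth_after_division[of "{}" f f M \<kappa>]) (use f \<kappa> z in auto)
  then have "log_plus (cmod (f z)) \<le> M + 2 / (1 - cmod z) * \<kappa>"
    using M \<kappa> z by (subst log_plus_le_iff) auto
  then have "(1 - cmod z) * log_plus (cmod (f z)) \<le> (1 - cmod z) * (M + 2 / (1 - cmod z) * \<kappa>)"
    using z by (intro mult_left_mono) auto
  also have "\<dots> = (1 - cmod z) * M + 2 * \<kappa>" using z by (simp add: distrib_left)
  finally show ?thesis .
qed

lemma mult_ln_inverse_le: "0 < x \<Longrightarrow> x \<le> 1 \<Longrightarrow> x * ln (inverse x) \<le> (1::real)"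
proof -
  assume x: "0 < x" "x \<le> 1"
  have "ln (inverse x) \<le> inverse x - 1" using x by (intro ln_le_minus_one) auto
  then have "x * ln (inverse x) \<le> x * (inverse x - 1)" using x by (intro mult_left_mono) auto
  also have "\<dots> \<le> 1" using x by (simp add: algebra_simps)
  finally show ?thesis .
qed

lemma mult_ln_inverse_small:
  fixes e :: real assumes "e > 0"
  obtains \<delta> where "\<delta> > 0" "\<And>x. 0 < x \<Longrightarrow> x < \<delta> \<Longrightarrow> x * ln (inverse x) \<le> e"
proof -
  have "((\<lambda>x::real. x * ln (inverse x)) \<longlongrightarrow> 0) (at_right 0)" by real_asymp
  then have "\<forall>\<^sub>F x in at_right (0::real). x * ln (inverse x) < e" using assms by (rule order_tendstoD)
  then show ?thesis using that unfolding eventually_at_right_field by (metis less_imp_le)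
qed

text \<open>By the pseudohyperbolic identity, 1 - |b|^2 is at most twice \<open>1 - cmod z\<close>
  over the square of \<open>1 - cmod \<nu>\<close>. A factor is therefore close to 1 in modulus as
  soon as \<open>z\<close> is much nearer to the circle than \<open>\<nu>\<close>.\<close>

lemma norm_blaschke_factor_ge:
  assumes \<nu>: "cmod \<nu> < 1" and z: "cmod z < 1" and \<eta>: "1 - cmod z \<le> \<eta> * (1 - cmod \<nu>)\<^sup>2 / 2"
  shows "1 - \<eta> \<le> cmod (blaschke_factor \<nu> z)"
proof -
  let ?b = "cmod (blaschke_factor \<nu> z)" and ?D = "cmod (1 - cnj \<nu> * z)"
  have D: "1 - cmod \<nu> \<le> ?D" by (rule blaschke_denom_ge[OF \<nu> less_imp_le[OF z]])
  then have D0: "0 < ?D" using \<nu> by linarith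
  have b1: "?b \<le> 1" by (rule norm_blaschke_factor_le_1[OF \<nu> less_imp_le[OF z]])
  have "(1 - ?b\<^sup>2) * ?D\<^sup>2 = ?D\<^sup>2 - (cmod (\<nu> - z))\<^sup>2"
    unfolding norm_blaschke_factor using D0 by (simp add: power_divide left_diff_distrib)
  also have "\<dots> = (1 - (cmod \<nu>)\<^sup>2) * (1 - (cmod z)\<^sup>2)" by (rule blaschke_factor_identity)
  also have "\<dots> \<le> 1 * (1 - (cmod z)\<^sup>2)" using z by (intro mult_right_mono) (auto simp: abs_square_le_1)
  also have "1 * (1 - (cmod z)\<^sup>2) = (1 + cmod z) * (1 - cmod z)" by (simp add: power2_eq_square algebra_simps)
  also have "\<dots> \<le> 2 * (1 - cmod z)" using z by (intro mult_right_mono) auto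
  also have "\<dots> \<le> \<eta> * (1 - cmod \<nu>)\<^sup>2" using \<eta> by simp
  finally have 1: "(1 - ?b\<^sup>2) * ?D\<^sup>2 \<le> \<eta> * (1 - cmod \<nu>)\<^sup>2" .
  have "0 \<le> \<eta> * (1 - cmod \<nu>)\<^sup>2" using \<eta> z by linarith
  then have "0 \<le> \<eta>" using \<nu> by (simp add: zero_le_mult_iff)
  then have "\<eta> * (1 - cmod \<nu>)\<^sup>2 \<le> \<eta> * ?D\<^sup>2" using D \<nu> by (intro mult_left_mono power_mono) auto
  then have "(1 - ?b\<^sup>2) * ?D\<^sup>2 \<le> \<eta> * ?D\<^sup>2" using 1 by linarith
  then have "1 - ?b\<^sup>2 \<le> \<eta>" using D0 by simp
  moreover have "?b\<^sup>2 \<le> ?b" using b1 by (simp add: power2_eq_square mult_left_le)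
  ultimately show ?thesis by linarith
qed

lemma prod_ge_one_minus_sum:
  fixes x y :: "'a \<Rightarrow> real"
  assumes "finite F" "\<And>i. i \<in> F \<Longrightarrow> 1 - x i \<le> y i" "\<And>i. i \<in> F \<Longrightarrow> 0 \<le> y i" "\<And>i. i \<in> F \<Longrightarrow> y i \<le> 1"
    "\<And>i. i \<in> F \<Longrightarrow> 0 \<le> x i"
  shows "1 - sum x F \<le> prod y F"
  using assms
proof (induction F rule: finite_induct)
  case (insert i F)
  have IH: "1 - sum x F \<le> prod y F" using insert by auto
  have p: "0 \<le> prod y F" "prod y F \<le> 1" using insert by (auto intro!: prod_nonneg prod_le_1)
  have "1 - x i \<le> y i" "0 \<le> x i" using insert by auto
  then have "(1 - x i) * prod y F \<le> y i * prod y F" using p by (intro mult_right_mono)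
  moreover have "x i * prod y F \<le> x i * 1" using p \<open>0 \<le> x i\<close> by (intro mult_left_mono)
  ultimately show ?case using IH insert(1,2) by (simp add: left_diff_distrib)
qed auto

text \<open>Each point is placed so near the circle that its factors with all earlier points are
  within \<open>(1/4) ^ (n + 1)\<close> of 1. By symmetry of the modulus in its two points the same
  holds for later points, and the deviations sum to \<open>1 / 3\<close>. The sets
  \<open>S n\<close> may depend on \<open>n\<close>, which lets the badness of the chosen points
  grow along the sequence.\<close>

lemma sparse_sequence:
  assumes S: "\<forall>n. \<forall>r<1. \<exists>\<mu>\<in>S n. r < cmod \<mu>" and disc: "\<forall>n. \<forall>\<mu>\<in>S n. cmod \<mu> < 1"
  shows "\<exists>l :: nat \<Rightarrow> complex. (\<forall>n. l n \<in> S n) \<and> (\<forall>n. 1 - cmod (l n) < 1 / (real n + 1)) \<and>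
    (\<forall>n F. finite F \<longrightarrow> F \<subseteq> range l - {l n} \<longrightarrow> 2 / 3 \<le> cmod (\<Prod>\<nu>\<in>F. blaschke_factor \<nu> (l n)))"
proof -
  let ?P = "\<lambda>l n r. r \<in> S n \<and> 1 - cmod r < 1 / (real n + 1) \<and> (\<forall>k<n. 1 - (1/4) ^ (n + 1) \<le> cmod (blaschke_factor (l k) r))"
  have "\<exists>l. \<forall>n. ?P l n (l n)"
  proof (rule dependent_wellorder_choice)
    fix n and l :: "nat \<Rightarrow> complex" assume l: "\<And>k. k < n \<Longrightarrow> ?P l k (l k)"
    \<comment> \<open>Finitely many radii below 1 are to be exceeded: one for the approach to the
      circle and one for each earlier point.\<close>
    define R where "R = Max (insert (1 - 1 / (real n + 1)) ((\<lambda>k. 1 - (1/4) ^ (n + 1) * (1 - cmod (l k))\<^sup>2 / 2) ` {..<n}))"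
    have "R < 1" unfolding R_def using l disc by (subst Max_less_iff) fastforce+
    then obtain \<mu> where \<mu>: "\<mu> \<in> S n" "R < cmod \<mu>" using S by blast
    have m: "cmod \<mu> < 1" using \<mu>(1) disc by blast
    have "1 - 1 / (real n + 1) \<le> R" unfolding R_def by (intro Max_ge) auto
    moreover have "1 - (1/4) ^ (n + 1) \<le> cmod (blaschke_factor (l k) \<mu>)" if k: "k < n" for k
    proof (rule norm_blaschke_factor_ge[OF _ m])
      show "cmod (l k) < 1" using l[OF k] disc by blast
      have "1 - (1/4) ^ (n + 1) * (1 - cmod (l k))\<^sup>2 / 2 \<le> R" unfolding R_def using k by (intro Max_ge) auto
      then show "1 - cmod \<mu> \<le> (1/4) ^ (n + 1) * (1 - cmod (l k))\<^sup>2 / 2" using \<mu>(2) by linarith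
    qed
    ultimately show "\<exists>r. ?P l n r" using \<mu> by (intro exI[of _ \<mu>]) auto
  qed auto
  then obtain l where l: "\<And>n. l n \<in> S n" "\<And>n. 1 - cmod (l n) < 1 / (real n + 1)"
    "\<And>n k. k < n \<Longrightarrow> 1 - (1/4) ^ (n + 1) \<le> cmod (blaschke_factor (l k) (l n))" by blast
  have l1: "cmod (l n) < 1" for n using disc l(1) by blast
  \<comment> \<open>The deviation is charged to the index \<open>k\<close> of the other point,
    whichever of the two comes first, so that the sum over \<open>k\<close> converges.\<close>
  have b: "1 - (1/4) ^ (k + 1) \<le> cmod (blaschke_factor (l k) (l n))" if "k \<noteq> n" for k n
  proof (cases "k < n")
    case True
    have "(1/4 :: real) ^ (n + 1) \<le> (1/4) ^ (k + 1)" using True by (intro power_decreasing) auto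
    then show ?thesis using l(3)[OF True] by linarith
  next
    case False
    then show ?thesis using l(3)[of n k] that norm_blaschke_factor_commute[of "l k" "l n"] by simp
  qed
  have "2 / 3 \<le> cmod (\<Prod>\<nu>\<in>F. blaschke_factor \<nu> (l n))" if F: "finite F" "F \<subseteq> range l - {l n}" for n F
  proof -
    \<comment> \<open>Selects one index for each point of \<open>F\<close>, turning the sum over
      points into a sum over distinct indices.\<close>
    define i where "i = inv l"
    have il: "l (i \<nu>) = \<nu>" if "\<nu> \<in> F" for \<nu> unfolding i_def using F(2) that by (intro f_inv_into_f) auto
    have inj: "inj_on i F" by (rule inj_on_inverseI[of F l]) (use il in auto)
    have "(\<Sum>\<nu>\<in>F. (1/4 :: real) ^ (i \<nu> + 1)) = (\<Sum>k\<in>i ` F. (1/4) ^ (k + 1))"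
      by (simp add: sum.reindex[OF inj])
    also have "\<dots> \<le> (\<Sum>k. (1/4 :: real) ^ (k + 1))"
      using F(1) by (intro sum_le_suminf) (auto intro!: summable_mult summable_geometric)
    also have "(\<Sum>k. (1/4 :: real) ^ (k + 1)) = 1 / 3"
      using suminf_mult[of "\<lambda>k. (1/4 :: real) ^ k" "1/4"] by (simp add: suminf_geometric summable_geometric)
    finally have "2 / 3 \<le> 1 - (\<Sum>\<nu>\<in>F. (1/4 :: real) ^ (i \<nu> + 1))" by simp
    also have "\<dots> \<le> (\<Prod>\<nu>\<in>F. cmod (blaschke_factor \<nu> (l n)))"
    proof (rule prod_ge_one_minus_sum[OF F(1)])
      fix \<nu> assume \<nu>: "\<nu> \<in> F"
      then have "i \<nu> \<noteq> n" using il F(2) by auto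
      from b[OF this] show "1 - (1/4) ^ (i \<nu> + 1) \<le> cmod (blaschke_factor \<nu> (l n))" using il[OF \<nu>] by simp
      show "cmod (blaschke_factor \<nu> (l n)) \<le> 1"
        using l1[of "i \<nu>"] l1[of n] il[OF \<nu>] by (intro norm_blaschke_factor_le_1) auto
    qed auto
    finally show ?thesis by (simp add: prod_norm)
  qed
  then show ?thesis using l(1,2) by (intro exI[of _ l]) simp
qed

context stolz_blaschke
begin

definition log_blaschke :: "complex \<Rightarrow> real" where
  "log_blaschke \<mu> = ln (inverse (cmod (blaschke_product_omit \<Lambda> \<mu> \<mu>)))"

lemma norm_blaschke_product_omit:
  assumes "\<mu> \<in> \<Lambda>"
  shows "0 < cmod (blaschke_product_omit \<Lambda> \<mu> \<mu>)" "cmod (blaschke_product_omit \<Lambda> \<mu> \<mu>) \<le> 1"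
  unfolding blaschke_product_omit_eq
  using blaschke_product_nonzero[of "\<Lambda> - {\<mu>}" \<mu>] norm_blaschke_product_le_1[of "\<Lambda> - {\<mu>}" \<mu>]
    disc[OF assms] ball_notin_E[OF disc[OF assms]] by auto

lemma log_blaschke_nonneg: "\<mu> \<in> \<Lambda> \<Longrightarrow> 0 \<le> log_blaschke \<mu>"
  unfolding log_blaschke_def using norm_blaschke_product_omit[of \<mu>]
  by (simp add: ln_inverse)

text \<open>A single point is a one-term sum, and outside a finite set the Cauchy criterion makes it
  smaller than \<open>\<delta>\<close>. Estimates near the circle thus miss finitely many points
  only.\<close>

lemma finite_inner_part:
  assumes "0 < \<delta>" shows "finite {\<mu>\<in>\<Lambda>. \<delta> \<le> 1 - cmod \<mu>}"
proof -
  obtain F0 where F0: "finite F0" "\<forall>F. finite F \<longrightarrow> F \<subseteq> \<Lambda> \<longrightarrow> F \<inter> F0 = {} \<longrightarrow> (\<Sum>\<mu>\<in>F. 1 - cmod \<mu>) < \<delta>"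
    using summable_on_small_tail[OF summable assms] by blast
  have "\<mu> \<in> F0" if "\<mu> \<in> \<Lambda>" "\<delta> \<le> 1 - cmod \<mu>" for \<mu>
    using F0(2)[rule_format, of "{\<mu>}"] that by auto
  then show ?thesis by (intro finite_subset[OF _ F0(1)]) auto
qed

lemma bounded_on_inner_part:
  fixes \<phi> :: "complex \<Rightarrow> real"
  assumes "0 < \<delta>"
  obtains C where "0 < C" "\<And>\<mu>. \<mu> \<in> \<Lambda> \<Longrightarrow> \<delta> \<le> 1 - cmod \<mu> \<Longrightarrow> \<phi> \<mu> \<le> C"
proof -
  let ?I = "insert 1 (\<phi> ` {\<mu>\<in>\<Lambda>. \<delta> \<le> 1 - cmod \<mu>})"
  have fin: "finite ?I" using finite_inner_part[OF assms] by simp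
  have "1 \<le> Max ?I" using fin by (intro Max_ge) auto
  moreover have "\<phi> \<mu> \<le> Max ?I" if "\<mu> \<in> \<Lambda>" "\<delta> \<le> 1 - cmod \<mu>" for \<mu>
    using fin that by (intro Max_ge) auto
  ultimately show ?thesis using that[of "Max ?I"] by auto
qed

text \<open>The factor \<open>1 - \<bar>\<mu>\<bar>\<close> gained from the last summand makes the coefficients summable.\<close>
lemma interpolation_from_majorant:
  fixes a \<omega> :: "complex \<Rightarrow> complex"
  assumes H: "H holomorphic_on ball 0 1" "continuous_on (cball 0 1 - E) H"
    and maj: "\<And>\<mu>. \<mu> \<in> \<Lambda> \<Longrightarrow> log_plus (cmod (a \<mu>)) + log_blaschke \<mu> + ln (inverse (1 - cmod \<mu>)) \<le> Re (H \<mu>)"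
    and \<omega>: "bounded (\<omega> ` \<Lambda>)"
  obtains g M where "g holomorphic_on ball 0 1" "continuous_on (cball 0 1 - E) g" "0 \<le> M"
    "\<And>z. cmod z < 1 \<Longrightarrow> cmod (g z) \<le> exp (Re (H z) + M)" "\<And>\<mu>. \<mu> \<in> \<Lambda> \<Longrightarrow> g \<mu> = \<omega> \<mu> * a \<mu>"
proof -
  obtain W where W: "0 < W" "\<And>\<mu>. \<mu> \<in> \<Lambda> \<Longrightarrow> cmod (\<omega> \<mu>) \<le> W"
    using \<omega> unfolding bounded_pos by auto
  let ?b = "\<lambda>\<mu>. blaschke_product_omit \<Lambda> \<mu> \<mu>"
  \<comment> \<open>Forced by the target: in \<open>exp (H \<mu>) * G \<mu>\<close> the exponential
    and the Blaschke product at \<open>\<mu>\<close> have to cancel.\<close>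
  define c where "c \<mu> = \<omega> \<mu> * a \<mu> * exp (- H \<mu>) / ?b \<mu>" for \<mu>
  have cle: "cmod (c \<mu>) \<le> W * (1 - cmod \<mu>)" if \<mu>: "\<mu> \<in> \<Lambda>" for \<mu>
  proof -
    have m: "cmod \<mu> < 1" by (rule disc[OF \<mu>])
    have b: "0 < cmod (?b \<mu>)" using norm_blaschke_product_omit[OF \<mu>] by simp
    have e1: "exp (- log_blaschke \<mu>) = cmod (?b \<mu>)" unfolding log_blaschke_def using b by (simp add: ln_inverse)
    have e2: "exp (- ln (inverse (1 - cmod \<mu>))) = 1 - cmod \<mu>" using m by (simp add: ln_inverse)
    have "exp (- Re (H \<mu>)) \<le> exp (- log_plus (cmod (a \<mu>)) + - log_blaschke \<mu> + - ln (inverse (1 - cmod \<mu>)))"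
      using maj[OF \<mu>] by simp
    also have "\<dots> = exp (- log_plus (cmod (a \<mu>))) * cmod (?b \<mu>) * (1 - cmod \<mu>)"
      unfolding exp_add e1 e2 ..
    finally have H': "exp (- Re (H \<mu>)) \<le> exp (- log_plus (cmod (a \<mu>))) * cmod (?b \<mu>) * (1 - cmod \<mu>)" .
    have "cmod (\<omega> \<mu>) * cmod (a \<mu>) * exp (- Re (H \<mu>)) \<le> W * exp (log_plus (cmod (a \<mu>))) * (exp (- log_plus (cmod (a \<mu>))) * cmod (?b \<mu>) * (1 - cmod \<mu>))"
      using W(1) W(2)[OF \<mu>] H' le_exp_log_plus by (intro mult_mono) auto
    also have "\<dots> = W * (1 - cmod \<mu>) * cmod (?b \<mu>)" by (simp add: exp_minus)
    finally have "cmod (\<omega> \<mu>) * cmod (a \<mu>) * exp (- Re (H \<mu>)) \<le> W * (1 - cmod \<mu>) * cmod (?b \<mu>)" .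
    then show ?thesis unfolding c_def using b by (simp add: norm_divide norm_mult divide_simps)
  qed
  have "(\<lambda>\<mu>. cmod (c \<mu>)) summable_on \<Lambda>"
    by (rule summable_on_comparison_test[OF summable_scaled[OF order_refl, of W]]) (use cle in auto)
  then obtain G where G: "G holomorphic_on ball 0 1" "continuous_on (cball 0 1 - E) G"
    "\<And>z. cmod z \<le> 1 \<Longrightarrow> z \<notin> E \<Longrightarrow> cmod (G z) \<le> (\<Sum>\<^sub>\<infinity>\<mu>\<in>\<Lambda>. cmod (c \<mu>))"
    "\<And>\<mu>. \<mu> \<in> \<Lambda> \<Longrightarrow> G \<mu> = c \<mu> * blaschke_product (\<Lambda> - {\<mu>}) \<mu>"
    using bounded_interpolation by metis
  define K where "K = (\<Sum>\<^sub>\<infinity>\<mu>\<in>\<Lambda>. cmod (c \<mu>))"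
  have K: "0 \<le> K" unfolding K_def by (intro infsum_nonneg) auto
  show ?thesis
  proof (rule that[of "\<lambda>z. exp (H z) * G z" K])
    show "(\<lambda>z. exp (H z) * G z) holomorphic_on ball 0 1" by (intro holomorphic_intros H G)
    show "continuous_on (cball 0 1 - E) (\<lambda>z. exp (H z) * G z)" by (intro continuous_intros H G)
    show "cmod (exp (H z) * G z) \<le> exp (Re (H z) + K)" if z: "cmod z < 1" for z
    proof -
      have "cmod (G z) \<le> K" unfolding K_def using G(3)[of z] z ball_notin_E[OF z] by simp
      also have "\<dots> \<le> exp K" using exp_ge_add_one_self[of K] by linarith
      finally show ?thesis by (simp add: norm_mult exp_add)
    qed
    show "exp (H \<mu>) * G \<mu> = \<omega> \<mu> * a \<mu>" if \<mu>: "\<mu> \<in> \<Lambda>" for \<mu>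
      using G(4)[OF \<mu>] norm_blaschke_product_omit(1)[OF \<mu>]
      unfolding c_def blaschke_product_omit_eq by (simp add: exp_minus)
  qed (rule K)
qed

text \<open>All three quantities to be majorised are at most a constant over
  \<open>1 - cmod \<mu>\<close>, and that size is reached by kernels with poles at the
  vertices.\<close>

lemma nevanlinna_sufficient:
  assumes C: "\<And>\<mu>. \<mu> \<in> \<Lambda> \<Longrightarrow> (1 - cmod \<mu>) * log_blaschke \<mu> \<le> C"
  shows "free_interpolating \<Lambda> nevanlinna_class"
  unfolding free_interpolating_iff
proof (intro ballI allI impI)
  fix f and \<omega> :: "complex \<Rightarrow> complex" assume f: "f \<in> nevanlinna_class" and \<omega>: "bounded (\<omega> ` \<Lambda>)"
  obtain \<kappa> where \<kappa>: "0 < \<kappa>" "\<forall>\<^sub>F R in at_left 1. cmean (\<lambda>\<theta>. max 0 (log_plus (cmod (f (of_real R * cis \<theta>))) - 0)) \<le> \<kappa>"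
    using nevanlinna_class_truncated_means[OF f] by blast
  let ?e = "\<lambda>\<mu>. log_plus (cmod (f \<mu>)) + log_blaschke \<mu> + ln (inverse (1 - cmod \<mu>))"
  \<comment> \<open>The summands bound, in this order, the growth of \<open>f\<close>, the Blaschke
    term and \<open>x * ln (inverse x)\<close> on the unit interval.\<close>
  define D where "D = 2 * \<kappa> + \<bar>C\<bar> + 1"
  have eD: "(1 - cmod \<mu>) * ?e \<mu> \<le> D" if \<mu>: "\<mu> \<in> \<Lambda>" for \<mu>
    using log_plus_growth[OF nevanlinna_class_holomorphic[OF f] order_refl less_imp_le[OF \<kappa>(1)] \<kappa>(2) disc[OF \<mu>]]
      C[OF \<mu>] mult_ln_inverse_le[of "1 - cmod \<mu>"] disc[OF \<mu>] abs_ge_self[of C]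
    unfolding D_def distrib_left by simp
  define c where "c k = (1 + A)\<^sup>2 * D * (1/2) ^ k" for k :: nat
  have D: "0 < D" unfolding D_def using \<kappa>(1) by linarith
  have c: "0 \<le> c k" "Series.summable c" for k
    unfolding c_def[abs_def] using D by (auto intro!: summable_mult summable_geometric)
  obtain H where H: "H holomorphic_on ball 0 1" "continuous_on (cball 0 1 - E) H"
    "\<And>z. cmod z \<le> 1 \<Longrightarrow> z \<notin> E \<Longrightarrow> 0 \<le> Re (H z)"
    "\<And>\<mu> k. \<mu> \<in> \<Lambda> \<Longrightarrow> 0 \<le> 1 - cmod \<mu> \<Longrightarrow> c k / ((1 + A)\<^sup>2 * (1 - cmod \<mu>)) \<le> Re (H \<mu>)"
    by (rule positive_majorant[of c "\<lambda>_. 0"]) (use c in auto)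
  have "?e \<mu> \<le> Re (H \<mu>)" if \<mu>: "\<mu> \<in> \<Lambda>" for \<mu>
  proof -
    have x: "0 < 1 - cmod \<mu>" using disc[OF \<mu>] by simp
    have "?e \<mu> \<le> D / (1 - cmod \<mu>)" using eD[OF \<mu>] x by (simp add: pos_le_divide_eq mult.commute)
    also have "\<dots> = c 0 / ((1 + A)\<^sup>2 * (1 - cmod \<mu>))" unfolding c_def using A by simp
    also have "\<dots> \<le> Re (H \<mu>)" using H(4)[OF \<mu>, of 0] x by simp
    finally show ?thesis .
  qed
  then obtain g M where g: "g holomorphic_on ball 0 1" "continuous_on (cball 0 1 - E) g" "0 \<le> M"
    "\<And>z. cmod z < 1 \<Longrightarrow> cmod (g z) \<le> exp (Re (H z) + M)" "\<And>\<mu>. \<mu> \<in> \<Lambda> \<Longrightarrow> g \<mu> = \<omega> \<mu> * f \<mu>"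
    using interpolation_from_majorant[OF H(1,2) _ \<omega>, of f] by metis
  have "g \<in> nevanlinna_class"
    using H(3) ball_notin_E by (intro nevanlinna_class_dominated[OF g(1) H(1) _ g(3,4)]) auto
  then show "\<exists>g\<in>nevanlinna_class. \<forall>\<mu>\<in>\<Lambda>. g \<mu> = \<omega> \<mu> * f \<mu>" using g(5) by blast
qed

text \<open>The quantity to be majorised is now of smaller order than the reciprocal of
  \<open>1 - cmod \<mu>\<close>. Near the circle ever smaller masses therefore suffice, and their
  poles may sit at ever smaller positive distances \<open>s k\<close>. A point is served by the
  first \<open>k\<close> with \<open>s k \<le> 1 - cmod \<mu>\<close>; minimality of
  \<open>k\<close> places the point close enough to the circle for the mass with index
  \<open>k\<close> to be sufficient.\<close>

lemma smirnov_sufficient: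
  assumes C: "\<And>e. 0 < e \<Longrightarrow> \<exists>\<delta>>0. \<forall>\<mu>\<in>\<Lambda>. 1 - cmod \<mu> < \<delta> \<longrightarrow> (1 - cmod \<mu>) * log_blaschke \<mu> \<le> e"
  shows "free_interpolating \<Lambda> smirnov_class"
  unfolding free_interpolating_iff
proof (intro ballI allI impI)
  fix f and \<omega> :: "complex \<Rightarrow> complex" assume f: "f \<in> smirnov_class" and \<omega>: "bounded (\<omega> ` \<Lambda>)"
  have fh: "f holomorphic_on ball 0 1"
    using f smirnov_subset_nevanlinna nevanlinna_class_holomorphic by blast
  let ?e = "\<lambda>\<mu>. log_plus (cmod (f \<mu>)) + log_blaschke \<mu> + ln (inverse (1 - cmod \<mu>))"
  have small: "\<exists>\<delta>>0. \<forall>\<mu>\<in>\<Lambda>. 1 - cmod \<mu> < \<delta> \<longrightarrow> (1 - cmod \<mu>) * ?e \<mu> \<le> \<epsilon>" if \<epsilon>: "\<epsilon> > 0" for \<epsilon>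
  proof -
    \<comment> \<open>Four contributions of \<open>\<epsilon> / 4\<close> each; the truncated mean
      enters the growth bound doubled, hence \<open>\<epsilon> / 8\<close>.\<close>
    have e8: "\<epsilon> / 8 > 0" "\<epsilon> / 4 > 0" using \<epsilon> by auto
    obtain M where M: "0 \<le> M"
      "\<forall>\<^sub>F R in at_left 1. cmean (\<lambda>\<theta>. max 0 (log_plus (cmod (f (of_real R * cis \<theta>))) - M)) \<le> \<epsilon> / 8"
      using smirnov_class_uniformly_integrable[OF f e8(1)] by blast
    obtain \<delta>1 where \<delta>1: "\<delta>1 > 0" "\<forall>\<mu>\<in>\<Lambda>. 1 - cmod \<mu> < \<delta>1 \<longrightarrow> (1 - cmod \<mu>) * log_blaschke \<mu> \<le> \<epsilon> / 4"
      using C[OF e8(2)] by blast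
    obtain \<delta>2 where \<delta>2: "\<delta>2 > 0" "\<And>x. 0 < x \<Longrightarrow> x < \<delta>2 \<Longrightarrow> x * ln (inverse x) \<le> \<epsilon> / 4"
      using mult_ln_inverse_small[OF e8(2)] by blast
    define \<delta>3 where "\<delta>3 = \<epsilon> / 4 / (M + 1)"
    have \<delta>3: "\<delta>3 > 0" unfolding \<delta>3_def using \<epsilon> M by (intro divide_pos_pos) auto
    have "(1 - cmod \<mu>) * ?e \<mu> \<le> \<epsilon>" if \<mu>: "\<mu> \<in> \<Lambda>" and x: "1 - cmod \<mu> < min \<delta>1 (min \<delta>2 \<delta>3)" for \<mu>
    proof -
      have x0: "0 < 1 - cmod \<mu>" using disc[OF \<mu>] by simp
      have "(1 - cmod \<mu>) * M \<le> (1 - cmod \<mu>) * (M + 1)" using x0 by (intro mult_left_mono) auto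
      also have "\<dots> \<le> \<delta>3 * (M + 1)" using x M by (intro mult_right_mono) auto
      also have "\<dots> = \<epsilon> / 4" unfolding \<delta>3_def using M(1)
        by (metis add_nonneg_pos nonzero_eq_divide_eq less_irrefl zero_less_one)
      finally have "(1 - cmod \<mu>) * M \<le> \<epsilon> / 4" .
      moreover have "(1 - cmod \<mu>) * log_plus (cmod (f \<mu>)) \<le> (1 - cmod \<mu>) * M + 2 * (\<epsilon> / 8)"
        using e8 by (intro log_plus_growth[OF fh M(1) _ M(2) disc[OF \<mu>]]) auto
      moreover have "(1 - cmod \<mu>) * log_blaschke \<mu> \<le> \<epsilon> / 4" using \<delta>1(2) \<mu> x by auto
      moreover have "(1 - cmod \<mu>) * ln (inverse (1 - cmod \<mu>)) \<le> \<epsilon> / 4" using \<delta>2(2) x0 x by auto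
      ultimately show ?thesis unfolding distrib_left by linarith
    qed
    then show ?thesis using \<delta>1(1) \<delta>2(1) \<delta>3 by (intro exI[of _ "min \<delta>1 (min \<delta>2 \<delta>3)"]) auto
  qed
  obtain \<delta>0 where \<delta>0: "\<delta>0 > 0" "\<forall>\<mu>\<in>\<Lambda>. 1 - cmod \<mu> < \<delta>0 \<longrightarrow> (1 - cmod \<mu>) * ?e \<mu> \<le> 1"
    using small[of 1] by auto
  obtain D0 where D0: "0 < D0" "\<And>\<mu>. \<mu> \<in> \<Lambda> \<Longrightarrow> \<delta>0 \<le> 1 - cmod \<mu> \<Longrightarrow> (1 - cmod \<mu>) * ?e \<mu> \<le> D0"
    using bounded_on_inner_part[OF \<delta>0(1), of "\<lambda>\<mu>. (1 - cmod \<mu>) * ?e \<mu>"] by blast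
  define D where "D = D0 + 1"
  have D: "0 < D" unfolding D_def using D0 by simp
  have eD: "(1 - cmod \<mu>) * ?e \<mu> \<le> D" if "\<mu> \<in> \<Lambda>" for \<mu>
    using D0(2)[OF that] \<delta>0(2) D0(1) that unfolding D_def by (cases "1 - cmod \<mu> < \<delta>0") force+
  \<comment> \<open>The exponent is shifted by one because a point that misses the pole with index
    \<open>k\<close> is served by a later one. Index 0 is covered by the bound \<open>D\<close>,
    valid on all of \<open>\<Lambda>\<close>.\<close>
  have "\<forall>k::nat. \<exists>\<delta>>0. \<forall>\<mu>\<in>\<Lambda>. 1 - cmod \<mu> < \<delta> \<longrightarrow> (1 - cmod \<mu>) * ?e \<mu> \<le> D * (1/2) ^ Suc k"
    by (intro allI small) (use D in simp)
  from choice[OF this] obtain \<delta> where \<delta>: "\<And>k. 0 < \<delta> k"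
    "\<And>k \<mu>. \<mu> \<in> \<Lambda> \<Longrightarrow> 1 - cmod \<mu> < \<delta> k \<Longrightarrow> (1 - cmod \<mu>) * ?e \<mu> \<le> D * (1/2) ^ Suc k" by blast
  \<comment> \<open>The second entry makes the shifts tend to 0, so every point of
    \<open>\<Lambda>\<close> is served by some pole.\<close>
  define s where "s k = min (\<delta> k) (1 / (real k + 1))" for k
  define c where "c k = (1 + A)\<^sup>2 * D * (1/2) ^ k" for k :: nat
  have s: "0 < s k" "s k \<le> 1" for k unfolding s_def using \<delta>(1) by (auto simp: min_le_iff_disj)
  have c: "0 \<le> c k" "Series.summable c" for k
    unfolding c_def[abs_def] using D by (auto intro!: summable_mult summable_geometric)
  obtain H where H: "H holomorphic_on ball 0 1" "continuous_on (cball 0 1 - E) H"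
    "\<And>z. cmod z \<le> 1 \<Longrightarrow> z \<notin> E \<Longrightarrow> 0 \<le> Re (H z)"
    "integrable circ (\<lambda>\<theta>. Re (H (cis \<theta>)))" "cmean (\<lambda>\<theta>. Re (H (cis \<theta>))) = Re (H 0)"
    "\<And>\<mu> k. \<mu> \<in> \<Lambda> \<Longrightarrow> s k \<le> 1 - cmod \<mu> \<Longrightarrow> c k / ((1 + A)\<^sup>2 * (1 - cmod \<mu>)) \<le> Re (H \<mu>)"
    by (rule positive_majorant[of c s]) (use c s in \<open>auto intro: less_imp_le\<close>)
  have "?e \<mu> \<le> Re (H \<mu>)" if \<mu>: "\<mu> \<in> \<Lambda>" for \<mu>
  proof -
    have x: "0 < 1 - cmod \<mu>" using disc[OF \<mu>] by simp
    obtain n :: nat where "1 / (1 - cmod \<mu>) < real n" using reals_Archimedean2 by blast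
    then have "1 / (real n + 1) \<le> 1 - cmod \<mu>" using x by (simp add: field_simps)
    then have ex: "s n \<le> 1 - cmod \<mu>" unfolding s_def by simp
    define k where "k = (LEAST k. s k \<le> 1 - cmod \<mu>)"
    have k: "s k \<le> 1 - cmod \<mu>" unfolding k_def using ex by (rule LeastI)
    have "(1 - cmod \<mu>) * ?e \<mu> \<le> D * (1/2) ^ k"
    proof (cases k)
      case (Suc j)
      then have "\<not> s j \<le> 1 - cmod \<mu>" unfolding k_def by (metis not_less_Least lessI)
      then have "1 - cmod \<mu> < \<delta> j" unfolding s_def by simp
      then show ?thesis using \<delta>(2)[OF \<mu>] Suc by blast
    qed (use eD[OF \<mu>] in simp)
    then have "?e \<mu> \<le> D * (1/2) ^ k / (1 - cmod \<mu>)" using x by (simp add: pos_le_divide_eq mult.commute)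
    also have "\<dots> = c k / ((1 + A)\<^sup>2 * (1 - cmod \<mu>))" unfolding c_def using A by simp
    also have "\<dots> \<le> Re (H \<mu>)" by (rule H(6)[OF \<mu> k])
    finally show ?thesis .
  qed
  then obtain g M where g: "g holomorphic_on ball 0 1" "continuous_on (cball 0 1 - E) g" "0 \<le> M"
    "\<And>z. cmod z < 1 \<Longrightarrow> cmod (g z) \<le> exp (Re (H z) + M)" "\<And>\<mu>. \<mu> \<in> \<Lambda> \<Longrightarrow> g \<mu> = \<omega> \<mu> * f \<mu>"
    using interpolation_from_majorant[OF H(1,2) _ \<omega>, of f] by metis
  have "g \<in> smirnov_class"
    by (rule smirnov_class_dominated[OF finE g(1,2) H(1,2,3,4,5) circleE g(3,4)])
  then show "\<exists>g\<in>smirnov_class. \<forall>\<mu>\<in>\<Lambda>. g \<mu> = \<omega> \<mu> * f \<mu>" using g(5) by blast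
qed

section \<open>Necessity of the two conditions\<close>

text \<open>Dividing out finitely many zeros of \<open>f\<close> preserves the growth bound, uniformly in their number.\<close>
lemma log_blaschke_le_of_indicator:
  assumes S: "S \<subseteq> \<Lambda>" and \<mu>: "\<mu> \<in> S"
    and sparse: "\<And>F. finite F \<Longrightarrow> F \<subseteq> S - {\<mu>} \<Longrightarrow> 2 / 3 \<le> cmod (\<Prod>\<nu>\<in>F. blaschke_factor \<nu> \<mu>)"
    and f: "f holomorphic_on ball 0 1" "\<And>\<nu>. \<nu> \<in> \<Lambda> \<Longrightarrow> f \<nu> = of_bool (\<nu> \<in> S)"
    and \<kappa>: "\<forall>\<^sub>F R in at_left 1. cmean (\<lambda>\<theta>. max 0 (log_plus (cmod (f (of_real R * cis \<theta>))) - M)) \<le> \<kappa>"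
  shows "(1 - cmod \<mu>) * log_blaschke \<mu> \<le> (1 - cmod \<mu>) * (1 + M) + 2 * \<kappa>"
proof -
  have \<mu>\<Lambda>: "\<mu> \<in> \<Lambda>" using S \<mu> by blast
  have m: "cmod \<mu> < 1" by (rule disc[OF \<mu>\<Lambda>])
  define T where "T = M + 2 / (1 - cmod \<mu>) * \<kappa>"
  \<comment> \<open>Points of \<open>F\<close> inside \<open>S\<close> are handled by sparseness.
    Those outside are zeros of \<open>f\<close>; dividing them out at \<open>\<mu>\<close>, where
    \<open>f\<close> is 1, makes the reciprocal of their product obey the growth bound.\<close>
  have low: "2 / 3 * exp (- T) \<le> cmod (\<Prod>\<nu>\<in>F. blaschke_factor \<nu> \<mu>)" if F: "finite F" "F \<subseteq> \<Lambda> - {\<mu>}" for F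
  proof -
    let ?P = "\<lambda>F. \<Prod>\<nu>\<in>F. blaschke_factor \<nu> \<mu>"
    have F1: "finite (F - S)" "F - S \<subseteq> ball 0 1" using F disc by auto
    have f0: "f \<nu> = 0" if "\<nu> \<in> F - S" for \<nu> using f(2)[of \<nu>] F(2) that by auto
    obtain g where g: "g holomorphic_on ball 0 1"
      "\<And>z. z \<in> ball 0 1 \<Longrightarrow> f z = (\<Prod>\<nu>\<in>F - S. blaschke_factor \<nu> z) * g z"
      using divide_blaschke_zeros[OF F1 f(1) f0] by metis
    have "cmod (g \<mu>) \<le> exp T" unfolding T_def by (rule growth_after_division[OF F1 f(1) g \<kappa> m])
    moreover have "1 = cmod (?P (F - S)) * cmod (g \<mu>)"
    proof -
      have "f \<mu> = 1" using f(2)[OF \<mu>\<Lambda>] \<mu> by simp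
      then have "1 = ?P (F - S) * g \<mu>" using g(2)[of \<mu>] m by simp
      then show ?thesis by (simp flip: norm_mult)
    qed
    ultimately have "1 \<le> cmod (?P (F - S)) * exp T" by (metis mult_left_mono norm_ge_zero)
    then have 1: "exp (- T) \<le> cmod (?P (F - S))" by (simp add: exp_minus divide_simps)
    have 2: "2 / 3 \<le> cmod (?P (F \<inter> S))" using F by (intro sparse) auto
    have "F = (F \<inter> S) \<union> (F - S)" by blast
    then have "?P F = ?P (F \<inter> S) * ?P (F - S)" using F(1) prod.union_disjoint[of "F \<inter> S" "F - S"] by (metis Diff_disjoint finite_Diff finite_Int inf_assoc inf_bot_right)
    then have "cmod (?P F) = cmod (?P (F \<inter> S)) * cmod (?P (F - S))" by (simp add: norm_mult)
    also have "\<dots> \<ge> 2 / 3 * exp (- T)" using 1 2 by (intro mult_mono) auto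
    finally show ?thesis .
  qed
  have "2 / 3 * exp (- T) \<le> cmod (blaschke_product (\<Lambda> - {\<mu>}) \<mu>)"
  proof (rule tendsto_lowerbound[OF tendsto_norm[OF tendsto_blaschke_product]])
    show "\<forall>\<^sub>F F in finite_subsets_at_top (\<Lambda> - {\<mu>}). 2 / 3 * exp (- T) \<le> cmod (\<Prod>\<nu>\<in>F. blaschke_factor \<nu> \<mu>)"
      using low by (intro eventually_finite_subsets_at_top_weakI) auto
  qed (use m ball_notin_E in auto)
  then have "ln (2 / 3 * exp (- T)) \<le> ln (cmod (blaschke_product_omit \<Lambda> \<mu> \<mu>))"
    unfolding blaschke_product_omit_eq by (intro ln_mono) auto
  moreover have "ln (2 / 3 * exp (- T)) = ln (2 / 3) - T" by (subst ln_mult) auto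
  \<comment> \<open>The sparse points cost \<open>ln (3 / 2)\<close>; this is the 1 in
    \<open>1 + M\<close>.\<close>
  moreover have "ln (3 / 2 :: real) \<le> 1" using ln_le_minus_one[of "3 / 2 :: real"] by simp
  moreover have "ln (2 / 3 :: real) = - ln (3 / 2)" using ln_inverse[of "3 / 2 :: real"] by simp
  moreover have "log_blaschke \<mu> = - ln (cmod (blaschke_product_omit \<Lambda> \<mu> \<mu>))"
    unfolding log_blaschke_def using norm_blaschke_product_omit(1)[OF \<mu>\<Lambda>] by (simp add: ln_inverse)
  ultimately have "log_blaschke \<mu> \<le> 1 + T" by linarith
  then have "(1 - cmod \<mu>) * log_blaschke \<mu> \<le> (1 - cmod \<mu>) * (1 + T)" using m by (intro mult_left_mono) auto
  also have "\<dots> = (1 - cmod \<mu>) * (1 + M) + 2 * \<kappa>" unfolding T_def using m by (simp add: distrib_left)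
  finally show ?thesis .
qed

text \<open>The bounded multiplier is the indicator of \<open>S\<close>, applied to the trace of the
  constant 1.\<close>

lemma indicator_interpolation:
  assumes "free_interpolating \<Lambda> X" "(\<lambda>_. 1) \<in> X"
  obtains f where "f \<in> X" "\<And>\<nu>. \<nu> \<in> \<Lambda> \<Longrightarrow> f \<nu> = of_bool (\<nu> \<in> S)"
proof -
  have "bounded ((\<lambda>\<nu>. of_bool (\<nu> \<in> S) :: complex) ` \<Lambda>)" by (rule finite_imp_bounded[OF finite_subset[of _ "{0, 1}"]]) auto
  then show ?thesis
    using assms(1)[unfolded free_interpolating_iff, rule_format, OF assms(2)] that by force
qed

text \<open>One function \<open>f\<close> takes care of the entire sequence \<open>l\<close>, so one
  \<open>\<kappa>\<close> bounds the weighted logarithm at every \<open>l n\<close>, although it was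
  chosen to exceed \<open>real n\<close> there. No uniform interpolation constant has to be
  found.\<close>

lemma nevanlinna_necessary:
  assumes free: "free_interpolating \<Lambda> nevanlinna_class"
  shows "\<exists>C. \<forall>\<mu>\<in>\<Lambda>. (1 - cmod \<mu>) * log_blaschke \<mu> \<le> C"
proof (rule ccontr)
  let ?\<phi> = "\<lambda>\<mu>. (1 - cmod \<mu>) * log_blaschke \<mu>"
  assume unb: "\<not> (\<exists>C. \<forall>\<mu>\<in>\<Lambda>. ?\<phi> \<mu> \<le> C)"
  define S where "S n = {\<mu>\<in>\<Lambda>. real n < ?\<phi> \<mu>}" for n :: nat
  have unbS: "\<exists>\<mu>\<in>S n. r < cmod \<mu>" if r: "r < 1" for n r
  proof (rule ccontr)
    assume no: "\<not> (\<exists>\<mu>\<in>S n. r < cmod \<mu>)"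
    obtain C where C: "0 < C" "\<And>\<mu>. \<mu> \<in> \<Lambda> \<Longrightarrow> 1 - r \<le> 1 - cmod \<mu> \<Longrightarrow> ?\<phi> \<mu> \<le> C"
      using bounded_on_inner_part[of "1 - r" ?\<phi>] r by (metis diff_gt_0_iff_gt)
    have "?\<phi> \<mu> \<le> max C (real n)" if "\<mu> \<in> \<Lambda>" for \<mu>
      using C(2)[OF that] no that unfolding S_def by (cases "real n < ?\<phi> \<mu>") force+
    then show False using unb by blast
  qed
  have "\<forall>n. \<forall>r<1. \<exists>\<mu>\<in>S n. r < cmod \<mu>" "\<forall>n. \<forall>\<mu>\<in>S n. cmod \<mu> < 1"
    using unbS disc unfolding S_def by auto
  note ex = sparse_sequence[OF this]
  obtain l where l': "\<forall>n. l n \<in> S n"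
    "\<forall>n F. finite F \<longrightarrow> F \<subseteq> range l - {l n} \<longrightarrow> 2 / 3 \<le> cmod (\<Prod>\<nu>\<in>F. blaschke_factor \<nu> (l n))"
    using ex by blast
  note l = l'[rule_format]
  have sub: "range l \<subseteq> \<Lambda>" using l(1) unfolding S_def by auto
  have "(\<lambda>_. 1) \<in> nevanlinna_class" using one_smirnov_class smirnov_subset_nevanlinna by blast
  then obtain f where f: "f \<in> nevanlinna_class" "\<And>\<nu>. \<nu> \<in> \<Lambda> \<Longrightarrow> f \<nu> = of_bool (\<nu> \<in> range l)"
    using indicator_interpolation[OF free] by metis
  obtain \<kappa> where \<kappa>: "0 < \<kappa>" "\<forall>\<^sub>F R in at_left 1. cmean (\<lambda>\<theta>. max 0 (log_plus (cmod (f (of_real R * cis \<theta>))) - 0)) \<le> \<kappa>"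
    using nevanlinna_class_truncated_means[OF f(1)] by blast
  obtain n where n: "1 + 2 * \<kappa> < real n" using reals_Archimedean2 by blast
  have "?\<phi> (l n) \<le> (1 - cmod (l n)) * (1 + 0) + 2 * \<kappa>"
    by (rule log_blaschke_le_of_indicator[OF sub _ l(2) nevanlinna_class_holomorphic[OF f(1)] f(2) \<kappa>(2)]) auto
  also have "\<dots> \<le> 1 + 2 * \<kappa>" by simp
  finally have "?\<phi> (l n) \<le> 1 + 2 * \<kappa>" .
  moreover have "real n < ?\<phi> (l n)" using l(1)[of n] unfolding S_def by simp
  ultimately show False using n by simp
qed

text \<open>The threshold \<open>e\<close> stays fixed, but the sequence has to approach the circle:
  this removes the term with \<open>M\<close>, which depends on \<open>f\<close> and hence on the
  sequence already chosen, while uniform integrability makes the other term small.\<close>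

lemma smirnov_necessary:
  assumes free: "free_interpolating \<Lambda> smirnov_class" and e: "0 < e"
  shows "\<exists>\<delta>>0. \<forall>\<mu>\<in>\<Lambda>. 1 - cmod \<mu> < \<delta> \<longrightarrow> (1 - cmod \<mu>) * log_blaschke \<mu> \<le> e"
proof (rule ccontr)
  let ?\<phi> = "\<lambda>\<mu>. (1 - cmod \<mu>) * log_blaschke \<mu>"
  assume no: "\<not> ?thesis"
  define S where "S = {\<mu>\<in>\<Lambda>. e < ?\<phi> \<mu>}"
  have unbS: "\<exists>\<mu>\<in>S. r < cmod \<mu>" if "r < 1" for r
  proof -
    have "\<exists>\<mu>\<in>\<Lambda>. 1 - cmod \<mu> < 1 - r \<and> \<not> ?\<phi> \<mu> \<le> e" using no that by (metis diff_gt_0_iff_gt)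
    then show ?thesis unfolding S_def by auto
  qed
  have "\<forall>n::nat. \<forall>r<1. \<exists>\<mu>\<in>S. r < cmod \<mu>" "\<forall>n::nat. \<forall>\<mu>\<in>S. cmod \<mu> < 1"
    using unbS disc unfolding S_def by auto
  note ex = sparse_sequence[OF this]
  obtain l where l': "\<forall>n::nat. l n \<in> S" "\<forall>n. 1 - cmod (l n) < 1 / (real n + 1)"
    "\<forall>n F. finite F \<longrightarrow> F \<subseteq> range l - {l n} \<longrightarrow> 2 / 3 \<le> cmod (\<Prod>\<nu>\<in>F. blaschke_factor \<nu> (l n))"
    using ex by blast
  note l = l'[rule_format]
  have sub: "range l \<subseteq> \<Lambda>" using l(1) unfolding S_def by auto
  obtain f where f: "f \<in> smirnov_class" "\<And>\<nu>. \<nu> \<in> \<Lambda> \<Longrightarrow> f \<nu> = of_bool (\<nu> \<in> range l)"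
    using indicator_interpolation[OF free one_smirnov_class] by metis
  have fh: "f holomorphic_on ball 0 1"
    using f smirnov_subset_nevanlinna nevanlinna_class_holomorphic by blast
  have e4: "e / 4 > 0" using e by simp
  obtain M where M: "0 \<le> M"
    "\<forall>\<^sub>F R in at_left 1. cmean (\<lambda>\<theta>. max 0 (log_plus (cmod (f (of_real R * cis \<theta>))) - M)) \<le> e / 4"
    using smirnov_class_uniformly_integrable[OF f(1) e4] by blast
  \<comment> \<open>Chosen so that the term with \<open>M\<close> takes at most
    \<open>e / 2\<close>; the truncated mean \<open>e / 4\<close>, doubled, takes the other half and
    contradicts the strict inequality defining \<open>S\<close>.\<close>
  obtain n where n: "2 * (1 + M) / e < real n" using reals_Archimedean2 by blast
  have "(1 - cmod (l n)) * (1 + M) \<le> 1 / (real n + 1) * (1 + M)"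
    using l(2)[of n] M by (intro mult_right_mono) auto
  also have "\<dots> \<le> e / 2" using n e by (simp add: field_simps)
  finally have "(1 - cmod (l n)) * (1 + M) \<le> e / 2" .
  moreover have "?\<phi> (l n) \<le> (1 - cmod (l n)) * (1 + M) + 2 * (e / 4)"
    by (rule log_blaschke_le_of_indicator[OF sub _ l(3) fh f(2) M(2)]) auto
  moreover have "e < ?\<phi> (l n)" using l(1)[of n] unfolding S_def by simp
  ultimately show False by simp
qed

end

section \<open>From the locale to the stated form of the conditions\<close>

lemma stolz_blaschke_from_union:
  assumes "\<Lambda> \<subseteq> unit_disc" "(\<lambda>\<mu>. 1 - cmod \<mu>) summable_on \<Lambda>" "in_finite_union_stolz_angles \<Lambda>"
  obtains E A where "stolz_blaschke \<Lambda> E A"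
proof -
  obtain V where V: "finite V" "\<And>\<alpha> \<zeta>. (\<alpha>, \<zeta>) \<in> V \<Longrightarrow> 0 < \<alpha> \<and> cmod \<zeta> = 1"
    "\<Lambda> \<subseteq> (\<Union>(\<alpha>, \<zeta>) \<in> V. stolz_angle \<alpha> \<zeta>)"
    using assms(3) unfolding in_finite_union_stolz_angles_def by fast
  define A where "A = 2 * Max (insert 0 (fst ` V))"
  have A0: "0 \<le> Max (insert 0 (fst ` V))" using V(1) by (intro Max_ge) auto
  have "stolz_blaschke \<Lambda> (snd ` V) A"
  proof
    show "cmod \<mu> < 1" if "\<mu> \<in> \<Lambda>" for \<mu> using assms(1) that by auto
    show "0 \<le> A" unfolding A_def using A0 by simp
    fix \<mu> assume "\<mu> \<in> \<Lambda>"
    then obtain \<alpha> \<zeta> where v: "(\<alpha>, \<zeta>) \<in> V" "\<mu> \<in> stolz_angle \<alpha> \<zeta>" using V(3) by auto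
    have b: "cmod \<mu> < 1" "cmod (\<mu> - \<zeta>) \<le> 2 * \<alpha> * (1 - cmod \<mu>)"
      using stolz_angle_bound[OF v(2)] V(2)[OF v(1)] by auto
    have "\<alpha> \<le> Max (insert 0 (fst ` V))" using V(1) v(1) by (intro Max_ge) force+
    then have "2 * \<alpha> * (1 - cmod \<mu>) \<le> A * (1 - cmod \<mu>)" unfolding A_def using b(1) by (intro mult_right_mono) auto
    then show "\<exists>\<zeta>\<in>snd ` V. cmod (\<mu> - \<zeta>) \<le> A * (1 - cmod \<mu>)" using b(2) v(1) by force
  qed (use V(1,2) assms(2) in auto)
  then show ?thesis using that by blast
qed

text \<open>The filter expresses that the modulus tends to 1 within \<open>\<Lambda>\<close>. If no
  points of \<open>\<Lambda>\<close> approach the circle, it is trivial and both sides hold.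
  Nonnegativity of \<open>\<phi>\<close> reduces the limit to an upper bound.\<close>

lemma tendsto_zero_towards_circle_iff:
  fixes \<phi> :: "complex \<Rightarrow> real"
  assumes "\<And>\<mu>. \<mu> \<in> \<Lambda> \<Longrightarrow> cmod \<mu> < 1" "\<And>\<mu>. \<mu> \<in> \<Lambda> \<Longrightarrow> 0 \<le> \<phi> \<mu>"
  shows "(\<phi> \<longlongrightarrow> 0) (inf (filtercomap cmod (at_left 1)) (principal \<Lambda>)) \<longleftrightarrow>
    (\<forall>e>0. \<exists>\<delta>>0. \<forall>\<mu>\<in>\<Lambda>. 1 - cmod \<mu> < \<delta> \<longrightarrow> \<phi> \<mu> \<le> e)"
proof -
  have ev: "eventually P (inf (filtercomap cmod (at_left 1)) (principal \<Lambda>)) \<longleftrightarrow> (\<exists>\<delta>>0. \<forall>\<mu>\<in>\<Lambda>. 1 - cmod \<mu> < \<delta> \<longrightarrow> P \<mu>)" for P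
  proof
    assume "eventually P (inf (filtercomap cmod (at_left 1)) (principal \<Lambda>))"
    then obtain Q where Q: "eventually Q (at_left 1)" "\<And>\<mu>. Q (cmod \<mu>) \<Longrightarrow> \<mu> \<in> \<Lambda> \<Longrightarrow> P \<mu>"
      unfolding eventually_inf_principal eventually_filtercomap by blast
    then obtain b where b: "b < 1" "\<And>y. b < y \<Longrightarrow> y < 1 \<Longrightarrow> Q y" unfolding eventually_at_left_field by blast
    show "\<exists>\<delta>>0. \<forall>\<mu>\<in>\<Lambda>. 1 - cmod \<mu> < \<delta> \<longrightarrow> P \<mu>"
      using b Q(2) assms(1) by (intro exI[of _ "1 - b"]) auto
  next
    assume "\<exists>\<delta>>0. \<forall>\<mu>\<in>\<Lambda>. 1 - cmod \<mu> < \<delta> \<longrightarrow> P \<mu>"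
    then obtain \<delta> where \<delta>: "\<delta> > 0" "\<And>\<mu>. \<mu> \<in> \<Lambda> \<Longrightarrow> 1 - cmod \<mu> < \<delta> \<Longrightarrow> P \<mu>" by blast
    have "eventually (\<lambda>y. 1 - \<delta> < y) (at_left 1)" using eventually_at_left_real[of "1 - \<delta>" 1] \<delta>(1) by (auto elim: eventually_mono)
    then show "eventually P (inf (filtercomap cmod (at_left 1)) (principal \<Lambda>))"
      unfolding eventually_inf_principal eventually_filtercomap
      by (intro exI[of _ "\<lambda>y. 1 - \<delta> < y"]) (use \<delta>(2) in force)
  qed
  show ?thesis
  proof
    assume L: "(\<phi> \<longlongrightarrow> 0) (inf (filtercomap cmod (at_left 1)) (principal \<Lambda>))"
    show "\<forall>e>0. \<exists>\<delta>>0. \<forall>\<mu>\<in>\<Lambda>. 1 - cmod \<mu> < \<delta> \<longrightarrow> \<phi> \<mu> \<le> e"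
    proof (intro allI impI)
      fix e :: real assume "e > 0"
      from order_tendstoD(2)[OF L this] show "\<exists>\<delta>>0. \<forall>\<mu>\<in>\<Lambda>. 1 - cmod \<mu> < \<delta> \<longrightarrow> \<phi> \<mu> \<le> e"
        unfolding ev by (meson less_imp_le)
    qed
  next
    assume R: "\<forall>e>0. \<exists>\<delta>>0. \<forall>\<mu>\<in>\<Lambda>. 1 - cmod \<mu> < \<delta> \<longrightarrow> \<phi> \<mu> \<le> e"
    show "(\<phi> \<longlongrightarrow> 0) (inf (filtercomap cmod (at_left 1)) (principal \<Lambda>))"
    proof (rule tendstoI)
      fix e :: real assume "e > 0"
      then obtain \<delta> where \<delta>: "\<delta> > 0" "\<And>\<mu>. \<mu> \<in> \<Lambda> \<Longrightarrow> 1 - cmod \<mu> < \<delta> \<Longrightarrow> \<phi> \<mu> \<le> e / 2" using R half_gt_zero by meson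
      show "\<forall>\<^sub>F \<mu> in inf (filtercomap cmod (at_left 1)) (principal \<Lambda>). dist (\<phi> \<mu>) 0 < e"
        unfolding ev using \<delta> assms(2) \<open>e > 0\<close> by (intro exI[of _ \<delta>]) fastforce
    qed
  qed
qed

text \<open>The supremum is taken in the extended reals, where an unbounded family really has
  supremum infinity and the empty one minus infinity.\<close>

lemma SUP_ereal_finite_iff: "(SUP x\<in>X. ereal (\<phi> x)) < \<infinity> \<longleftrightarrow> (\<exists>C. \<forall>x\<in>X. \<phi> x \<le> C)"
proof
  assume "(SUP x\<in>X. ereal (\<phi> x)) < \<infinity>"
  then obtain C where C: "(SUP x\<in>X. ereal (\<phi> x)) < ereal C" using ereal_dense2 by blast
  show "\<exists>C. \<forall>x\<in>X. \<phi> x \<le> C"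
  proof (intro exI ballI)
    fix x assume "x \<in> X"
    then have "ereal (\<phi> x) \<le> (SUP x\<in>X. ereal (\<phi> x))" by (rule SUP_upper)
    also note C
    finally show "\<phi> x \<le> C" by simp
  qed
next
  assume "\<exists>C. \<forall>x\<in>X. \<phi> x \<le> C"
  then obtain C where C: "\<And>x. x \<in> X \<Longrightarrow> \<phi> x \<le> C" by blast
  have "(SUP x\<in>X. ereal (\<phi> x)) \<le> ereal C" by (rule SUP_least) (use C in simp)
  also have "\<dots> < \<infinity>" by simp
  finally show "(SUP x\<in>X. ereal (\<phi> x)) < \<infinity>" .
qed

theorem proposition1p11:
  fixes \<Lambda> :: "complex set"
  assumes "\<Lambda> \<subseteq> unit_disc"
    and "\<Lambda> sparse_in unit_disc"
    and "(\<lambda>\<mu>. 1 - cmod \<mu>) summable_on \<Lambda>"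
    and "in_finite_union_stolz_angles \<Lambda>"
  shows "(free_interpolating \<Lambda> smirnov_class \<longleftrightarrow>
            ((\<lambda>\<mu>. (1 - cmod \<mu>) * ln (inverse (cmod (blaschke_product_omit \<Lambda> \<mu> \<mu>)))) \<longlongrightarrow> 0)
              (inf (filtercomap cmod (at_left 1)) (principal \<Lambda>))) \<and>
         (free_interpolating \<Lambda> nevanlinna_class \<longleftrightarrow>
            (SUP \<mu>\<in>\<Lambda>. ereal ((1 - cmod \<mu>) * ln (inverse (cmod (blaschke_product_omit \<Lambda> \<mu> \<mu>))))) < \<infinity>)"
proof -
  obtain E A where "stolz_blaschke \<Lambda> E A" using stolz_blaschke_from_union[OF assms(1,3,4)] .
  then interpret stolz_blaschke \<Lambda> E A .
  have nonneg: "0 \<le> (1 - cmod \<mu>) * log_blaschke \<mu>" if "\<mu> \<in> \<Lambda>" for \<mu>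
    using disc[OF that] log_blaschke_nonneg[OF that] by simp
  have limit_iff: "((\<lambda>\<mu>. (1 - cmod \<mu>) * log_blaschke \<mu>) \<longlongrightarrow> 0) (inf (filtercomap cmod (at_left 1)) (principal \<Lambda>)) \<longleftrightarrow>
      (\<forall>e>0. \<exists>\<delta>>0. \<forall>\<mu>\<in>\<Lambda>. 1 - cmod \<mu> < \<delta> \<longrightarrow> (1 - cmod \<mu>) * log_blaschke \<mu> \<le> e)"
    by (rule tendsto_zero_towards_circle_iff) (use disc nonneg in auto)
  have "free_interpolating \<Lambda> smirnov_class \<longleftrightarrow>
      ((\<lambda>\<mu>. (1 - cmod \<mu>) * log_blaschke \<mu>) \<longlongrightarrow> 0) (inf (filtercomap cmod (at_left 1)) (principal \<Lambda>))"
    unfolding limit_iff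
  proof (intro iffI allI impI)
    fix e :: real assume "free_interpolating \<Lambda> smirnov_class" "0 < e"
    then show "\<exists>\<delta>>0. \<forall>\<mu>\<in>\<Lambda>. 1 - cmod \<mu> < \<delta> \<longrightarrow> (1 - cmod \<mu>) * log_blaschke \<mu> \<le> e" by (rule smirnov_necessary)
  next
    assume "\<forall>e>0. \<exists>\<delta>>0. \<forall>\<mu>\<in>\<Lambda>. 1 - cmod \<mu> < \<delta> \<longrightarrow> (1 - cmod \<mu>) * log_blaschke \<mu> \<le> e"
    then show "free_interpolating \<Lambda> smirnov_class" by (intro smirnov_sufficient) simp
  qed
  moreover have "free_interpolating \<Lambda> nevanlinna_class \<longleftrightarrow>
      (SUP \<mu>\<in>\<Lambda>. ereal ((1 - cmod \<mu>) * log_blaschke \<mu>)) < \<infinity>"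
    unfolding SUP_ereal_finite_iff using nevanlinna_sufficient nevanlinna_necessary by blast
  ultimately show ?thesis unfolding log_blaschke_def by blast
qed

end
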